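(* Assume that $F\in\mathcal{F}$. Then $F\in\mathcal{F}_{\mathrm{dist}}^{\mathrm{fid}}$ if and only if there exists $t_0>0$ such that $F^{\boxplus t}\in\mathcal{F}_{\mathrm{rr}}^{0}$ for every $t\in(0,t_0)$.
   Context: $\mathcal{F}$ is the set of rational functions $F(w)=wP(w)/Q(w)$, where $P,Q\in\mathbb{R}[w]$ are relatively prime polynomials with $P(0)=Q(0)=1$. For $F\in\mathcal{F}$ let $D(z)=z\sum_{n\ge0}s_n(F)z^n$ be the compositional inverse of $F$ near $0$ ($F(D(z))=z$, $D(0)=0$). $\mathcal{F}_{\mathrm{dist}}$ is the set of $F\in\mathcal{F}$ for which there is a probability distribution $\mu$ on $\mathbb{R}$ with $s_n(F)=\int_{\mathbb{R}}x^n\,\mu(dx)$ for all $n\ge0$; then $\mu$ is compactly supported, unique, and denoted $\mu(F)$. The $R$-transform of $F\in\mathcal{F}$ is $R(w)=\frac{w}{F(w)}-1$; for $F\in\mathcal{F}_{\mathrm{dist}}$ it coincides with the free $R$-transform of $\mu(F)$. For $t\in\mathbb{R}$, $F^{\boxplus t}(w)=\frac{w}{1+tR(w)}\in\mathcal{F}$. A compactly supported probability distribution $\mu$ on $\mathbb{R}$ is freely infinitely divisible if for every $n\in\mathbb{N}$ there is a compactly supported probability distribution $\mu_n$ with $\mu=\mu_n^{\boxplus n}$ ($n$-fold additive free convolution), i.e. whose free $R$-transforms satisfy $R_\mu=n R_{\mu_n}$. $\mathcal{F}_{\mathrm{dist}}^{\mathrm{fid}}$ is the set of $F\in\mathcal{F}_{\mathrm{dist}}$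 such that $\mu(F)$ is freely infinitely divisible. The characteristic polynomial of $F=wP/Q\in\mathcal{F}$ is $\chi_F(w)=\big(P(w)+wP'(w)\big)Q(w)-wP(w)Q'(w)$, and $\mathcal{F}_{\mathrm{rr}}^{0}$ is the set of $F\in\mathcal{F}$ such that all complex roots of $\chi_F$ are real. *)

theory Defs
  imports
    "HOL-Computational_Algebra.Polynomial_Factorial"
    "HOL-Computational_Algebra.Polynomial_FPS"
    "HOL-Computational_Algebra.Field_as_Ring"
    "HOL-Probability.Probability"
begin

text \<open>Rational functions over the reals are elements of the fraction field of
  \<^typ>\<open>real poly\<close>.\<close>

definition fract_var :: "real poly fract" where
  "fract_var = to_fract [:0, 1:]"

text \<open>\<open>F = w P / Q\<close> in lowest terms, normalised by \<open>P(0) = Q(0) = 1\<close>; this determines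
  \<open>P\<close> and \<open>Q\<close>.\<close>

definition is_rep :: "real poly \<Rightarrow> real poly \<Rightarrow> real poly fract \<Rightarrow> bool" where
  "is_rep P Q F \<longleftrightarrow> coprime P Q \<and> poly P 0 = 1 \<and> poly Q 0 = 1 \<and>
     F = fract_var * to_fract P / to_fract Q"

definition Frat :: "real poly fract set" where
  "Frat = {F. \<exists>P Q. is_rep P Q F}"

lemma is_rep_unique:
  assumes "is_rep P Q F" "is_rep P' Q' F"
  shows "P = P' \<and> Q = Q'"
proof -
  from assms have nz: "P \<noteq> 0" "Q \<noteq> 0" "P' \<noteq> 0" "Q' \<noteq> 0"
    by (auto simp: is_rep_def)
  have v: "fract_var \<noteq> 0" by (simp add: fract_var_def)
  have "fract_var * to_fract P / to_fract Q = fract_var * to_fract P' / to_fract Q'"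
    using assms by (metis is_rep_def)
  then have "to_fract (P * Q') = to_fract (P' * Q)"
    using nz v by (simp add: field_simps)
  then have eq: "P * Q' = P' * Q" by (simp only: to_fract_eq_iff)
  have cop: "coprime P Q" "coprime P' Q'" using assms by (simp_all add: is_rep_def)
  have "P dvd P' * Q" unfolding eq[symmetric] by (rule dvd_triv_left)
  then have "P dvd P'" by (simp only: coprime_dvd_mult_left_iff[OF cop(1)])
  then obtain c where c: "P' = P * c" by (auto elim: dvdE)
  have "P' dvd P * Q'" unfolding eq by (rule dvd_triv_left)
  then have "P' dvd P" by (simp only: coprime_dvd_mult_left_iff[OF cop(2)])
  then have "P * c dvd P * 1" by (simp only: c mult_1_right)
  then have "is_unit c" using nz(1) by (simp only: dvd_mult_cancel_left) simp
  then obtain a where a: "c = [:a:]" by (rule is_unit_polyE)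
  have "poly P' 0 = poly P 0 * a" using c a by simp
  then have "a = 1" using assms by (simp add: is_rep_def)
  then have P: "P = P'" using c a by simp
  then have "P * Q' = P * Q" using eq by (simp only: P)
  then show ?thesis using P nz(1) by (simp only: mult_cancel_left) simp
qed

definition rep_num :: "real poly fract \<Rightarrow> real poly" where
  "rep_num F = (THE P. \<exists>Q. is_rep P Q F)"

definition rep_den :: "real poly fract \<Rightarrow> real poly" where
  "rep_den F = (THE Q. \<exists>P. is_rep P Q F)"

lemma rep_num_eq: "is_rep P Q F \<Longrightarrow> rep_num F = P"
  unfolding rep_num_def by (rule the_equality) (auto dest: is_rep_unique)

lemma rep_den_eq: "is_rep P Q F \<Longrightarrow> rep_den F = Q"
  unfolding rep_den_def by (rule the_equality) (auto dest: is_rep_unique)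

text \<open>The Taylor expansion at 0. Since \<open>F\<close> has derivative 1 there, the Taylor series of its
  compositional inverse near 0 is the compositional inverse of this series.\<close>

definition fps_of_rat :: "real poly fract \<Rightarrow> real fps" where
  "fps_of_rat F = fps_X * fps_of_poly (rep_num F) / fps_of_poly (rep_den F)"

definition comp_inverse :: "real poly fract \<Rightarrow> real fps" where
  "comp_inverse F = fps_inv (fps_of_rat F)"

definition s_coeff :: "nat \<Rightarrow> real poly fract \<Rightarrow> real" where
  "s_coeff n F = fps_nth (comp_inverse F) (Suc n)"

lemma fps_of_rat_nth:
  assumes "F \<in> Frat"
  shows "fps_nth (fps_of_rat F) 0 = 0" "fps_nth (fps_of_rat F) 1 = 1"
proof -
  from assms obtain P Q where r: "is_rep P Q F" by (auto simp: Frat_def)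
  then have 0: "coeff P 0 = 1" "coeff Q 0 = 1" by (auto simp: is_rep_def poly_0_coeff_0)
  then have "fps_of_rat F = fps_X * (fps_of_poly P * inverse (fps_of_poly Q))"
    using rep_num_eq[OF r] rep_den_eq[OF r]
    by (simp add: fps_of_rat_def fps_divide_unit mult.assoc)
  then show "fps_nth (fps_of_rat F) 0 = 0" "fps_nth (fps_of_rat F) 1 = 1"
    using 0 by auto
qed

lemma comp_inverse_is_inverse:
  assumes "F \<in> Frat"
  shows "fps_nth (comp_inverse F) 0 = 0" "fps_of_rat F oo comp_inverse F = fps_X"
  using fps_of_rat_nth[OF assms] fps_inv_right[of "fps_of_rat F"]
  by (auto simp: comp_inverse_def fps_inv_def)

definition has_moments :: "real measure \<Rightarrow> (nat \<Rightarrow> real) \<Rightarrow> bool" where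
  "has_moments \<mu> m \<longleftrightarrow>
     (\<forall>n. integrable \<mu> (\<lambda>x. x ^ n) \<and> m n = (\<integral>x. x ^ n \<partial>\<mu>))"

definition Fdist :: "real poly fract set" where
  "Fdist = {F \<in> Frat. \<exists>\<mu>. real_distribution \<mu> \<and> has_moments \<mu> (\<lambda>n. s_coeff n F)}"

text \<open>Meaningful for \<open>F \<in> Fdist\<close>, where the distribution is unique: the coefficients
  \<open>s_coeff n F\<close> grow at most exponentially.\<close>

definition mu_of :: "real poly fract \<Rightarrow> real measure" where
  "mu_of F = (THE \<mu>. real_distribution \<mu> \<and> has_moments \<mu> (\<lambda>n. s_coeff n F))"

definition R_rat :: "real poly fract \<Rightarrow> real poly fract" where
  "R_rat F = fract_var / F - 1"

definition boxplus_power :: "real poly fract \<Rightarrow> real \<Rightarrow> real poly fract" where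
  "boxplus_power F t = fract_var / (1 + to_fract [:t:] * R_rat F)"

definition compact_distribution :: "real measure \<Rightarrow> bool" where
  "compact_distribution \<mu> \<longleftrightarrow>
     real_distribution \<mu> \<and> (\<exists>K. compact K \<and> measure \<mu> K = 1)"

text \<open>The free R-transform of a compactly supported distribution, as a power series.
  With \<open>D(z) = z * (\<Sum>n. m\<^sub>n * z ^ n)\<close>, where \<open>m\<^sub>n\<close> are the moments, and \<open>F\<close> the
  compositional inverse of \<open>D\<close>, it is \<open>R(w) = w / F(w) - 1\<close>. It is normalised so that
  the n-th coefficient is the n-th free cumulant, i.e. it equals \<open>w\<close> times
  Voiculescu's R-transform.\<close>

definition free_R :: "real measure \<Rightarrow> real fps" where
  "free_R \<mu> = fps_X / fps_inv (fps_X * Abs_fps (\<lambda>n. \<integral>x. x ^ n \<partial>\<mu>)) - 1"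

text \<open>That \<open>\<mu>\<close> is the n-fold additive free convolution of \<open>\<nu>\<close> with itself is expressed
  by the additivity of the free R-transform.\<close>

definition free_conv_root :: "nat \<Rightarrow> real measure \<Rightarrow> real measure \<Rightarrow> bool" where
  "free_conv_root n \<mu> \<nu> \<longleftrightarrow> free_R \<mu> = of_nat n * free_R \<nu>"

definition freely_infinitely_divisible :: "real measure \<Rightarrow> bool" where
  "freely_infinitely_divisible \<mu> \<longleftrightarrow> compact_distribution \<mu> \<and>
     (\<forall>n\<ge>1. \<exists>\<nu>. compact_distribution \<nu> \<and> free_conv_root n \<mu> \<nu>)"

definition Fdist_fid :: "real poly fract set" where
  "Fdist_fid = {F \<in> Fdist. freely_infinitely_divisible (mu_of F)}"

definition charpoly_rat :: "real poly fract \<Rightarrow> real poly" where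
  "charpoly_rat F = (let P = rep_num F; Q = rep_den F; w = [:0, 1:] in
     (P + w * pderiv P) * Q - w * P * pderiv Q)"

definition Frr0 :: "real poly fract set" where
  "Frr0 = {F \<in> Frat.
     \<forall>z::complex. poly (map_poly complex_of_real (charpoly_rat F)) z = 0 \<longrightarrow> z \<in> \<real>}"

lemma boxplus_power_rep:
  assumes r: "is_rep P Q F" and t: "t \<noteq> 0"
  shows "is_rep P (P + smult t (Q - P)) (boxplus_power F t)"
proof -
  let ?S = "P + smult t (Q - P)"
  have nz: "P \<noteq> 0" "Q \<noteq> 0" "poly ?S 0 = 1" using r by (auto simp: is_rep_def)
  have v: "fract_var \<noteq> 0" by (simp add: fract_var_def)
  have "coprime P ?S"
  proof (rule coprimeI)
    fix d assume d: "d dvd P" "d dvd ?S"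
    then have "d dvd smult t (Q - P)" by (simp add: dvd_add_right_iff)
    then have "d dvd Q - P" using t by (simp add: dvd_smult_iff)
    then have "d dvd Q" using dvd_add[of d "Q - P" P] d by simp
    then show "is_unit d" using r d coprime_common_divisor[of P Q d] by (simp add: is_rep_def)
  qed
  moreover have "boxplus_power F t = fract_var * to_fract P / to_fract ?S"
  proof -
    have "R_rat F = (to_fract Q - to_fract P) / to_fract P"
    proof -
      have F: "F = fract_var * to_fract P / to_fract Q" using r by (simp add: is_rep_def)
      have "to_fract P \<noteq> 0" "to_fract Q \<noteq> 0" using nz by simp_all
      then have "fract_var / F = to_fract Q / to_fract P" unfolding F using v by simp
      then show ?thesis using \<open>to_fract P \<noteq> 0\<close> by (simp add: R_rat_def diff_divide_distrib)
    qed
    moreover have "to_fract ?S = to_fract P + to_fract [:t:] * (to_fract Q - to_fract P)"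
    proof -
      have "smult t (Q - P) = [:t:] * (Q - P)" by simp
      then show ?thesis by (simp only: to_fract_add to_fract_mult to_fract_diff)
    qed
    ultimately have "1 + to_fract [:t:] * R_rat F = to_fract ?S / to_fract P"
      using nz by (simp add: add_divide_distrib)
    then show ?thesis by (simp add: boxplus_power_def)
  qed
  ultimately show ?thesis using r nz by (simp add: is_rep_def)
qed

end

(* Write R / w = r. Both sides of the equivalence say that r has the rational Levy form
   r(w) = a + sum_x c_x w / (1 - x w) with finitely many real x and c_x > 0.

   In u = 1/w the roots of the characteristic polynomial of F^{boxplus t} are the solutions of
   - g'(u) = 1/t for g(u) = r(1/u). As t -> 0 they cluster at the poles of g, and m + 1 of them
   leave a pole of order m in equally spaced directions; all of them are real only if the pole is
   real, m = 1 and the residue is positive. Conversely, simple real poles with positive residues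
   give two real solutions near each pole, which is all of them.

   If mu(F) has n-th roots nu_n, then n times the k-th moment of nu_n converges to the k-th free
   cumulant, so the shifted cumulants form a positive Hankel form; it has finite rank because R is
   rational, hence comes from finitely many positive point masses. Conversely, for the Levy form
   the iteration G -> 1 / (z - a - sum_x c_x G / (1 - x G)) maps Cauchy transforms of finitely
   supported probability measures to such transforms with uniformly bounded support, and its
   moments eventually agree with s_n(F); a weak limit (Helly) has these moments. *)
theory Submission
  imports Defs "HOL-Computational_Algebra.Fundamental_Theorem_Algebra"
begin

section \<open>Real polynomials with real roots\<close>

text \<open>With Q - P = w N1 and r = N1 / P, the characteristic polynomial of the t-th free power,
  divided by P^2, is 1 - t w^2 r'(w), and w^2 r'(w) = - g'(u). The variable u is preferred because r
  may have a pole at w = infinity; in u this is the node 0, the semicircular part, and needs no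
  separate treatment. Scaling R by 1/n keeps the Levy form. So it is enough to produce a measure for
  every F in Levy form: the n-th free root of mu(F) is the measure of the free power with exponent
  1/n. The obstacle is to keep the iterates measures. Each iterate is a rational function that maps
  the upper half-plane to the lower one, and this alone forces real simple poles with positive
  residues. A bound on the real axis outside a fixed interval keeps the poles inside it. The
  remaining comparison with s_n(F) is formal, as power series modulo powers of the variable. An
  exponential bound on s_n(F) makes mu(F) unique and compactly supported.\<close>

abbreviation cpoly :: "real poly \<Rightarrow> complex poly" where
  "cpoly \<equiv> map_poly complex_of_real"

lemma cpoly_add [simp]: "cpoly (p + q) = cpoly p + cpoly q"
  by (intro poly_eqI) (simp add: coeff_map_poly)

lemma cpoly_diff [simp]: "cpoly (p - q) = cpoly p - cpoly q"
  by (intro poly_eqI) (simp add: coeff_map_poly)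

lemma cpoly_mult [simp]: "cpoly (p * q) = cpoly p * cpoly q"
  by (intro poly_eqI) (simp add: coeff_map_poly coeff_mult)

lemma cpoly_smult [simp]: "cpoly (smult c p) = smult (of_real c) (cpoly p)"
  by (intro poly_eqI) (simp add: coeff_map_poly)

lemma cpoly_pCons [simp]: "cpoly (pCons c p) = pCons (of_real c) (cpoly p)"
  by (intro poly_eqI) (simp add: coeff_map_poly coeff_pCons split: nat.splits)

lemma cpoly_sum [simp]: "cpoly (\<Sum>x\<in>I. f x) = (\<Sum>x\<in>I. cpoly (f x))"
  by (induction I rule: infinite_finite_induct) auto

lemma cpoly_prod [simp]: "cpoly (\<Prod>x\<in>I. f x) = (\<Prod>x\<in>I. cpoly (f x))"
  by (induction I rule: infinite_finite_induct) auto

lemma cpoly_power [simp]: "cpoly (p ^ n) = cpoly p ^ n"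
  by (induction n) auto

lemma cpoly_pderiv: "cpoly (pderiv p) = pderiv (cpoly p)"
  by (intro poly_eqI) (simp add: coeff_map_poly coeff_pderiv)

lemma cpoly_eq_0_iff [simp]: "cpoly p = 0 \<longleftrightarrow> p = 0"
  by (rule map_poly_eq_0_iff) auto

lemma cpoly_eq_iff [simp]: "cpoly p = cpoly q \<longleftrightarrow> p = q"
  using cpoly_eq_0_iff[of "p - q"] by (simp del: cpoly_eq_0_iff)

lemma degree_cpoly [simp]: "degree (cpoly p) = degree p"
  by (rule degree_map_poly) auto

lemma poly_cpoly_of_real [simp]: "poly (cpoly p) (of_real x) = of_real (poly p x)"
  by (induction p) auto

lemma poly_cpoly_cnj: "poly (cpoly p) (cnj z) = cnj (poly (cpoly p) z)"
  by (induction p) auto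

text \<open>A Bezout identity over the reals stays valid at complex points.\<close>

lemma coprime_imp_no_common_root:
  assumes "coprime p q" "poly (cpoly p) z = 0"
  shows "poly (cpoly q) z \<noteq> 0"
proof
  assume "poly (cpoly q) z = 0"
  moreover obtain a b where "a * p + b * q = 1"
    using bezout_coefficients_fst_snd[of p q] assms(1) by (metis coprime_imp_gcd_eq_1)
  then have "poly (cpoly (a * p + b * q)) z = 1" by simp
  ultimately show False using assms(2) by simp
qed

text \<open>The remainder modulo the real quadratic is linear with real coefficients and vanishes at
  z; its imaginary part at z forces the slope to be 0, and then the constant.\<close>

lemma nonreal_root_dvd:
  assumes "poly (cpoly p) z = 0" "z \<notin> \<real>"
  shows "[:(Re z)\<^sup>2 + (Im z)\<^sup>2, - 2 * Re z, 1:] dvd p"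
proof -
  define q where "q = [:(Re z)\<^sup>2 + (Im z)\<^sup>2, - 2 * Re z, 1:]"
  define r where "r = p mod q"
  have "degree r < 2" using degree_mod_less[of q p] by (auto simp: q_def r_def)
  then have r: "r = [:coeff r 0, coeff r 1:]"
    by (intro poly_eqI) (auto simp: coeff_pCons coeff_eq_0 split: nat.splits)
  have "poly (cpoly q) z = 0"
    by (auto simp: q_def complex_eq_iff power2_eq_square algebra_simps)
  moreover have "p = q * (p div q) + r" by (simp add: r_def)
  then have "poly (cpoly p) z = poly (cpoly (q * (p div q) + r)) z" by simp
  ultimately have "poly (cpoly r) z = 0" using assms by simp
  then have e: "of_real (coeff r 0) + z * of_real (coeff r 1) = 0" by (subst (asm) r) simp
  then have "Im z * coeff r 1 = 0" by (simp add: complex_eq_iff)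
  moreover have "Im z \<noteq> 0" using assms by (simp add: complex_is_Real_iff)
  ultimately have "coeff r 1 = 0" by simp
  with e have "coeff r 0 = 0" by simp
  with \<open>coeff r 1 = 0\<close> have "r = 0" by (subst r) simp
  then show ?thesis by (auto simp: r_def q_def)
qed

section \<open>Polynomials with real simple roots and partial fractions\<close>

definition node_poly :: "real set \<Rightarrow> real poly" where
  "node_poly X = (\<Prod>x\<in>X. [:- x, 1:])"

lemma poly_node_poly: "poly (node_poly X) u = (\<Prod>x\<in>X. u - x)"
  by (simp add: node_poly_def poly_prod)

lemma poly_cpoly_node_poly: "poly (cpoly (node_poly X)) u = (\<Prod>x\<in>X. u - of_real x)"
  by (simp add: node_poly_def poly_prod)

lemma node_poly_remove:
  "finite X \<Longrightarrow> x \<in> X \<Longrightarrow> node_poly X = [:- x, 1:] * node_poly (X - {x})"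
  unfolding node_poly_def by (rule prod.remove)

lemma node_poly_monic [simp]: "lead_coeff (node_poly X) = 1"
  unfolding node_poly_def by (simp add: lead_coeff_prod)

lemma node_poly_nonzero [simp]: "node_poly X \<noteq> 0"
  by (metis node_poly_monic leading_coeff_0_iff zero_neq_one)

lemma degree_node_poly [simp]: "degree (node_poly X) = card X"
  unfolding node_poly_def by (subst degree_prod_eq_sum_degree) auto

lemma poly_node_poly_eq_0_iff: "finite X \<Longrightarrow> poly (node_poly X) u = 0 \<longleftrightarrow> u \<in> X"
  by (auto simp: poly_node_poly)

lemma poly_pderiv_node_poly:
  assumes "finite X" "x \<in> X"
  shows "poly (pderiv (node_poly X)) x = poly (node_poly (X - {x})) x"
  by (simp add: node_poly_remove[OF assms] pderiv_mult pderiv_pCons del: mult_pCons_left)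

lemma node_poly_dvd:
  assumes "finite X" "\<And>x. x \<in> X \<Longrightarrow> poly p x = 0"
  shows "node_poly X dvd p"
  using assms
proof (induction X)
  case empty
  then show ?case by (simp add: node_poly_def)
next
  case (insert x X)
  then obtain g where g: "p = node_poly X * g" by (metis dvd_def insertCI)
  have "poly (node_poly X) x \<noteq> 0" using insert by (simp add: poly_node_poly_eq_0_iff)
  then have "poly g x = 0" using insert.prems[of x] g by simp
  then obtain h where "g = [:- x, 1:] * h" by (metis poly_eq_0_iff_dvd dvd_def)
  then have "p = node_poly (insert x X) * h"
    using g insert by (simp add: node_poly_def mult.assoc mult.left_commute del: mult_pCons_left)
  then show ?case by simp
qed

text \<open>Real roots without multiplicity make the complex factorisation square-free with real
  linear factors, so it descends to the reals.\<close>

lemma real_simple_roots_split: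
  assumes "p \<noteq> 0" "\<And>z. poly (cpoly p) z = 0 \<Longrightarrow> z \<in> \<real>"
    "\<And>x. poly p x = 0 \<Longrightarrow> poly (pderiv p) x \<noteq> 0"
  shows "p = smult (lead_coeff p) (node_poly {x. poly p x = 0})"
proof -
  have "rsquarefree (cpoly p)"
    unfolding rsquarefree_roots
  proof (intro allI notI, elim conjE)
    fix z assume z: "poly (cpoly p) z = 0" "poly (pderiv (cpoly p)) z = 0"
    then obtain x where x: "z = of_real x" using assms(2) by (auto elim: Reals_cases)
    have "poly (cpoly (pderiv p)) z = 0" using z by (simp add: cpoly_pderiv)
    then show False using assms(3)[of x] z(1) unfolding x by simp
  qed
  note complex_poly_decompose_rsquarefree[OF this]
  moreover have "{z. poly (cpoly p) z = 0} = of_real ` {x. poly p x = 0}"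
    using assms(2) by (force elim!: Reals_cases)
  moreover have "(\<Prod>z\<in>complex_of_real ` {x. poly p x = 0}. [:- z, 1:]) = cpoly (node_poly {x. poly p x = 0})"
    unfolding node_poly_def by (subst prod.reindex) (auto simp: inj_on_def)
  moreover have "lead_coeff (cpoly p) = of_real (lead_coeff p)" by (simp add: coeff_map_poly)
  ultimately have "cpoly p = cpoly (smult (lead_coeff p) (node_poly {x. poly p x = 0}))"
    by simp
  then show ?thesis by (simp only: cpoly_eq_iff)
qed

text \<open>Lagrange interpolation with one extra term: the multiple of \<open>B\<close> absorbs the
  coefficient of degree \<open>card X\<close>, so the difference of both sides has degree below
  \<open>card X\<close> but vanishes at all nodes.\<close>

lemma partial_fractions_poly:
  assumes X: "finite X" and B: "B = smult l (node_poly X)" and l: "l \<noteq> 0" and A: "degree A \<le> card X"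
  shows "A = smult (coeff A (card X) / l) B
    + (\<Sum>x\<in>X. smult (poly A x / poly (pderiv B) x) (smult l (node_poly (X - {x}))))"
    (is "A = ?R")
proof -
  define T where "T = A - ?R"
  have dB: "poly (pderiv B) x = l * poly (node_poly (X - {x})) x" "poly (node_poly (X - {x})) x \<noteq> 0"
    if "x \<in> X" for x
    using that X by (auto simp: B pderiv_smult poly_pderiv_node_poly poly_node_poly_eq_0_iff)
  have z: "poly T y = 0" if "y \<in> X" for y
  proof -
    have "poly ?R y = (\<Sum>x\<in>X. poly A x / poly (pderiv B) x * (l * poly (node_poly (X - {x})) y))"
      using that X by (simp add: poly_sum B poly_node_poly_eq_0_iff mult.assoc)
    also have "\<dots> = (\<Sum>x\<in>X. if x = y then poly A y else 0)"
      using that X l dB[of y] dB by (intro sum.cong) (auto simp: poly_node_poly_eq_0_iff)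
    also have "\<dots> = poly A y" using that X by simp
    finally show ?thesis by (simp add: T_def)
  qed
  have "coeff T n = 0" if n: "n \<ge> card X" for n
  proof -
    have "coeff (node_poly (X - {x})) n = 0" if "x \<in> X" for x
      using that X n card_Diff1_less[OF X that] by (intro coeff_eq_0) auto
    then have c: "coeff ?R n = coeff A (card X) / l * (l * coeff (node_poly X) n)"
      by (simp add: coeff_sum B)
    show ?thesis
    proof (cases "n = card X")
      case True
      have "coeff (node_poly X) n = 1" using node_poly_monic[of X] True by simp
      with c l True show ?thesis by (simp add: T_def)
    next
      case False
      then have "coeff (node_poly X) n = 0" "coeff A n = 0" using n A by (auto intro!: coeff_eq_0)
      with c show ?thesis by (simp add: T_def)
    qed
  qed
  then have "T = 0 \<or> degree T < card X"
    by (metis leading_coeff_0_iff not_less)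
  moreover have "card X \<le> degree T" if "T \<noteq> 0"
  proof -
    have "card X \<le> card {x. poly T x = 0}"
      using z poly_roots_finite[OF that] by (intro card_mono) auto
    also have "\<dots> \<le> degree T" by (rule card_poly_roots_bound[OF that])
    finally show ?thesis .
  qed
  ultimately have "T = 0" by fastforce
  then show ?thesis by (simp add: T_def)
qed

lemma partial_fractions:
  assumes X: "finite X" and B: "B = smult l (node_poly X)" and l: "l \<noteq> 0" and A: "degree A \<le> card X"
    and u: "poly B u \<noteq> 0"
  shows "poly A u / poly B u = coeff A (card X) / l + (\<Sum>x\<in>X. (poly A x / poly (pderiv B) x) / (u - x))"
proof -
  have e: "l * poly (node_poly (X - {x})) u = poly B u / (u - x)" if "x \<in> X" for x
  proof -
    have "poly B u = (u - x) * (l * poly (node_poly (X - {x})) u)"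
      unfolding B by (subst node_poly_remove[OF X that]) (simp add: algebra_simps)
    then show ?thesis using u by auto
  qed
  have "poly A u = coeff A (card X) / l * poly B u
     + (\<Sum>x\<in>X. poly A x / poly (pderiv B) x * (l * poly (node_poly (X - {x})) u))"
    by (subst partial_fractions_poly[OF X B l A]) (simp add: poly_sum mult.assoc)
  also have "\<dots> = (coeff A (card X) / l + (\<Sum>x\<in>X. (poly A x / poly (pderiv B) x) / (u - x))) * poly B u"
    using e by (simp add: sum_distrib_right ring_distribs)
  finally show ?thesis using u by simp
qed

section \<open>Real-rootedness for small t forces simple real poles\<close>

text \<open>On a small circle around p the function \<open>\<psi>\<close> is almost constant, so the
  imaginary part of \<open>cis (k * \<theta>) * \<psi>\<close> changes sign across
  \<open>\<theta>0\<close> while the real part stays positive. The intermediate value theorem in the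
  angle alone gives a positive real value.\<close>

lemma sector_hit:
  fixes \<psi> :: "complex \<Rightarrow> complex" and k :: nat and \<theta>0 \<rho> \<eta> :: real
  assumes cont: "continuous_on (ball p r) \<psi>" and r: "r > 0" and k: "k > 0"
    and \<theta>0: "\<psi> p * cis (k * \<theta>0) = of_real \<rho>" "\<rho> > 0" and \<eta>: "\<eta> > 0"
  obtains \<epsilon> \<theta> s where "0 < \<epsilon>" "\<epsilon> < \<eta>" "\<bar>\<theta> - \<theta>0\<bar> < \<eta>" "0 < s" "s < \<eta>"
    "(of_real \<epsilon> * cis \<theta>) ^ k * \<psi> (p + of_real \<epsilon> * cis \<theta>) = of_real s"
proof -
  \<comment> \<open>The bound \<open>1 / k\<close> keeps \<open>k * \<delta>\<close> at most 1,
    below pi / 2, so its sine and cosine are positive.\<close>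
  define \<delta> where "\<delta> = min (\<eta> / 2) (1 / k)"
  have \<delta>: "0 < \<delta>" "\<delta> < \<eta>" "k * \<delta> \<le> 1" using \<eta> k by (auto simp: \<delta>_def min_def field_simps)
  have k\<delta>: "0 < k * \<delta>" "k * \<delta> < pi / 2" using \<delta> k pi_half_gt_zero pi_gt3 by (auto intro: le_less_trans)
  \<comment> \<open>The tolerated error: anything below \<open>e\<close> changes neither the sign of
    the imaginary part at the two ends nor the positivity of the real part in between.\<close>
  define e where "e = \<rho> * min (sin (k * \<delta>)) (cos (k * \<delta>))"
  have sc: "sin (k * \<delta>) > 0" "cos (k * \<delta>) > 0"
    using k\<delta> by (auto intro!: sin_gt_zero cos_gt_zero)
  have e: "e > 0" "e \<le> \<rho> * sin (k * \<delta>)" "e \<le> \<rho> * cos (k * \<delta>)"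
    using sc \<theta>0 by (auto simp: e_def)
  have "isCont \<psi> p" using cont r by (simp add: continuous_on_eq_continuous_at)
  then obtain d where d: "d > 0" "\<And>u. dist u p < d \<Longrightarrow> dist (\<psi> u) (\<psi> p) < e"
    using e unfolding continuous_at_eps_delta by blast
  \<comment> \<open>The last bound makes the attained value s smaller than \<open>\<eta>\<close>;
    the bound 1 serves to estimate \<open>\<epsilon> ^ k\<close> by
    \<open>\<epsilon>\<close>.\<close>
  define \<epsilon> where "\<epsilon> = min (min (d / 2) (r / 2)) (min (min (\<eta> / 2) 1) (\<eta> / (2 * (\<rho> + e))))"
  have \<epsilon>: "0 < \<epsilon>" "\<epsilon> < \<eta>" "\<epsilon> < d" "\<epsilon> < r" "\<epsilon> \<le> 1" "\<epsilon> \<le> \<eta> / (2 * (\<rho> + e))"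
    using d r \<eta> e \<theta>0 by (auto simp: \<epsilon>_def min_less_iff_disj)
  have \<epsilon>s: "\<epsilon> * (\<rho> + e) < \<eta>" using \<epsilon>(6) e \<theta>0 \<eta> by (simp add: field_simps)
  define H where "H \<theta> = cis (k * \<theta>) * \<psi> (p + of_real \<epsilon> * cis \<theta>)" for \<theta> :: real
  have nu: "dist (p + of_real \<epsilon> * cis \<theta>) p = \<epsilon>" for \<theta>
    using \<epsilon> by (simp add: dist_norm norm_mult)
  have Hd: "norm (H \<theta> - of_real \<rho> * cis (k * (\<theta> - \<theta>0))) < e" for \<theta>
  proof -
    have "of_real \<rho> * cis (k * (\<theta> - \<theta>0)) = \<psi> p * (cis (k * \<theta>0) * cis (k * (\<theta> - \<theta>0)))"
      using \<theta>0 by (metis mult.assoc)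
    also have "cis (k * \<theta>0) * cis (k * (\<theta> - \<theta>0)) = cis (k * \<theta>)"
      by (simp add: cis_mult algebra_simps)
    finally have "H \<theta> - of_real \<rho> * cis (k * (\<theta> - \<theta>0))
        = cis (k * \<theta>) * (\<psi> (p + of_real \<epsilon> * cis \<theta>) - \<psi> p)"
      by (simp add: H_def algebra_simps)
    then show ?thesis using d(2)[of "p + of_real \<epsilon> * cis \<theta>"] \<epsilon> nu by (simp add: norm_mult dist_norm)
  qed
  have Re: "\<rho> * cos (k * (\<theta> - \<theta>0)) - e < Re (H \<theta>)" for \<theta>
    using Hd[of \<theta>] abs_Re_le_cmod[of "H \<theta> - of_real \<rho> * cis (k * (\<theta> - \<theta>0))"] by simp
  have Im: "\<bar>Im (H \<theta>) - \<rho> * sin (k * (\<theta> - \<theta>0))\<bar> < e" for \<theta>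
    using Hd[of \<theta>] abs_Im_le_cmod[of "H \<theta> - of_real \<rho> * cis (k * (\<theta> - \<theta>0))"] by simp
  have "Im (H (\<theta>0 - \<delta>)) \<le> 0" "0 \<le> Im (H (\<theta>0 + \<delta>))"
    using Im[of "\<theta>0 - \<delta>"] Im[of "\<theta>0 + \<delta>"] e by auto
  moreover have "continuous_on {\<theta>0 - \<delta>..\<theta>0 + \<delta>} (\<lambda>\<theta>. Im (H \<theta>))"
    unfolding H_def using \<epsilon>
    by (intro continuous_intros continuous_on_compose2[OF cont])
       (auto simp: nu dist_commute[of p])
  ultimately obtain \<theta> where \<theta>: "\<theta>0 - \<delta> \<le> \<theta>" "\<theta> \<le> \<theta>0 + \<delta>" "Im (H \<theta>) = 0"
    using IVT'[of "\<lambda>\<theta>. Im (H \<theta>)" "\<theta>0 - \<delta>" 0 "\<theta>0 + \<delta>"] \<delta> by auto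
  have "\<bar>k * (\<theta> - \<theta>0)\<bar> \<le> k * \<delta>" using \<theta> by (auto simp: abs_mult intro!: mult_left_mono)
  then have "cos (k * \<delta>) \<le> cos \<bar>k * (\<theta> - \<theta>0)\<bar>"
    using k\<delta> by (intro cos_monotone_0_pi_le) auto
  then have "\<rho> * cos (k * \<delta>) \<le> \<rho> * cos (k * (\<theta> - \<theta>0))"
    using \<theta>0 by (simp only: cos_abs_real mult_le_cancel_left_pos)
  then have ReH: "Re (H \<theta>) > 0" using Re[of \<theta>] e by linarith
  have "norm (H \<theta>) \<le> norm (H \<theta> - of_real \<rho> * cis (k * (\<theta> - \<theta>0))) + norm (of_real \<rho> * cis (k * (\<theta> - \<theta>0)))"
    by (metis diff_add_cancel norm_triangle_ineq)
  also have "norm (of_real \<rho> * cis (k * (\<theta> - \<theta>0))) = \<rho>" using \<theta>0 by (simp add: norm_mult)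
  finally have "norm (H \<theta>) < \<rho> + e" using Hd[of \<theta>] by simp
  then have "Re (H \<theta>) < \<rho> + e" using abs_Re_le_cmod[of "H \<theta>"] by simp
  moreover have "\<epsilon> ^ k \<le> \<epsilon>" using power_decreasing[of 1 k \<epsilon>] \<epsilon> k by simp
  ultimately have "\<epsilon> ^ k * Re (H \<theta>) \<le> \<epsilon> * (\<rho> + e)"
    using \<epsilon> ReH by (intro mult_mono) auto
  then have "\<epsilon> ^ k * Re (H \<theta>) < \<eta>" using \<epsilon>s by simp
  moreover have "\<epsilon> ^ k * Re (H \<theta>) > 0" using \<epsilon> ReH by simp
  moreover have "(of_real \<epsilon> * cis \<theta>) ^ k * \<psi> (p + of_real \<epsilon> * cis \<theta>) = of_real (\<epsilon> ^ k * Re (H \<theta>))"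
  proof -
    have "(of_real \<epsilon> * cis \<theta>) ^ k * \<psi> (p + of_real \<epsilon> * cis \<theta>) = of_real (\<epsilon> ^ k) * H \<theta>"
      by (simp add: H_def power_mult_distrib Complex.DeMoivre)
    also have "H \<theta> = of_real (Re (H \<theta>))" using \<theta> by (simp add: complex_eq_iff)
    finally show ?thesis by simp
  qed
  ultimately show ?thesis using \<epsilon> \<theta> \<delta> that[of \<epsilon> \<theta> "\<epsilon> ^ k * Re (H \<theta>)"] by auto
qed

text \<open>Near a pole \<open>p\<close> of order \<open>Suc j\<close> of \<open>A / B\<close>, the function \<open>- 1 / (A / B)'\<close> behaves like
  a constant times \<open>(u - p) ^ (j + 2)\<close>, so it takes small positive values close to every ray on
  which this leading term is positive.\<close>

lemma pole_ray_real:
  fixes A B B1 :: "complex poly" and \<theta>0 \<rho> :: real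
  assumes B: "B = [:- p, 1:] ^ Suc j * B1" and B1: "poly B1 p \<noteq> 0" and A: "poly A p \<noteq> 0"
    and t0: "t0 > 0"
    and nz: "\<And>u t. u \<notin> \<real> \<Longrightarrow> poly B u \<noteq> 0 \<Longrightarrow> 0 < t \<Longrightarrow> t < t0 \<Longrightarrow>
      (poly B u)\<^sup>2 + of_real t * (poly (pderiv A) u * poly B u - poly A u * poly (pderiv B) u) \<noteq> 0"
    and \<theta>0: "poly B1 p / poly A p * cis (Suc (Suc j) * \<theta>0) = of_real \<rho>" "\<rho> > 0"
  shows "p \<in> \<real> \<and> sin \<theta>0 = 0"
proof (rule ccontr)
  assume neg: "\<not> (p \<in> \<real> \<and> sin \<theta>0 = 0)"
  \<comment> \<open>The numerator A'B - AB' of the derivative without its factor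
    \<open>(u - p) ^ j\<close>; at p only - (j + 1) A(p) B1(p) remains.\<close>
  define E where "E = [:- p, 1:] * (pderiv A * B1 - A * pderiv B1) - smult (of_nat (Suc j)) (A * B1)"
  have W: "pderiv A * B - A * pderiv B = [:- p, 1:] ^ j * E"
    unfolding B E_def pderiv_mult pderiv_power_Suc
    by (simp add: pderiv_pCons pCons_one algebra_simps smult_add_left smult_add_right smult_diff_right
        del: mult_pCons_left mult_pCons_right)
  have Ep: "poly E p \<noteq> 0" using A B1 by (simp add: E_def del: of_nat_Suc)
  have "open {u. poly E u \<noteq> 0 \<and> poly B1 u \<noteq> 0}"
    by (intro open_Collect_conj open_Collect_neq continuous_intros)
  then obtain r where r: "r > 0" "\<And>u. dist u p < r \<Longrightarrow> poly E u \<noteq> 0 \<and> poly B1 u \<noteq> 0"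
    using Ep B1 unfolding open_dist by auto
  \<comment> \<open>Then \<open>(u - p) ^ (j + 2) * \<psi> u\<close> is - B^2 / (A'B - AB') near p;
    where it takes the value s, the expression in \<open>nz\<close> vanishes for t = s.\<close>
  define \<psi> where "\<psi> u = - (poly B1 u)\<^sup>2 / poly E u" for u
  have cont: "continuous_on (ball p r) \<psi>"
    unfolding \<psi>_def using r by (intro continuous_intros) (auto simp: dist_commute)
  have \<psi>p: "\<psi> p * cis (Suc (Suc j) * \<theta>0) = of_real (\<rho> / Suc j)"
  proof -
    have "\<psi> p = poly B1 p / poly A p / of_nat (Suc j)"
      using A B1 by (simp add: \<psi>_def E_def power2_eq_square field_simps del: of_nat_Suc)
    then have "\<psi> p * cis (Suc (Suc j) * \<theta>0) = poly B1 p / poly A p * cis (Suc (Suc j) * \<theta>0) / of_nat (Suc j)"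
      by simp
    then show ?thesis unfolding \<theta>0(1) by simp
  qed
  \<comment> \<open>This keeps u off the real axis: a nonreal p is moved by less than its height,
    and at a real p the direction stays where the sine is nonzero.\<close>
  define h where "h = (if p \<in> \<real> then \<bar>sin \<theta>0\<bar> else \<bar>Im p\<bar>)"
  have h: "h > 0" using neg by (auto simp: h_def complex_is_Real_iff)
  define \<eta> where "\<eta> = min (min t0 r) h"
  have \<eta>: "\<eta> > 0" "\<eta> \<le> t0" "\<eta> \<le> r" "\<eta> \<le> h" using t0 r h by (auto simp: \<eta>_def)
  obtain \<epsilon> \<theta> s where s: "0 < \<epsilon>" "\<epsilon> < \<eta>" "\<bar>\<theta> - \<theta>0\<bar> < \<eta>" "0 < s" "s < \<eta>"
    "(of_real \<epsilon> * cis \<theta>) ^ Suc (Suc j) * \<psi> (p + of_real \<epsilon> * cis \<theta>) = of_real s"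
    using sector_hit[OF cont r(1) _ \<psi>p _ \<eta>(1)] \<theta>0 by auto
  define u where "u = p + of_real \<epsilon> * cis \<theta>"
  have "u \<notin> \<real>"
  proof (cases "p \<in> \<real>")
    case True
    have "\<bar>sin \<theta>0 - sin \<theta>\<bar> \<le> \<bar>\<theta>0 - \<theta>\<bar>"
    proof -
      have "sin \<theta>0 - sin \<theta> = 2 * sin ((\<theta>0 - \<theta>) / 2) * cos ((\<theta>0 + \<theta>) / 2)" by (rule sin_diff_sin)
      then have "\<bar>sin \<theta>0 - sin \<theta>\<bar> = 2 * (\<bar>sin ((\<theta>0 - \<theta>) / 2)\<bar> * \<bar>cos ((\<theta>0 + \<theta>) / 2)\<bar>)"
        by (simp add: abs_mult)
      also have "\<dots> \<le> 2 * (\<bar>(\<theta>0 - \<theta>) / 2\<bar> * 1)"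
        by (intro mult_left_mono mult_mono abs_sin_x_le_abs_x abs_cos_le_one) auto
      finally show ?thesis by simp
    qed
    then have "sin \<theta> \<noteq> 0" using s \<eta> True by (auto simp: h_def)
    then show ?thesis using True s by (simp add: u_def complex_is_Real_iff)
  next
    case False
    have "\<bar>\<epsilon> * sin \<theta>\<bar> \<le> \<epsilon> * 1" unfolding abs_mult using s by (intro mult_mono) auto
    then show ?thesis using False s \<eta> by (auto simp: u_def complex_is_Real_iff h_def)
  qed
  moreover have up: "u - p = of_real \<epsilon> * cis \<theta>" by (simp add: u_def)
  have "dist u p < r" using s \<eta> by (simp add: dist_norm up norm_mult)
  then have nzu: "poly E u \<noteq> 0" "poly B1 u \<noteq> 0" using r by auto
  moreover have "u \<noteq> p" using up s by auto
  ultimately have "(poly B u)\<^sup>2 + of_real s * (poly (pderiv A) u * poly B u - poly A u * poly (pderiv B) u) \<noteq> 0"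
    using s \<eta> by (intro nz) (auto simp: B)
  moreover have "poly (pderiv A) u * poly B u - poly A u * poly (pderiv B) u = (u - p) ^ j * poly E u"
    using arg_cong[OF W, of "\<lambda>q. poly q u"] by simp
  moreover have "of_real s * poly E u = - ((u - p) ^ Suc (Suc j) * (poly B1 u)\<^sup>2)"
    using s(6) nzu unfolding u_def[symmetric] up[symmetric] \<psi>_def by (simp add: field_simps)
  then have "of_real s * ((u - p) ^ j * poly E u) = - ((u - p) ^ Suc j * poly B1 u)\<^sup>2"
    unfolding mult.left_commute[of "of_real s"] by (simp add: power2_eq_square mult_ac)
  moreover have "poly B u = (u - p) ^ Suc j * poly B1 u" by (simp add: B algebra_simps)
  ultimately show False by simp
qed

text \<open>With c the inverse of the leading Laurent coefficient of A / B at a pole of order j + 1,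
  every angle at which \<open>c * cis ((j + 2) * \<theta>)\<close> is positive must be real. One
  such angle always exists, namely - Arg c / (j + 2), so the pole is real; for real c suitable
  further angles fix its sign and the order.\<close>

lemma real_simple_poles:
  fixes A B :: "real poly"
  assumes B: "B \<noteq> 0" and co: "\<And>z. poly (cpoly B) z = 0 \<Longrightarrow> poly (cpoly A) z \<noteq> 0"
    and t0: "t0 > 0"
    and nz: "\<And>u t. u \<notin> \<real> \<Longrightarrow> poly (cpoly B) u \<noteq> 0 \<Longrightarrow> 0 < t \<Longrightarrow> t < t0 \<Longrightarrow>
      (poly (cpoly B) u)\<^sup>2 + of_real t * (poly (pderiv (cpoly A)) u * poly (cpoly B) u
         - poly (cpoly A) u * poly (pderiv (cpoly B)) u) \<noteq> 0"
  shows "poly (cpoly B) z = 0 \<Longrightarrow> z \<in> \<real>"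
    and "poly B x = 0 \<Longrightarrow> poly (pderiv B) x \<noteq> 0 \<and> poly A x / poly (pderiv B) x > 0"
proof -
  show "z \<in> \<real>" if z: "poly (cpoly B) z = 0"
  proof -
    have B': "cpoly B \<noteq> 0" using B by simp
    obtain B1 where B1: "cpoly B = [:- z, 1:] ^ order z (cpoly B) * B1" "\<not> [:- z, 1:] dvd B1"
      using order_decomp[OF B'] by blast
    obtain j where j: "order z (cpoly B) = Suc j" using z B' order_root[of "cpoly B" z] by (cases "order z (cpoly B)") auto
    define c where "c = poly B1 z / poly (cpoly A) z"
    have n0: "poly B1 z \<noteq> 0" using B1 by (simp add: poly_eq_0_iff_dvd)
    have "c \<noteq> 0" using n0 co[OF z] by (simp add: c_def)
    have "c * cis (Suc (Suc j) * (- Arg c / Suc (Suc j))) = of_real (norm c)"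
    proof -
      have "c = of_real (norm c) * cis (Arg c)" using rcis_cmod_Arg[of c] by (simp add: rcis_def)
      then have "c * cis (- Arg c) = of_real (norm c) * (cis (Arg c) * cis (- Arg c))" by (metis mult.assoc)
      then show ?thesis by (simp add: cis_mult del: of_nat_Suc)
    qed
    then show ?thesis
      using pole_ray_real[OF B1(1)[unfolded j] n0 co[OF z] t0 nz, of "- Arg c / Suc (Suc j)" "norm c"]
        \<open>c \<noteq> 0\<close> unfolding c_def by auto
  qed
  show "poly (pderiv B) x \<noteq> 0 \<and> poly A x / poly (pderiv B) x > 0" if x: "poly B x = 0"
  proof -
    obtain B1 where B1: "B = [:- x, 1:] ^ order x B * B1" "\<not> [:- x, 1:] dvd B1"
      using order_decomp[OF B] by blast
    obtain j where j: "order x B = Suc j" using x B order_root[of B x] by (cases "order x B") auto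
    note Bj = B1(1)[unfolded j]
    define c where "c = poly B1 x / poly A x"
    have n0: "poly B1 x \<noteq> 0" using B1 by (simp add: poly_eq_0_iff_dvd)
    have cx: "poly (cpoly A) (of_real x) \<noteq> 0" using x by (intro co) simp
    then have Ax: "poly A x \<noteq> 0" by simp
    have cB: "cpoly B = [:- of_real x, 1:] ^ Suc j * cpoly B1"
      using arg_cong[OF Bj, of cpoly] by simp
    have ray: "sin \<theta> = 0" if "of_real c * cis (Suc (Suc j) * \<theta>) = of_real \<rho>" "\<rho> > 0" for \<theta> \<rho> :: real
      using pole_ray_real[OF cB _ cx t0 nz, of \<theta> \<rho>] that n0 by (simp add: c_def del: of_nat_Suc)
    have "c \<noteq> 0" using n0 Ax by (simp add: c_def)
    have "c > 0"
    proof (rule ccontr)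
      assume "\<not> c > 0"
      \<comment> \<open>If c is negative, the angle pi / (j + 2) replaces it by - c, yet this
        direction is not real.\<close>
      then have "sin (pi / Suc (Suc j)) = 0" using \<open>c \<noteq> 0\<close> by (intro ray[of _ "- c"]) (auto simp del: of_nat_Suc)
      moreover have "sin (pi / Suc (Suc j)) > 0" by (intro sin_gt_zero) (auto simp: field_simps add_pos_nonneg)
      ultimately show False by simp
    qed
    have "j = 0"
    proof (rule ccontr)
      assume "j \<noteq> 0"
      \<comment> \<open>The positive direction next to angle 0. It is real only if j + 2 = 2, that
        is, for a simple pole.\<close>
      have "sin (2 * pi / Suc (Suc j)) = 0" using \<open>c > 0\<close> by (intro ray[of _ c]) (auto simp: cis_2pi simp del: of_nat_Suc)
      moreover have "sin (2 * pi / Suc (Suc j)) > 0" using \<open>j \<noteq> 0\<close> by (intro sin_gt_zero) (auto simp: field_simps add_pos_nonneg)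
      ultimately show False by simp
    qed
    then have "B = [:- x, 1:] * B1" using Bj by (simp only: power_Suc power_0 mult_1_right)
    then have "poly (pderiv B) x = poly B1 x"
      by (simp add: pderiv_mult pderiv_pCons del: mult_pCons_left)
    moreover have "poly A x / poly B1 x = 1 / c" by (simp add: c_def)
    ultimately show ?thesis using n0 \<open>c > 0\<close> by simp
  qed
qed

section \<open>The Levy form as a power series, and the variable u = 1/w\<close>

definition rnode_poly :: "real set \<Rightarrow> real poly" where
  "rnode_poly X = (\<Prod>x\<in>X. [:1, - x:])"

lemma poly_rnode_poly: "poly (rnode_poly X) w = (\<Prod>x\<in>X. 1 - x * w)"
  by (simp add: rnode_poly_def poly_prod algebra_simps)

lemma rnode_poly_remove:
  "finite X \<Longrightarrow> x \<in> X \<Longrightarrow> rnode_poly X = [:1, - x:] * rnode_poly (X - {x})"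
  unfolding rnode_poly_def by (rule prod.remove)

lemma poly_rnode_poly_0 [simp]: "poly (rnode_poly X) 0 = 1"
  by (simp add: poly_rnode_poly)

lemma coeff_rnode_poly_0 [simp]: "coeff (rnode_poly X) 0 = 1"
  by (simp flip: poly_0_coeff_0)

lemma rnode_poly_nonzero [simp]: "rnode_poly X \<noteq> 0"
  by (metis coeff_0 coeff_rnode_poly_0 zero_neq_one)

text \<open>The coefficient of \<open>w ^ n\<close>, the \<open>n\<close>-th free cumulant, is \<open>\<Sum>x\<in>X. c x * x ^ (n - 2)\<close> for \<open>n \<ge> 2\<close>;
  the node \<open>x = 0\<close> is the semicircular part.\<close>

definition cumulant_fps :: "real \<Rightarrow> real set \<Rightarrow> (real \<Rightarrow> real) \<Rightarrow> real fps" where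
  "cumulant_fps a X c = fps_const a * fps_X
     + (\<Sum>x\<in>X. fps_const (c x) * fps_X\<^sup>2 * inverse (1 - fps_const x * fps_X))"

text \<open>Both denominators have constant term 1, so they can be cleared. The resulting polynomial
  identity can be evaluated at points, real or complex, which the series identity cannot.\<close>

lemma cumulant_fps_iff:
  assumes X: "finite X" and P: "coeff P 0 = 1"
  shows "fps_of_poly Q / fps_of_poly P - 1 = cumulant_fps a X c \<longleftrightarrow>
    (Q - P) * rnode_poly X = P * ([:0, a:] * rnode_poly X
        + [:0, 0, 1:] * (\<Sum>x\<in>X. smult (c x) (rnode_poly (X - {x}))))" (is "?L \<longleftrightarrow> ?l = P * ?r")
proof -
  let ?F = "fps_of_poly :: real poly \<Rightarrow> real fps"
  have nz: "?F P \<noteq> 0" "?F (rnode_poly X) \<noteq> 0" using P by (auto simp: fps_eq_iff intro: exI[of _ 0])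
  have lin: "?F [:1, - x:] = 1 - fps_const x * fps_X" for x
    by (simp add: fps_of_poly_linear' flip: fps_const_neg)
  have inv: "inverse (1 - fps_const x * fps_X) * ?F (rnode_poly X) = ?F (rnode_poly (X - {x}))"
    if "x \<in> X" for x :: real
    by (subst rnode_poly_remove[OF X that])
       (simp add: fps_of_poly_mult lin inverse_mult_eq_1 flip: mult.assoc del: mult_pCons_left)
  have r: "cumulant_fps a X c * ?F (rnode_poly X) = ?F ?r"
  proof -
    have mon: "?F [:0, a:] = fps_const a * fps_X" "?F [:0, 0, 1:] = fps_X\<^sup>2"
      by (simp_all add: fps_of_poly_pCons power2_eq_square)
    have "cumulant_fps a X c * ?F (rnode_poly X) = fps_const a * fps_X * ?F (rnode_poly X)
        + (\<Sum>x\<in>X. fps_const (c x) * fps_X\<^sup>2 * (inverse (1 - fps_const x * fps_X) * ?F (rnode_poly X)))"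
      unfolding cumulant_fps_def ring_distribs sum_distrib_right by (simp only: mult.assoc)
    also have "\<dots> = ?F [:0, a:] * ?F (rnode_poly X)
        + ?F [:0, 0, 1:] * (\<Sum>x\<in>X. fps_const (c x) * ?F (rnode_poly (X - {x})))"
      unfolding mon sum_distrib_left using inv by (intro arg_cong2[of _ _ _ _ "(+)"] sum.cong) (simp_all add: mult_ac)
    also have "\<dots> = ?F ?r"
      by (simp only: fps_of_poly_add fps_of_poly_mult fps_of_poly_sum fps_of_poly_smult)
    finally show ?thesis .
  qed
  have l: "(?F Q / ?F P - 1) * ?F P = ?F (Q - P)"
  proof -
    have "?F Q / ?F P * ?F P = ?F Q"
      using P by (simp add: fps_divide_unit mult.assoc inverse_mult_eq_1)
    then show ?thesis by (simp add: ring_distribs fps_of_poly_diff)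
  qed
  have "?L \<longleftrightarrow> (?F Q / ?F P - 1) * ?F P * ?F (rnode_poly X) = cumulant_fps a X c * ?F P * ?F (rnode_poly X)"
    using nz by simp
  also have "\<dots> \<longleftrightarrow> ?F (Q - P) * ?F (rnode_poly X) = ?F P * (cumulant_fps a X c * ?F (rnode_poly X))"
    unfolding l by (simp only: mult_ac)
  also have "\<dots> \<longleftrightarrow> ?l = P * ?r"
    unfolding r by (simp only: fps_of_poly_mult[symmetric] fps_of_poly_eq_iff)
  finally show ?thesis .
qed

text \<open>This is \<open>u ^ d * p (1 / u)\<close>. The padding by a monomial allows two
  polynomials of different degrees to be reversed with the same d, so that their quotient is the old
  one at 1/u.\<close>

definition rev_poly :: "nat \<Rightarrow> 'a :: comm_ring_1 poly \<Rightarrow> 'a poly" where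
  "rev_poly d p = monom 1 (d - degree p) * reflect_poly p"

lemma poly_rev_poly:
  fixes p :: "'a :: field poly"
  assumes "degree p \<le> d" "u \<noteq> 0"
  shows "poly (rev_poly d p) u = u ^ d * poly p (1 / u)"
  using assms by (simp add: rev_poly_def poly_monom poly_reflect_poly_nz inverse_eq_divide
      flip: mult.assoc power_add)

lemma cpoly_rev_poly [simp]: "cpoly (rev_poly d p) = rev_poly d (cpoly p)"
proof -
  have "cpoly (reflect_poly p) = reflect_poly (cpoly p)"
    by (intro poly_eqI) (simp add: coeff_map_poly coeff_reflect_poly)
  then show ?thesis by (simp add: rev_poly_def map_poly_monom)
qed

lemma degree_rev_poly:
  fixes p :: "'a :: field poly"
  assumes "degree p \<le> d" "coeff p 0 \<noteq> 0"
  shows "degree (rev_poly d p) = d"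
proof -
  have "p \<noteq> 0" using assms by auto
  then show ?thesis
    using assms by (simp add: rev_poly_def degree_mult_eq degree_monom_eq)
qed

lemma degree_rev_poly_le:
  fixes p :: "'a :: field poly"
  assumes "degree p \<le> d"
  shows "degree (rev_poly d p) \<le> d"
proof -
  have "degree (rev_poly d p) \<le> degree (monom (1::'a) (d - degree p)) + degree (reflect_poly p)"
    unfolding rev_poly_def by (rule degree_mult_le)
  also have "\<dots> \<le> (d - degree p) + degree p"
    by (intro add_mono degree_monom_le degree_reflect_poly_le)
  finally show ?thesis using assms by simp
qed

lemma poly_pderiv_rev_poly:
  fixes p :: "complex poly"
  assumes "degree p \<le> d" "u \<noteq> 0"
  shows "poly (pderiv (rev_poly d p)) u =
    of_nat d * u ^ d / u * poly p (1 / u) - u ^ d / u\<^sup>2 * poly (pderiv p) (1 / u)"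
proof -
  have "((\<lambda>u. u ^ d * poly p (1 / u)) has_field_derivative
      of_nat d * u ^ (d - 1) * poly p (1 / u) + u ^ d * (poly (pderiv p) (1 / u) * (- 1 / u\<^sup>2))) (at u)"
    using assms by (auto intro!: derivative_eq_intros DERIV_chain'[where g = "poly p"] poly_DERIV simp: power2_eq_square)
  moreover have "open (- {0 :: complex})" "u \<in> - {0}" using assms by auto
  ultimately have "(poly (rev_poly d p) has_field_derivative
      of_nat d * u ^ (d - 1) * poly p (1 / u) + u ^ d * (poly (pderiv p) (1 / u) * (- 1 / u\<^sup>2))) (at u)"
    by (rule has_field_derivative_transform_within_open) (use assms in \<open>auto simp: poly_rev_poly\<close>)
  from DERIV_unique[OF poly_DERIV this] show ?thesis
    using assms by (cases d) auto
qed

text \<open>Since S / P = 1 + t w r with r = N1 / P, the terms that are linear in w r cancel and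
  only 1 - t w^2 r'(w), times P^2, is left.\<close>

lemma charpoly_expand:
  fixes P N1 :: "real poly"
  assumes "S = P + smult t ([:0, 1:] * N1)"
  shows "poly (cpoly ((P + [:0, 1:] * pderiv P) * S - [:0, 1:] * P * pderiv S)) w =
    (poly (cpoly P) w)\<^sup>2 - of_real t * w\<^sup>2 * (poly (pderiv (cpoly N1)) w * poly (cpoly P) w
        - poly (cpoly N1) w * poly (pderiv (cpoly P)) w)"
  by (simp add: assms pderiv_add pderiv_smult pderiv_mult pderiv_pCons power2_eq_square algebra_simps
       flip: cpoly_pderiv del: mult_pCons_left)

lemma real_rooted_imp_cumulant_form:
  assumes co: "coprime P Q" and P0: "poly P 0 = 1" and Q0: "poly Q 0 = 1" and t0: "t0 > 0"
    and rr: "\<And>t z S. 0 < t \<Longrightarrow> t < t0 \<Longrightarrow> S = P + smult t (Q - P) \<Longrightarrow>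
       poly (cpoly ((P + [:0, 1:] * pderiv P) * S - [:0, 1:] * P * pderiv S)) z = 0 \<Longrightarrow> z \<in> \<real>"
  obtains a X c where "finite X" "\<And>x. x \<in> X \<Longrightarrow> c x > 0"
    "fps_of_poly Q / fps_of_poly P - 1 = cumulant_fps a X c"
proof -
  have "poly (Q - P) 0 = 0" using P0 Q0 by simp
  then obtain N1 where N1: "Q - P = [:0, 1:] * N1"
    using poly_eq_0_iff_dvd[of "Q - P" 0] by (auto simp: dvd_def)
  have Pc: "coeff P 0 = 1" using P0 by (simp add: poly_0_coeff_0)
  then have Pnz: "P \<noteq> 0" by auto
  \<comment> \<open>With the maximum, at least one of \<open>A\<close> and \<open>B\<close> is
    nonzero at u = 0, so reversing creates no common zero there.\<close>
  define d where "d = max (degree P) (degree N1)"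
  define B where "B = rev_poly d P"
  define A where "A = rev_poly d N1"
  have dP: "degree P \<le> d" and dN: "degree N1 \<le> d" by (auto simp: d_def)
  have degB: "degree B = d" using dP Pc by (simp add: B_def degree_rev_poly)
  have degA: "degree A \<le> d" using dN by (simp add: A_def degree_rev_poly_le)
  have Bnz: "B \<noteq> 0" using Pnz by (simp add: B_def rev_poly_def monom_eq_0_iff)
  have evB: "poly (cpoly B) u = u ^ d * poly (cpoly P) (1 / u)" if "u \<noteq> 0" for u
    using that dP by (simp add: B_def poly_rev_poly)
  have evA: "poly (cpoly A) u = u ^ d * poly (cpoly N1) (1 / u)" if "u \<noteq> 0" for u
    using that dN by (simp add: A_def poly_rev_poly)
  have coPN: "poly (cpoly N1) w \<noteq> 0" if "poly (cpoly P) w = 0" for w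
  proof
    assume "poly (cpoly N1) w = 0"
    moreover have "cpoly Q = cpoly P + [:0, 1:] * cpoly N1"
      using arg_cong[OF N1, of cpoly] by (simp add: algebra_simps)
    ultimately have "poly (cpoly Q) w = 0" using that by simp
    then show False using coprime_imp_no_common_root[OF co that] by simp
  qed
  have no_common: "poly (cpoly A) z \<noteq> 0" if z: "poly (cpoly B) z = 0" for z
  proof (cases "z = 0")
    case False
    then show ?thesis using z evA evB coPN by auto
  next
    case True
    have "poly (cpoly B) 0 = (if d = degree P then lead_coeff (cpoly P) else 0)"
      unfolding B_def cpoly_rev_poly using dP by (auto simp: rev_poly_def poly_monom power_0_left)
    then have "d \<noteq> degree P" using z True Pnz by (auto simp: coeff_map_poly)
    then have "d = degree N1" "N1 \<noteq> 0" by (auto simp: d_def max_def split: if_splits)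
    then show ?thesis
      using True unfolding A_def cpoly_rev_poly by (simp add: rev_poly_def coeff_map_poly)
  qed
  have nz: "(poly (cpoly B) u)\<^sup>2 + of_real t * (poly (pderiv (cpoly A)) u * poly (cpoly B) u
         - poly (cpoly A) u * poly (pderiv (cpoly B)) u) \<noteq> 0"
    if u: "u \<notin> \<real>" and t: "0 < t" "t < t0" for u t
  proof -
    have u0: "u \<noteq> 0" using u by auto
    have "1 / u \<notin> \<real>" using u by (metis Reals_1 Reals_divide div_by_1 divide_divide_eq_right mult_1)
    define K where "K = poly (pderiv (cpoly N1)) (1 / u) * poly (cpoly P) (1 / u)
        - poly (cpoly N1) (1 / u) * poly (pderiv (cpoly P)) (1 / u)"
    have "poly (cpoly ((P + [:0, 1:] * pderiv P) * (P + smult t (Q - P))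
        - [:0, 1:] * P * pderiv (P + smult t (Q - P)))) (1 / u) \<noteq> 0"
      using rr[OF t refl] \<open>1 / u \<notin> \<real>\<close> by blast
    then have "(poly (cpoly P) (1 / u))\<^sup>2 - of_real t * (1 / u)\<^sup>2 * K \<noteq> 0"
      unfolding N1 charpoly_expand[OF refl] K_def .
    moreover have "poly (pderiv (cpoly A)) u * poly (cpoly B) u - poly (cpoly A) u * poly (pderiv (cpoly B)) u
      = (u ^ d)\<^sup>2 * (- ((1 / u)\<^sup>2 * K))"
      unfolding evA[OF u0] evB[OF u0] unfolding A_def B_def cpoly_rev_poly K_def
      using u0 dN dP by (simp add: poly_pderiv_rev_poly field_simps power2_eq_square)
    then have "(poly (cpoly B) u)\<^sup>2 + of_real t * (poly (pderiv (cpoly A)) u * poly (cpoly B) u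
         - poly (cpoly A) u * poly (pderiv (cpoly B)) u)
      = (u ^ d)\<^sup>2 * ((poly (cpoly P) (1 / u))\<^sup>2 - of_real t * (1 / u)\<^sup>2 * K)"
      by (simp only:) (simp add: evB[OF u0] power_mult_distrib algebra_simps)
    ultimately show ?thesis using u0 by simp
  qed
  define X where "X = {x. poly B x = 0}"
  define c where "c x = poly A x / poly (pderiv B) x" for x
  have realX: "z \<in> \<real>" if "poly (cpoly B) z = 0" for z
    by (rule real_simple_poles(1)[OF Bnz no_common t0 nz that])
  have simpleX: "poly (pderiv B) x \<noteq> 0 \<and> c x > 0" if "poly B x = 0" for x
    unfolding c_def by (rule real_simple_poles(2)[OF Bnz no_common t0 nz that])
  have finX: "finite X" unfolding X_def by (rule poly_roots_finite[OF Bnz])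
  define l where "l = lead_coeff B"
  have l: "l \<noteq> 0" using Bnz by (simp add: l_def)
  have Bsplit: "B = smult l (node_poly X)"
    unfolding l_def X_def using realX simpleX by (intro real_simple_roots_split Bnz) auto
  have cardX: "card X = d" using degB l by (simp add: Bsplit)
  \<comment> \<open>The value of A / B at u = infinity, which is r(0), the first free
    cumulant.\<close>
  define a where "a = coeff A d / l"
  have pf: "poly A u / poly B u = a + (\<Sum>x\<in>X. c x / (u - x))" if "poly B u \<noteq> 0" for u
    using partial_fractions[OF finX Bsplit l _ that] degA by (simp add: cardX a_def c_def)
  \<comment> \<open>Different polynomials would differ at some w that avoids 0 and the zeros of
    \<open>P\<close> and \<open>rnode_poly X\<close>; there the partial fractions at u = 1/w give
    equality.\<close>
  have "(Q - P) * rnode_poly X = P * ([:0, a:] * rnode_poly X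
        + [:0, 0, 1:] * (\<Sum>x\<in>X. smult (c x) (rnode_poly (X - {x}))))" (is "?l = ?r")
  proof (rule ccontr)
    assume "?l \<noteq> ?r"
    then have "finite {w. poly (?l - ?r) w = 0}" by (intro poly_roots_finite) simp
    moreover have "finite {w. poly (P * rnode_poly X * [:0, 1:]) w = 0}"
      using Pnz by (intro poly_roots_finite) auto
    ultimately have "finite ({w. poly (?l - ?r) w = 0} \<union> {w. poly (P * rnode_poly X * [:0, 1:]) w = 0})"
      by blast
    then obtain w where "w \<notin> {w. poly (?l - ?r) w = 0} \<union> {w. poly (P * rnode_poly X * [:0, 1:]) w = 0}"
      using ex_new_if_finite infinite_UNIV_char_0 by blast
    then have w: "poly ?l w \<noteq> poly ?r w" "poly P w \<noteq> 0" "poly (rnode_poly X) w \<noteq> 0" "w \<noteq> 0"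
      by auto
    have e: "poly (rnode_poly (X - {x})) w = poly (rnode_poly X) w / (1 - x * w)" "1 - x * w \<noteq> 0"
      if "x \<in> X" for x
    proof -
      have e: "poly (rnode_poly X) w = (1 - x * w) * poly (rnode_poly (X - {x})) w"
        by (simp only: poly_rnode_poly prod.remove[OF finX that])
      then show "1 - x * w \<noteq> 0" using w(3) by auto
      then show "poly (rnode_poly (X - {x})) w = poly (rnode_poly X) w / (1 - x * w)"
        unfolding e by simp
    qed
    have "poly B (1 / w) \<noteq> 0" using w dP by (simp add: B_def poly_rev_poly)
    from pf[OF this] have "poly N1 w / poly P w = a + (\<Sum>x\<in>X. c x / (1 / w - x))"
      using w dP dN by (simp add: B_def A_def poly_rev_poly)
    also have "(\<Sum>x\<in>X. c x / (1 / w - x)) = (\<Sum>x\<in>X. w * c x / (1 - x * w))"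
      using w e by (intro sum.cong) (auto simp: field_simps)
    finally have "poly N1 w = poly P w * (a + (\<Sum>x\<in>X. w * c x / (1 - x * w)))"
      using w by (simp add: field_simps)
    then have "poly ?l w = w * poly P w * (a + (\<Sum>x\<in>X. w * c x / (1 - x * w))) * poly (rnode_poly X) w"
      unfolding N1 by simp
    also have "\<dots> = poly ?r w"
      using e by (simp add: poly_sum algebra_simps sum_distrib_left power2_eq_square)
    finally show False using w by simp
  qed
  then show ?thesis
    using that[OF finX, of c a] simpleX cumulant_fps_iff[OF finX Pc] by (auto simp: X_def)
qed

section \<open>Levy form implies real-rootedness\<close>

lemma finite_set_separated:
  fixes X :: "real set"
  assumes "finite X"
  obtains \<delta> where "\<delta> > 0" "\<And>x y. x \<in> X \<Longrightarrow> y \<in> X \<Longrightarrow> x \<noteq> y \<Longrightarrow> 2 * \<delta> \<le> \<bar>x - y\<bar>"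
proof -
  \<comment> \<open>The element 1 keeps the minimum meaningful when \<open>X\<close> has at most one
    point.\<close>
  define D where "D = insert 1 ((\<lambda>(x, y). \<bar>x - y\<bar>) ` {(x, y) \<in> X \<times> X. x \<noteq> y})"
  have "finite {(x, y) \<in> X \<times> X. x \<noteq> y}"
    by (rule finite_subset[of _ "X \<times> X"]) (use assms in auto)
  then have D: "finite D" "D \<noteq> {}" by (auto simp: D_def)
  have "Min D > 0" using D by (auto simp: D_def)
  moreover have "Min D \<le> \<bar>x - y\<bar>" if "x \<in> X" "y \<in> X" "x \<noteq> y" for x y
    using D that by (intro Min_le) (auto simp: D_def)
  ultimately show ?thesis using that[of "Min D / 2"] by auto
qed

text \<open>At a node only its own summand survives, so the polynomial is negative there; at
  distance \<open>\<delta>\<close> on either side it is positive once t is small. The two sign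
  changes per node give 2 \<open>card X\<close> distinct real roots, as many as the degree
  allows.\<close>

lemma small_perturbation_real_rooted:
  fixes X :: "real set" and c :: "real \<Rightarrow> real"
  assumes X: "finite X" and c: "\<And>x. x \<in> X \<Longrightarrow> c x > 0"
  obtains t0 where "t0 > 0"
    "\<And>t z. 0 < t \<Longrightarrow> t < t0 \<Longrightarrow>
      poly (cpoly ((node_poly X)\<^sup>2 - smult t (\<Sum>x\<in>X. smult (c x) ((node_poly (X - {x}))\<^sup>2)))) z = 0
       \<Longrightarrow> z \<in> \<real>"
proof -
  define S where "S = (\<Sum>x\<in>X. smult (c x) ((node_poly (X - {x}))\<^sup>2))"
  define T where "T t = (node_poly X)\<^sup>2 - smult t S" for t
  obtain \<delta> where \<delta>: "\<delta> > 0" "\<And>x y. x \<in> X \<Longrightarrow> y \<in> X \<Longrightarrow> x \<noteq> y \<Longrightarrow> 2 * \<delta> \<le> \<bar>x - y\<bar>"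
    using finite_set_separated[OF X] by blast
  have Tpos: "\<forall>\<^sub>F t in at_right 0. poly (T t) y > 0" if "y \<notin> X" for y
  proof -
    have "((\<lambda>t. (poly (node_poly X) y)\<^sup>2 - t * poly S y) \<longlongrightarrow> (poly (node_poly X) y)\<^sup>2 - 0 * poly S y) (at_right 0)"
      by (intro tendsto_intros)
    moreover have "(poly (node_poly X) y)\<^sup>2 - 0 * poly S y > 0"
      using that X by (simp add: poly_node_poly_eq_0_iff)
    ultimately have "\<forall>\<^sub>F t in at_right 0. (poly (node_poly X) y)\<^sup>2 - t * poly S y > 0"
      by (rule order_tendstoD(1))
    then show ?thesis by (simp add: T_def)
  qed
  have off: "x + \<delta> \<notin> X" "x - \<delta> \<notin> X" if "x \<in> X" for x
    using \<delta>(1) \<delta>(2)[OF that, of "x + \<delta>"] \<delta>(2)[OF that, of "x - \<delta>"] by auto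
  have "\<forall>\<^sub>F t in at_right 0. \<forall>x\<in>X. poly (T t) (x + \<delta>) > 0 \<and> poly (T t) (x - \<delta>) > 0"
    using X off by (intro eventually_ball_finite ballI eventually_conj Tpos) auto
  then obtain t0 where t0: "t0 > 0" "\<And>t x. 0 < t \<Longrightarrow> t < t0 \<Longrightarrow> x \<in> X \<Longrightarrow>
      poly (T t) (x + \<delta>) > 0 \<and> poly (T t) (x - \<delta>) > 0"
    unfolding eventually_at_right_field by auto
  have "z \<in> \<real>" if t: "0 < t" "t < t0" and z: "poly (cpoly (T t)) z = 0" for t z
  proof -
    have neg: "poly (T t) x < 0" if x: "x \<in> X" for x
    proof -
      have "poly S x = (\<Sum>y\<in>X. if y = x then c x * (poly (node_poly (X - {x})) x)\<^sup>2 else 0)"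
        unfolding S_def poly_sum
        by (rule sum.cong[OF refl]) (use X x in \<open>auto simp: poly_node_poly_eq_0_iff\<close>)
      also have "\<dots> = c x * (poly (node_poly (X - {x})) x)\<^sup>2" using X x by simp
      also have "\<dots> > 0" using c[OF x] X by (simp add: poly_node_poly_eq_0_iff)
      finally have "poly S x > 0" .
      moreover have "poly (node_poly X) x = 0" using x X by (simp add: poly_node_poly_eq_0_iff)
      ultimately show ?thesis using t by (simp add: T_def)
    qed
    have "\<exists>u. poly (T t) u = 0 \<and> (if b then x < u \<and> u < x + \<delta> else x - \<delta> < u \<and> u < x)" if "x \<in> X" for x b
      using poly_IVT_pos[of x "x + \<delta>" "T t"] poly_IVT_neg[of "x - \<delta>" x "T t"] neg[OF that] t0(2)[OF t that] \<delta>(1)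
      by (cases b) auto
    then obtain f where f: "\<And>x b. x \<in> X \<Longrightarrow> poly (T t) (f x b) = 0 \<and>
        (if b then x < f x b \<and> f x b < x + \<delta> else x - \<delta> < f x b \<and> f x b < x)"
      by metis
    define Z where "Z = (\<lambda>(x, b). complex_of_real (f x b)) ` (X \<times> UNIV)"
    have inj: "inj_on (\<lambda>(x, b). complex_of_real (f x b)) (X \<times> UNIV)"
    proof (rule inj_onI, clarify)
      fix x b y b' assume xy: "x \<in> X" "y \<in> X" and "complex_of_real (f x b) = of_real (f y b')"
      then have e: "f x b = f y b'" by simp
      have near: "\<bar>f x b - x\<bar> < \<delta>" "\<bar>f y b' - y\<bar> < \<delta>"
        using f[OF xy(1), of b] f[OF xy(2), of b'] by (auto split: if_splits)
      have "x = y" using \<delta>(2)[OF xy] near e by (cases "x = y") auto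
      with e f[OF xy(1), of b] f[OF xy(2), of b'] show "x = y \<and> b = b'" by (auto split: if_splits)
    qed
    have cardZ: "card Z = 2 * card X" using X unfolding Z_def card_image[OF inj] by (simp add: card_cartesian_product)
    have Tnz: "T t \<noteq> 0"
    proof (cases "X = {}")
      case True
      then show ?thesis by (simp add: T_def S_def node_poly_def)
    next
      case False
      then show ?thesis using neg by fastforce
    qed
    have "degree (T t) \<le> 2 * card X"
    proof -
      have "degree ((node_poly X)\<^sup>2) \<le> 2 * card X" by (simp add: degree_power_eq)
      moreover have "degree S \<le> 2 * card X" unfolding S_def
      proof (rule degree_sum_le[OF X])
        fix x assume "x \<in> X"
        have "degree (smult (c x) ((node_poly (X - {x}))\<^sup>2)) \<le> 2 * card (X - {x})"
          using degree_smult_le by (metis degree_node_poly degree_power_eq node_poly_nonzero)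
        also have "\<dots> \<le> 2 * card X" using X by (intro mult_left_mono card_mono) auto
        finally show "degree (smult (c x) ((node_poly (X - {x}))\<^sup>2)) \<le> 2 * card X" .
      qed
      ultimately show ?thesis unfolding T_def
        by (intro degree_diff_le) (auto intro: order.trans[OF degree_smult_le])
    qed
    moreover have "card {z. poly (cpoly (T t)) z = 0} \<le> degree (cpoly (T t))"
      using Tnz by (intro card_poly_roots_bound) simp
    ultimately have "card {z. poly (cpoly (T t)) z = 0} \<le> card Z" using cardZ by simp
    moreover have "Z \<subseteq> {z. poly (cpoly (T t)) z = 0}" using f by (auto simp: Z_def)
    moreover have "finite {z. poly (cpoly (T t)) z = 0}" using Tnz by (intro poly_roots_finite) simp
    ultimately have "Z = {z. poly (cpoly (T t)) z = 0}" by (intro card_seteq) auto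
    then have "z \<in> Z" using z by blast
    then show ?thesis by (auto simp: Z_def)
  qed
  then show ?thesis using that[OF t0(1)] unfolding T_def S_def by blast
qed

text \<open>At a nonreal root z, differentiating the Levy form turns the characteristic equation
  into 1 = t times the sum of c_x / (u - x)^2 with u = 1/z. Multiplied by the squared node
  polynomial, this makes u a nonreal root of the perturbed square.\<close>

lemma cumulant_form_imp_real_rooted:
  assumes co: "coprime P Q" and P0: "poly P 0 = 1" and Q0: "poly Q 0 = 1"
    and X: "finite X" and c: "\<And>x. x \<in> X \<Longrightarrow> c x > 0"
    and R: "fps_of_poly Q / fps_of_poly P - 1 = cumulant_fps a X c"
  obtains t0 where "t0 > 0" "\<And>t z S. 0 < t \<Longrightarrow> t < t0 \<Longrightarrow> S = P + smult t (Q - P) \<Longrightarrow>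
       poly (cpoly ((P + [:0, 1:] * pderiv P) * S - [:0, 1:] * P * pderiv S)) z = 0 \<Longrightarrow> z \<in> \<real>"
proof -
  obtain t0 where t0: "t0 > 0"
    "\<And>t z. 0 < t \<Longrightarrow> t < t0 \<Longrightarrow>
      poly (cpoly ((node_poly X)\<^sup>2 - smult t (\<Sum>x\<in>X. smult (c x) ((node_poly (X - {x}))\<^sup>2)))) z = 0
       \<Longrightarrow> z \<in> \<real>"
    using small_perturbation_real_rooted[OF X, where c = c] c by blast
  have "poly (Q - P) 0 = 0" using P0 Q0 by simp
  then obtain N1 where N1: "Q - P = [:0, 1:] * N1"
    using poly_eq_0_iff_dvd[of "Q - P" 0] by (auto simp: dvd_def)
  have Pc: "coeff P 0 = 1" using P0 by (simp add: poly_0_coeff_0)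
  have id: "(Q - P) * rnode_poly X = P * ([:0, a:] * rnode_poly X
        + [:0, 0, 1:] * (\<Sum>x\<in>X. smult (c x) (rnode_poly (X - {x}))))"
    using R cumulant_fps_iff[OF X Pc] by blast
  have nr: "1 - of_real x * w \<noteq> 0" if w: "w \<notin> \<real>" for w :: complex and x
  proof
    assume "1 - of_real x * w = 0"
    then have "w = of_real (1 / x)" by (cases "x = 0") (auto simp: field_simps)
    with w show False by simp
  qed
  have evr: "poly (cpoly (rnode_poly Y)) w = (\<Prod>x\<in>Y. 1 - of_real x * w)" for Y and w :: complex
    by (simp add: rnode_poly_def poly_prod algebra_simps)
  \<comment> \<open>Off the real axis the factors 1 - x w are nonzero, so the identity can be
    divided. A zero of P there would also be one of N1, hence of Q, against coprimality.\<close>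
  have quot: "poly (cpoly P) w \<noteq> 0" "poly (cpoly N1) w / poly (cpoly P) w
      = of_real a + (\<Sum>x\<in>X. of_real (c x) * w / (1 - of_real x * w))" if w: "w \<notin> \<real>" for w
  proof -
    have w0: "w \<noteq> 0" using w by auto
    define Pi where "Pi = poly (cpoly (rnode_poly X)) w"
    have Pi: "Pi \<noteq> 0" using X nr[OF w] by (auto simp: Pi_def evr)
    have Pix: "poly (cpoly (rnode_poly (X - {x}))) w = Pi / (1 - of_real x * w)" if "x \<in> X" for x
      using nr[OF w] X that by (simp add: Pi_def evr prod.remove[OF X that])
    have "poly (cpoly ((Q - P) * rnode_poly X)) w = w * poly (cpoly N1) w * Pi"
      unfolding N1 by (simp add: Pi_def)
    also have "poly (cpoly ((Q - P) * rnode_poly X)) w = w * poly (cpoly P) w * Pi *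
       (of_real a + (\<Sum>x\<in>X. of_real (c x) * w / (1 - of_real x * w)))"
      unfolding id using Pix by (simp add: poly_sum flip: Pi_def) (simp add: algebra_simps sum_distrib_left)
    finally have e: "poly (cpoly N1) w = poly (cpoly P) w *
       (of_real a + (\<Sum>x\<in>X. of_real (c x) * w / (1 - of_real x * w)))" using Pi w0 by simp
    show Pw: "poly (cpoly P) w \<noteq> 0"
    proof
      assume "poly (cpoly P) w = 0"
      moreover have "cpoly Q = cpoly P + [:0, 1:] * cpoly N1"
        using arg_cong[OF N1, of cpoly] by (simp add: algebra_simps)
      ultimately show False using e coprime_imp_no_common_root[OF co] by auto
    qed
    show "poly (cpoly N1) w / poly (cpoly P) w
      = of_real a + (\<Sum>x\<in>X. of_real (c x) * w / (1 - of_real x * w))" using e Pw by simp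
  qed
  have "z \<in> \<real>" if t: "0 < t" "t < t0" and S: "S = P + smult t (Q - P)"
    and z: "poly (cpoly ((P + [:0, 1:] * pderiv P) * S - [:0, 1:] * P * pderiv S)) z = 0" for t z S
  proof (rule ccontr)
    assume zr: "z \<notin> \<real>"
    then have z0: "z \<noteq> 0" by auto
    define u where "u = 1 / z"
    have ur: "u \<notin> \<real>" using zr unfolding u_def by (metis Reals_1 Reals_divide div_by_1 divide_divide_eq_right mult_1)
    have ux: "u - of_real x \<noteq> 0" for x using ur by auto
    have "((\<lambda>w. poly (cpoly N1) w / poly (cpoly P) w) has_field_derivative
       (poly (pderiv (cpoly N1)) z * poly (cpoly P) z - poly (cpoly N1) z * poly (pderiv (cpoly P)) z)
         / (poly (cpoly P) z)\<^sup>2) (at z)"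
      using quot(1)[OF zr] by (auto intro!: derivative_eq_intros poly_DERIV simp: power2_eq_square)
    moreover have "((\<lambda>w. of_real a + (\<Sum>x\<in>X. of_real (c x) * w / (1 - of_real x * w))) has_field_derivative
       (\<Sum>x\<in>X. of_real (c x) / (1 - of_real x * z)\<^sup>2)) (at z)"
      using nr[OF zr] by (auto intro!: derivative_eq_intros sum.cong simp: power2_eq_square field_simps)
    then have "((\<lambda>w. poly (cpoly N1) w / poly (cpoly P) w) has_field_derivative
       (\<Sum>x\<in>X. of_real (c x) / (1 - of_real x * z)\<^sup>2)) (at z)"
      by (rule has_field_derivative_transform_within_open[where S = "- \<real>"])
         (use zr quot closed_complex_Reals in auto)
    ultimately have der: "(poly (pderiv (cpoly N1)) z * poly (cpoly P) z - poly (cpoly N1) z * poly (pderiv (cpoly P)) z)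
         / (poly (cpoly P) z)\<^sup>2 = (\<Sum>x\<in>X. of_real (c x) / (1 - of_real x * z)\<^sup>2)"
      by (rule DERIV_unique)
    have "(poly (cpoly P) z)\<^sup>2 - of_real t * z\<^sup>2 * (poly (pderiv (cpoly N1)) z * poly (cpoly P) z
        - poly (cpoly N1) z * poly (pderiv (cpoly P)) z) = 0"
      using z unfolding charpoly_expand[OF S[unfolded N1]] .
    then have "1 = of_real t * (z\<^sup>2 * ((poly (pderiv (cpoly N1)) z * poly (cpoly P) z
        - poly (cpoly N1) z * poly (pderiv (cpoly P)) z) / (poly (cpoly P) z)\<^sup>2))"
      using quot(1)[OF zr] by (simp add: field_simps)
    also have "\<dots> = of_real t * (\<Sum>x\<in>X. of_real (c x) / (u - of_real x)\<^sup>2)"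
      unfolding der sum_distrib_left[of "z\<^sup>2"]
      using z0 nr[OF zr] ux by (intro arg_cong[of _ _ "(*) _"] sum.cong)
         (auto simp: u_def field_simps power2_eq_square)
    finally have one: "1 = of_real t * (\<Sum>x\<in>X. of_real (c x) / (u - of_real x)\<^sup>2)" .
    define n where "n = poly (cpoly (node_poly X)) u"
    have nx: "poly (cpoly (node_poly (X - {x}))) u = n / (u - of_real x)" if "x \<in> X" for x
      using ux by (simp add: n_def poly_cpoly_node_poly prod.remove[OF X that])
    have "n\<^sup>2 = n\<^sup>2 * (of_real t * (\<Sum>x\<in>X. of_real (c x) / (u - of_real x)\<^sup>2))"
      using one by simp
    then have "poly (cpoly ((node_poly X)\<^sup>2 - smult t (\<Sum>x\<in>X. smult (c x) ((node_poly (X - {x}))\<^sup>2)))) u = 0"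
      using nx by (simp add: poly_sum power_divide sum_distrib_left flip: n_def) (simp add: mult_ac)
    from t0(2)[OF t this] ur show False by blast
  qed
  then show ?thesis using that[OF t0(1)] by blast
qed

section \<open>Moment bounds and uniqueness\<close>

text \<open>A weighted l1 norm of a truncation. It is always finite, and a bound uniform in n gives
  exponential growth of the coefficients without any convergence argument.\<close>

definition trunc_norm :: "real \<Rightarrow> nat \<Rightarrow> real fps \<Rightarrow> real" where
  "trunc_norm r n f = (\<Sum>k\<le>n. \<bar>fps_nth f k\<bar> * r ^ k)"

lemma trunc_norm_nonneg: "r \<ge> 0 \<Longrightarrow> trunc_norm r n f \<ge> 0"
  unfolding trunc_norm_def by (intro sum_nonneg) auto

lemma trunc_norm_add: "r \<ge> 0 \<Longrightarrow> trunc_norm r n (f + g) \<le> trunc_norm r n f + trunc_norm r n g"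
  unfolding trunc_norm_def sum.distrib[symmetric]
  by (intro sum_mono) (auto simp flip: distrib_right intro!: mult_right_mono)

lemma trunc_norm_diff: "r \<ge> 0 \<Longrightarrow> trunc_norm r n (f - g) \<le> trunc_norm r n f + trunc_norm r n g"
  unfolding trunc_norm_def sum.distrib[symmetric]
  by (intro sum_mono) (auto simp flip: distrib_right intro!: mult_right_mono)

lemma trunc_norm_const: "trunc_norm r n (fps_const a) = \<bar>a\<bar>"
  unfolding trunc_norm_def by (subst sum.mono_neutral_cong_right[of _ "{0}"]) auto

lemma trunc_norm_X_mult: "trunc_norm r (Suc n) (fps_X * f) = r * trunc_norm r n f"
  unfolding trunc_norm_def by (subst sum.atMost_Suc_shift) (simp add: sum_distrib_left mult_ac)

lemma trunc_norm_mult_aux: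
  assumes "r \<ge> 0"
  shows "trunc_norm r n (f * g) \<le>
    (\<Sum>(i, j)\<in>{(i, j). i + j \<le> n}. (\<bar>fps_nth f i\<bar> * r ^ i) * (\<bar>fps_nth g j\<bar> * r ^ j))"
proof -
  have "\<bar>fps_nth (f * g) k\<bar> * r ^ k \<le>
      (\<Sum>i\<le>k. (\<bar>fps_nth f i\<bar> * r ^ i) * (\<bar>fps_nth g (k - i)\<bar> * r ^ (k - i)))" for k
  proof -
    have "\<bar>fps_nth (f * g) k\<bar> * r ^ k \<le> (\<Sum>i\<le>k. \<bar>fps_nth f i * fps_nth g (k - i)\<bar>) * r ^ k"
      using assms by (intro mult_right_mono) (auto simp: fps_mult_nth atLeast0AtMost)
    also have "\<dots> = (\<Sum>i\<le>k. (\<bar>fps_nth f i\<bar> * r ^ i) * (\<bar>fps_nth g (k - i)\<bar> * r ^ (k - i)))"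
      by (auto simp: sum_distrib_right abs_mult simp flip: power_add intro!: sum.cong)
    finally show ?thesis .
  qed
  then have "trunc_norm r n (f * g) \<le>
      (\<Sum>k\<le>n. \<Sum>i\<le>k. (\<bar>fps_nth f i\<bar> * r ^ i) * (\<bar>fps_nth g (k - i)\<bar> * r ^ (k - i)))"
    unfolding trunc_norm_def by (intro sum_mono)
  then show ?thesis by (simp add: sum.triangle_reindex_eq)
qed

lemma trunc_norm_mult:
  assumes "r \<ge> 0"
  shows "trunc_norm r n (f * g) \<le> trunc_norm r n f * trunc_norm r n g"
proof -
  have "trunc_norm r n (f * g) \<le>
    (\<Sum>(i, j)\<in>{..n} \<times> {..n}. (\<bar>fps_nth f i\<bar> * r ^ i) * (\<bar>fps_nth g j\<bar> * r ^ j))"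
    by (rule order.trans[OF trunc_norm_mult_aux[OF assms]], rule sum_mono2) (use assms in auto)
  then show ?thesis by (simp add: trunc_norm_def sum_product sum.cartesian_product)
qed

text \<open>With zero constant terms only indices i, j \<ge> 1 contribute, so i + j \<le> n + 1
  leaves both at most n. This gain of one degree is what lets an induction on n close.\<close>

lemma trunc_norm_mult_Suc:
  assumes "r \<ge> 0" "fps_nth f 0 = 0" "fps_nth g 0 = 0"
  shows "trunc_norm r (Suc n) (f * g) \<le> trunc_norm r n f * trunc_norm r n g"
proof -
  let ?h = "\<lambda>(i, j). (\<bar>fps_nth f i\<bar> * r ^ i) * (\<bar>fps_nth g j\<bar> * r ^ j)"
  have fin: "finite {(i, j). i + j \<le> Suc n}"
    by (rule finite_subset[of _ "{..Suc n} \<times> {..Suc n}"]) auto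
  have "trunc_norm r (Suc n) (f * g) \<le> sum ?h {(i, j). i + j \<le> Suc n}"
    by (rule trunc_norm_mult_aux[OF assms(1)])
  also have "\<dots> = sum ?h {(i, j). i + j \<le> Suc n \<and> i > 0 \<and> j > 0}"
  proof (intro sum.mono_neutral_right fin ballI)
    fix z assume "z \<in> {(i, j). i + j \<le> Suc n} - {(i, j). i + j \<le> Suc n \<and> i > 0 \<and> j > 0}"
    then have "fst z = 0 \<or> snd z = 0" by auto
    then show "?h z = 0" using assms by (cases z) auto
  qed auto
  also have "\<dots> \<le> sum ?h ({..n} \<times> {..n})"
    using assms by (intro sum_mono2) auto
  finally show ?thesis by (simp add: trunc_norm_def sum_product sum.cartesian_product)
qed

lemma poly_abs_nonneg: "x \<ge> 0 \<Longrightarrow> poly (map_poly abs q) (x::real) \<ge> 0"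
  by (induction q) (auto simp: map_poly_pCons)

lemma poly_abs_mono:
  assumes "0 \<le> x" "x \<le> (y::real)"
  shows "poly (map_poly abs q) x \<le> poly (map_poly abs q) y"
  using assms by (induction q) (auto simp: map_poly_pCons intro!: mult_mono poly_abs_nonneg)

lemma fps_of_poly_pCons_compose:
  fixes D :: "real fps"
  assumes "fps_nth D 0 = 0"
  shows "fps_of_poly (pCons a q) oo D = fps_const a + D * (fps_of_poly q oo D)"
  using assms by (simp add: fps_of_poly_pCons fps_compose_add_distrib fps_compose_mult_distrib mult.commute)

lemma trunc_norm_poly_compose:
  assumes "r \<ge> 0" "fps_nth D 0 = 0"
  shows "trunc_norm r n (fps_of_poly q oo D) \<le> poly (map_poly abs q) (trunc_norm r n D)"
proof (induction q)
  case 0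
  then show ?case by (simp add: trunc_norm_def)
next
  case (pCons a q)
  have "trunc_norm r n (fps_of_poly (pCons a q) oo D) \<le>
      trunc_norm r n (fps_const a) + trunc_norm r n (D * (fps_of_poly q oo D))"
    unfolding fps_of_poly_pCons_compose[OF assms(2)] by (rule trunc_norm_add[OF assms(1)])
  also have "\<dots> \<le> \<bar>a\<bar> + trunc_norm r n D * trunc_norm r n (fps_of_poly q oo D)"
    using trunc_norm_mult[OF assms(1)] by (simp add: trunc_norm_const)
  also have "\<dots> \<le> \<bar>a\<bar> + trunc_norm r n D * poly (map_poly abs q) (trunc_norm r n D)"
    using pCons assms by (intro add_left_mono mult_left_mono trunc_norm_nonneg)
  finally show ?case by (simp add: map_poly_pCons)
qed

lemma is_rep_coeff_0:
  assumes "is_rep P Q F"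
  shows "coeff P 0 = 1" "coeff Q 0 = 1"
  using assms by (auto simp: is_rep_def poly_0_coeff_0)

lemma fps_of_rat_rep: "is_rep P Q F \<Longrightarrow> fps_of_rat F = fps_X * fps_of_poly P / fps_of_poly Q"
  by (simp add: fps_of_rat_def rep_num_eq rep_den_eq)

lemma comp_inverse_equation:
  assumes r: "is_rep P Q F"
  shows "comp_inverse F * (fps_of_poly P oo comp_inverse F) = fps_X * (fps_of_poly Q oo comp_inverse F)"
proof -
  define D where "D = comp_inverse F"
  have "F \<in> Frat" using r by (auto simp: Frat_def)
  then have D: "fps_nth D 0 = 0" "fps_of_rat F oo D = fps_X"
    unfolding D_def by (rule comp_inverse_is_inverse)+
  have "fps_of_rat F * fps_of_poly Q = fps_X * fps_of_poly P"
    using is_rep_coeff_0[OF r] by (simp add: fps_of_rat_rep[OF r] fps_divide_unit mult.assoc inverse_mult_eq_1)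
  then have "(fps_of_rat F * fps_of_poly Q) oo D = (fps_X * fps_of_poly P) oo D" by simp
  then show ?thesis using D by (simp add: fps_compose_mult_distrib D_def)
qed

text \<open>With \<open>P = 1 + w * P1\<close>, the inverse satisfies \<open>D = z * Q(D) - D * (D * P1(D))\<close>, where the
  coefficients up to \<open>n + 1\<close> of the right-hand side only involve those of \<open>D\<close> up to \<open>n\<close>.\<close>

lemma s_coeff_exp_bound:
  assumes "F \<in> Frat"
  obtains C where "C > 0" "\<And>n. \<bar>s_coeff n F\<bar> \<le> C * C ^ n"
proof -
  obtain P Q where r: "is_rep P Q F" using assms by (auto simp: Frat_def)
  define D where "D = comp_inverse F"
  have D0: "fps_nth D 0 = 0" unfolding D_def by (rule comp_inverse_is_inverse[OF assms])
  obtain P1 where P: "P = pCons 1 P1"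
    using is_rep_coeff_0[OF r] by (cases P) auto
  have D: "D = fps_X * (fps_of_poly Q oo D) - D * (D * (fps_of_poly P1 oo D))"
    using comp_inverse_equation[OF r] D0 unfolding D_def[symmetric] P
    by (simp add: fps_of_poly_pCons_compose algebra_simps)
  define p q where "p = poly (map_poly abs P1) 1" and "q = poly (map_poly abs Q) 1"
  have pq: "p \<ge> 0" "q \<ge> 0" by (simp_all add: p_def q_def poly_abs_nonneg)
  \<comment> \<open>The radius is chosen so that the two terms of the equation for D are each at
    most \<open>\<tau> / 2\<close>: \<open>\<rho> * q\<close> for the first,
    \<open>\<tau> * (\<tau> * p)\<close> for the second. As \<open>\<tau> \<le> 1\<close>,
    polynomials in D may be estimated at 1.\<close>
  define \<tau> where "\<tau> = 1 / (2 * (1 + p))"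
  define \<rho> where "\<rho> = \<tau> / (2 * (1 + q))"
  have \<tau>: "0 < \<tau>" "\<tau> \<le> 1" "\<tau> * p \<le> 1 / 2" using pq by (auto simp: \<tau>_def field_simps)
  have \<rho>: "0 < \<rho>" "\<rho> * q \<le> \<tau> / 2" using pq \<tau>(1) by (auto simp: \<rho>_def field_simps)
  have tn: "trunc_norm \<rho> n D \<le> \<tau>" for n
  proof (induction n)
    case 0
    then show ?case using D0 \<tau> by (simp add: trunc_norm_def)
  next
    case (Suc n)
    define T where "T = trunc_norm \<rho> n D"
    have T: "0 \<le> T" "T \<le> \<tau>" using Suc \<rho> by (simp_all add: T_def trunc_norm_nonneg)
    have bd: "trunc_norm \<rho> n (fps_of_poly s oo D) \<le> poly (map_poly abs s) 1" for s
      using trunc_norm_poly_compose[of \<rho> D n s] \<rho> D0 poly_abs_mono[of T 1 s] T \<tau> by (simp add: T_def)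
    have "trunc_norm \<rho> (Suc n) D \<le> trunc_norm \<rho> (Suc n) (fps_X * (fps_of_poly Q oo D))
        + trunc_norm \<rho> (Suc n) (D * (D * (fps_of_poly P1 oo D)))"
      by (subst D) (rule trunc_norm_diff, use \<rho> in simp)
    also have "trunc_norm \<rho> (Suc n) (fps_X * (fps_of_poly Q oo D)) \<le> \<rho> * q"
      unfolding trunc_norm_X_mult q_def using \<rho> bd by (intro mult_left_mono) auto
    also have "trunc_norm \<rho> (Suc n) (D * (D * (fps_of_poly P1 oo D))) \<le> T * trunc_norm \<rho> n (D * (fps_of_poly P1 oo D))"
      unfolding T_def using \<rho> D0 by (intro trunc_norm_mult_Suc) auto
    also have "trunc_norm \<rho> n (D * (fps_of_poly P1 oo D)) \<le> T * trunc_norm \<rho> n (fps_of_poly P1 oo D)"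
      unfolding T_def using \<rho> by (intro trunc_norm_mult) auto
    also have "trunc_norm \<rho> n (fps_of_poly P1 oo D) \<le> p" unfolding p_def by (rule bd)
    also have "\<rho> * q + T * (T * p) \<le> \<tau> / 2 + \<tau> * (\<tau> * p)"
      using \<rho> T pq \<tau> by (intro add_mono mult_mono) auto
    also have "\<dots> \<le> \<tau> / 2 + \<tau> * (1 / 2)" using \<tau> by (intro add_left_mono mult_left_mono) auto
    finally show ?case using T by (simp add: mult_left_mono)
  qed
  have "\<bar>fps_nth D n\<bar> \<le> (1 / \<rho>) ^ n" for n
  proof -
    have "\<bar>fps_nth D n\<bar> * \<rho> ^ n \<le> trunc_norm \<rho> n D"
      unfolding trunc_norm_def using \<rho> by (intro member_le_sum) auto
    also have "\<dots> \<le> 1" using tn[of n] \<tau> by simp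
    finally show ?thesis using \<rho> by (simp add: field_simps)
  qed
  from this[of "Suc n" for n] have "\<bar>s_coeff n F\<bar> \<le> 1 / \<rho> * (1 / \<rho>) ^ n" for n
    by (simp only: s_coeff_def D_def power_Suc)
  then show ?thesis using that[of "1 / \<rho>"] \<rho> by simp
qed

section \<open>Measures with exponentially bounded moments\<close>

lemma even_moment:
  assumes "has_moments \<mu> m"
  shows "integrable \<mu> (\<lambda>x. \<bar>x\<bar> ^ (2 * k))" "(\<integral>x. \<bar>x\<bar> ^ (2 * k) \<partial>\<mu>) = m (2 * k)"
  using assms by (simp_all add: has_moments_def power_even_abs)

text \<open>Both characteristic functions are within 2K (|t| C)^(2k) / (2k)! of the same Taylor
  polynomial. Even orders are used because there the absolute moment in the error term is itself a
  moment.\<close>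

lemma moments_determine:
  assumes \<mu>: "real_distribution \<mu>" "has_moments \<mu> m" and \<nu>: "real_distribution \<nu>" "has_moments \<nu> m"
    and m: "\<And>n. \<bar>m n\<bar> \<le> K * C ^ n"
  shows "\<mu> = \<nu>"
proof (rule Levy_uniqueness[OF \<mu>(1) \<nu>(1)], rule ext)
  fix t :: real
  define S where "S n = (\<Sum>k\<le>n. (\<i> * t) ^ k / fact k * of_real (m k))" for n
  have approx: "norm (char \<kappa> t - S (2 * k)) \<le> 2 * K * ((\<bar>t\<bar> * C) ^ (2 * k) / fact (2 * k))"
    if "real_distribution \<kappa>" "has_moments \<kappa> m" for \<kappa> k
  proof -
    interpret real_distribution \<kappa> by fact
    have "norm (char \<kappa> t - (\<Sum>j\<le>2 * k. (\<i> * t) ^ j / fact j * of_real (\<integral>x. x ^ j \<partial>\<kappa>)))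
       \<le> 2 * \<bar>t\<bar> ^ (2 * k) / fact (2 * k) * (\<integral>x. \<bar>x\<bar> ^ (2 * k) \<partial>\<kappa>)"
      using that(2) by (intro char_approx1) (auto simp: has_moments_def)
    also have "(\<Sum>j\<le>2 * k. (\<i> * t) ^ j / fact j * of_real (\<integral>x. x ^ j \<partial>\<kappa>)) = S (2 * k)"
      using that(2) by (simp add: S_def has_moments_def)
    also have "2 * \<bar>t\<bar> ^ (2 * k) / fact (2 * k) * (\<integral>x. \<bar>x\<bar> ^ (2 * k) \<partial>\<kappa>)
        \<le> 2 * \<bar>t\<bar> ^ (2 * k) / fact (2 * k) * (K * C ^ (2 * k))"
      using m[of "2 * k"] by (intro mult_left_mono) (auto simp: even_moment(2)[OF that(2)])
    finally show ?thesis by (simp add: power_mult_distrib mult_ac)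
  qed
  have "(\<lambda>n. (\<bar>t\<bar> * C) ^ n / fact n) \<longlonglongrightarrow> 0"
    using summable_LIMSEQ_zero[OF summable_exp[of "\<bar>t\<bar> * C"]] by (simp add: field_simps)
  then have "(\<lambda>k. (\<bar>t\<bar> * C) ^ (2 * k) / fact (2 * k)) \<longlonglongrightarrow> 0"
    by (rule LIMSEQ_subseq_LIMSEQ[unfolded comp_def, of _ _ "\<lambda>k. 2 * k"]) (auto simp: strict_mono_def)
  then have lim: "(\<lambda>k. 4 * K * ((\<bar>t\<bar> * C) ^ (2 * k) / fact (2 * k))) \<longlonglongrightarrow> 4 * K * 0"
    by (intro tendsto_mult tendsto_const)
  have "norm (char \<mu> t - char \<nu> t) \<le> 4 * K * ((\<bar>t\<bar> * C) ^ (2 * k) / fact (2 * k))" for k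
  proof -
    have "norm (char \<mu> t - char \<nu> t) \<le> norm (char \<mu> t - S (2 * k)) + norm (char \<nu> t - S (2 * k))"
      by (metis norm_triangle_ineq4 diff_diff_eq2 add_diff_cancel diff_add_cancel)
    then show ?thesis using approx[OF \<mu>, of k] approx[OF \<nu>, of k] by simp
  qed
  then have "norm (char \<mu> t - char \<nu> t) \<le> 4 * K * 0"
    by (intro LIMSEQ_le_const[OF lim]) auto
  then show "char \<mu> t = char \<nu> t" by simp
qed

text \<open>Markov's inequality for the power 2k bounds the mass outside (- C - 1, C + 1) by K (C /
  (C + 1))^(2k), which tends to 0.\<close>

lemma moments_imp_compact_distribution:
  assumes \<mu>: "real_distribution \<mu>" "has_moments \<mu> m" and m: "\<And>n. \<bar>m n\<bar> \<le> K * C ^ n" and C: "C > 0"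
  shows "compact_distribution \<mu>"
proof -
  interpret real_distribution \<mu> by fact
  define A where "A = {x \<in> space \<mu>. C + 1 \<le> \<bar>x\<bar>}"
  have bd: "prob A \<le> K * ((C / (C + 1)) ^ 2) ^ k" for k
  proof -
    have "A \<subseteq> {x \<in> space \<mu>. (C + 1) ^ (2 * k) \<le> \<bar>x\<bar> ^ (2 * k)}"
      using C by (auto simp: A_def intro!: power_mono)
    then have "prob A \<le> prob {x \<in> space \<mu>. (C + 1) ^ (2 * k) \<le> \<bar>x\<bar> ^ (2 * k)}"
      by (intro finite_measure_mono) measurable
    also have "\<dots> \<le> (\<integral>x. \<bar>x\<bar> ^ (2 * k) \<partial>\<mu>) / (C + 1) ^ (2 * k)"
      using C even_moment(1)[OF \<mu>(2)] by (intro integral_Markov_inequality_measure[where A = "{}"]) auto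
    also have "\<dots> \<le> K * C ^ (2 * k) / (C + 1) ^ (2 * k)"
      using m[of "2 * k"] C by (intro divide_right_mono) (auto simp: even_moment(2)[OF \<mu>(2)])
    finally show ?thesis by (simp add: power_mult power_divide)
  qed
  have "(C / (C + 1)) ^ 2 < 1" using C by (simp add: power_less_one_iff abs_square_less_1)
  then have "(\<lambda>k. ((C / (C + 1)) ^ 2) ^ k) \<longlonglongrightarrow> 0"
    using C by (intro LIMSEQ_realpow_zero) auto
  then have "(\<lambda>k. K * ((C / (C + 1)) ^ 2) ^ k) \<longlonglongrightarrow> K * 0" by (intro tendsto_mult tendsto_const)
  then have "prob A \<le> K * 0" using bd by (intro LIMSEQ_le_const) auto
  then have A: "prob A = 0" by (simp add: measure_le_0_iff)
  have "1 - prob A \<le> prob {- (C + 1)..C + 1}"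
  proof -
    have "1 - prob A = prob (space \<mu> - A)" by (subst prob_compl) (auto simp: A_def)
    also have "\<dots> \<le> prob {- (C + 1)..C + 1}" by (intro finite_measure_mono) (auto simp: A_def)
    finally show ?thesis .
  qed
  then have "prob {- (C + 1)..C + 1} = 1" using A by (intro antisym prob_le_1) simp
  then show ?thesis using \<mu>(1) compact_Icc unfolding compact_distribution_def by blast
qed

lemma mu_of_moments:
  assumes "F \<in> Fdist"
  shows "real_distribution (mu_of F)" "has_moments (mu_of F) (\<lambda>n. s_coeff n F)"
proof -
  have F: "F \<in> Frat" using assms by (simp add: Fdist_def)
  obtain C where C: "C > 0" "\<And>n. \<bar>s_coeff n F\<bar> \<le> C * C ^ n" using s_coeff_exp_bound[OF F] by blast
  have "\<exists>!\<mu>. real_distribution \<mu> \<and> has_moments \<mu> (\<lambda>n. s_coeff n F)"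
    using assms moments_determine[OF _ _ _ _ C(2)] unfolding Fdist_def by blast
  from theI'[OF this] show "real_distribution (mu_of F)" "has_moments (mu_of F) (\<lambda>n. s_coeff n F)"
    unfolding mu_of_def by blast+
qed

lemma moments_compact_distribution:
  assumes "F \<in> Frat" "real_distribution \<mu>" "has_moments \<mu> (\<lambda>n. s_coeff n F)"
  shows "compact_distribution \<mu>"
proof -
  obtain C where C: "C > 0" "\<And>n. \<bar>s_coeff n F\<bar> \<le> C * C ^ n" using s_coeff_exp_bound[OF assms(1)] by blast
  show ?thesis by (rule moments_imp_compact_distribution[OF assms(2,3) C(2,1)])
qed

text \<open>The moment series is \<open>comp_inverse F\<close>, and inverting it again returns the
  expansion of F = w P / Q.\<close>

lemma free_R_moments:
  assumes r: "is_rep P Q F" and \<mu>: "has_moments \<mu> (\<lambda>n. s_coeff n F)"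
  shows "free_R \<mu> = fps_of_poly Q / fps_of_poly P - 1"
proof -
  have F: "F \<in> Frat" using r by (auto simp: Frat_def)
  have "fps_X * Abs_fps (\<lambda>n. \<integral>x. x ^ n \<partial>\<mu>) = comp_inverse F"
  proof (rule fps_ext)
    fix n
    show "fps_nth (fps_X * Abs_fps (\<lambda>n. \<integral>x. x ^ n \<partial>\<mu>)) n = fps_nth (comp_inverse F) n"
      using \<mu> comp_inverse_is_inverse(1)[OF F] by (cases n) (auto simp: has_moments_def s_coeff_def)
  qed
  then have inv: "fps_inv (fps_X * Abs_fps (\<lambda>n. \<integral>x. x ^ n \<partial>\<mu>)) = fps_X * (fps_of_poly P * inverse (fps_of_poly Q))"
    using fps_of_rat_nth[OF F] is_rep_coeff_0[OF r] fps_inv_idempotent[of "fps_of_rat F"]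
    by (simp add: comp_inverse_def fps_of_rat_rep[OF r] fps_divide_unit mult.assoc)
  have "fps_X / (fps_X * (fps_of_poly P * inverse (fps_of_poly Q))) = 1 / (fps_of_poly P * inverse (fps_of_poly Q))"
    using fps_divide_cancel[of "fps_X" 1 "fps_of_poly P * inverse (fps_of_poly Q)"] by simp
  also have "\<dots> = fps_of_poly Q / fps_of_poly P"
    using is_rep_coeff_0[OF r] by (simp add: fps_divide_unit fps_inverse_mult mult.commute)
  finally show ?thesis by (simp add: free_R_def inv)
qed

section \<open>Free infinite divisibility implies the Levy form\<close>

text \<open>The linear functional that sends the k-th power of the variable to \<open>h k\<close>.
  Nonnegativity on squares says that the Hankel matrices with entries \<open>h (i + j)\<close> are
  positive semidefinite.\<close>

definition hankel_functional :: "(nat \<Rightarrow> real) \<Rightarrow> real poly \<Rightarrow> real" where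
  "hankel_functional h p = (\<Sum>i\<le>degree p. coeff p i * h i)"

lemma hankel_functional_eq:
  "degree p \<le> n \<Longrightarrow> hankel_functional h p = (\<Sum>i\<le>n. coeff p i * h i)"
  unfolding hankel_functional_def
  by (rule sum.mono_neutral_left) (auto simp: coeff_eq_0)

lemma hankel_functional_0 [simp]: "hankel_functional h 0 = 0"
  by (simp add: hankel_functional_def)

lemma hankel_functional_add:
  "hankel_functional h (p + q) = hankel_functional h p + hankel_functional h q"
proof -
  define n where "n = max (degree p) (degree q)"
  have "degree p \<le> n" "degree q \<le> n" "degree (p + q) \<le> n"
    by (auto simp: n_def degree_add_le_max)
  then show ?thesis by (simp add: hankel_functional_eq[of _ n] ring_distribs sum.distrib)
qed

lemma hankel_functional_smult: "hankel_functional h (smult c p) = c * hankel_functional h p"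
  using hankel_functional_eq[OF degree_smult_le, of h c p]
  by (simp add: hankel_functional_def sum_distrib_left mult.assoc)

lemma hankel_functional_diff:
  "hankel_functional h (p - q) = hankel_functional h p - hankel_functional h q"
  using hankel_functional_add[of h "p - q" q] by simp

lemma hankel_functional_sum:
  "hankel_functional h (\<Sum>x\<in>A. f x) = (\<Sum>x\<in>A. hankel_functional h (f x))"
  by (induction A rule: infinite_finite_induct) (auto simp: hankel_functional_add)

lemma hankel_functional_monom: "hankel_functional h (monom 1 k) = h k"
  by (subst hankel_functional_eq[of _ k]) (auto simp: degree_monom_le if_distrib[of "\<lambda>x. x * _"] sum.If_cases)

text \<open>The degenerate case of Cauchy-Schwarz: along f + s g the quadratic term disappears, and
  a nonconstant affine function of s cannot stay nonnegative.\<close>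

lemma hankel_functional_null:
  assumes psd: "\<And>p. hankel_functional h (p * p) \<ge> 0" and g: "hankel_functional h (g * g) = 0"
  shows "hankel_functional h (g * f) = 0"
proof (rule ccontr)
  assume neq: "hankel_functional h (g * f) \<noteq> 0"
  \<comment> \<open>With this s the form takes the value -1.\<close>
  define s where "s = - (hankel_functional h (f * f) + 1) / (2 * hankel_functional h (g * f))"
  have "(f + smult s g) * (f + smult s g) = f * f + (smult s (g * f) + smult s (g * f)) + smult (s * s) (g * g)"
    by (simp add: algebra_simps)
  then have "hankel_functional h ((f + smult s g) * (f + smult s g)) =
      hankel_functional h (f * f) + (s * hankel_functional h (g * f) + s * hankel_functional h (g * f))"
    by (simp only: hankel_functional_add hankel_functional_smult g mult_zero_right add_0_right)
  also have "\<dots> < 0" using neq by (simp add: s_def)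
  finally show False using psd[of "f + smult s g"] by simp
qed

text \<open>A polynomial of least degree among those annihilating the form has simple real roots:
  otherwise positivity would make a proper divisor annihilate the form.\<close>

lemma hankel_atomic:
  assumes psd: "\<And>p. hankel_functional h (p * p) \<ge> 0"
    and B0: "B0 \<noteq> 0" "\<And>f. hankel_functional h (B0 * f) = 0"
  obtains X c where "finite X" "\<And>x. x \<in> X \<Longrightarrow> c x > 0" "\<And>k. h k = (\<Sum>x\<in>X. c x * x ^ k)"
proof -
  define L where "L = hankel_functional h"
  define null where "null B \<longleftrightarrow> B \<noteq> 0 \<and> (\<forall>f. L (B * f) = 0)" for B
  have "null B0" using B0 by (simp add: null_def L_def)
  then obtain B where B: "null B" and least: "\<And>B'. null B' \<Longrightarrow> degree B \<le> degree B'"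
    using ex_has_least_nat[of null B0 degree] by blast
  have Bnz: "B \<noteq> 0" and LB: "L (B * f) = 0" for f using B by (auto simp: null_def)
  have cs: "null g" if "g \<noteq> 0" "L (g * g) = 0" for g
    using that hankel_functional_null[OF psd, of g] by (auto simp: null_def L_def)
  have real: "z \<in> \<real>" if z: "poly (cpoly B) z = 0" for z
  proof (rule ccontr)
    assume zr: "z \<notin> \<real>"
    define q where "q = [:(Re z)\<^sup>2 + (Im z)\<^sup>2, - 2 * Re z, 1:]"
    obtain B1 where B1: "B = q * B1" using nonreal_root_dvd[OF z zr] by (auto simp: q_def dvd_def)
    have nz: "B1 \<noteq> 0" "q \<noteq> 0" using Bnz B1 by auto
    define e where "e = [:- Re z, 1:]"
    \<comment> \<open>Writing q as a sum of squares splits L(B B1) = 0 into two nonnegative terms.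
      So B1, of smaller degree than B, would annihilate the form as well.\<close>
    have "q = e * e + [:(Im z)\<^sup>2:]"
      by (simp add: q_def e_def power2_eq_square)
    then have "B * B1 = (e * B1) * (e * B1) + [:(Im z)\<^sup>2:] * (B1 * B1)"
      unfolding B1 by (simp only: ring_distribs mult_ac)
    then have "B * B1 = (e * B1) * (e * B1) + smult ((Im z)\<^sup>2) (B1 * B1)"
      by simp
    then have "L (B * B1) = L ((e * B1) * (e * B1)) + (Im z)\<^sup>2 * L (B1 * B1)"
      by (simp only: L_def hankel_functional_add hankel_functional_smult)
    moreover have "L ((e * B1) * (e * B1)) \<ge> 0" "L (B1 * B1) \<ge> 0"
      unfolding L_def by (rule psd)+
    ultimately have "(Im z)\<^sup>2 * L (B1 * B1) \<le> 0" using LB[of B1] by simp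
    moreover have "Im z \<noteq> 0" using zr by (simp add: complex_is_Real_iff)
    ultimately have "L (B1 * B1) = 0" using \<open>L (B1 * B1) \<ge> 0\<close> by (simp add: mult_le_0_iff)
    from least[OF cs[OF nz(1) this]] have "degree B \<le> degree B1" .
    moreover have "degree B = degree q + degree B1" using B1 nz by (simp add: degree_mult_eq)
    moreover have "degree q = 2" by (simp add: q_def)
    ultimately show False by simp
  qed
  have simple: "poly (pderiv B) x \<noteq> 0" if x: "poly B x = 0" for x
  proof
    assume d: "poly (pderiv B) x = 0"
    obtain B1 where B1: "B = [:- x, 1:] * B1" using x by (metis poly_eq_0_iff_dvd dvd_def)
    have "poly (pderiv B) x = poly B1 x"
      unfolding B1 by (simp add: pderiv_mult pderiv_pCons del: mult_pCons_left)
    then obtain B2 where B2: "B1 = [:- x, 1:] * B2" using d by (metis poly_eq_0_iff_dvd dvd_def)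
    have "B1 * B1 = B * B2" by (simp only: B1 B2 mult_ac)
    then have "L (B1 * B1) = 0" using LB by simp
    moreover have nz: "B1 \<noteq> 0" using Bnz B1 by auto
    ultimately have "degree B \<le> degree B1" using least cs by blast
    moreover have "degree B = 1 + degree B1" unfolding B1 using nz by (subst degree_mult_eq) auto
    ultimately show False by simp
  qed
  define X where "X = {x. poly B x = 0}"
  have X: "finite X" unfolding X_def by (rule poly_roots_finite[OF Bnz])
  have split: "B = smult (lead_coeff B) (node_poly X)"
    unfolding X_def using real simple by (intro real_simple_roots_split Bnz) auto
  \<comment> \<open>The Lagrange basis. Its square takes the same values on the nodes, so the weight
    L(l x) equals L(l x * l x) and is nonnegative.\<close>
  define l where "l x = smult (1 / poly (node_poly (X - {x})) x) (node_poly (X - {x}))" for x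
  define c where "c x = L (l x)" for x
  have lx: "poly (l x) y = (if x = y then 1 else 0)" if "x \<in> X" "y \<in> X" for x y
    using that X by (auto simp: l_def poly_node_poly_eq_0_iff)
  have rep: "L p = (\<Sum>x\<in>X. poly p x * c x)" for p
  proof -
    define r where "r = p - (\<Sum>x\<in>X. smult (poly p x) (l x))"
    have "poly r y = 0" if "y \<in> X" for y
      using that X by (simp add: r_def poly_sum lx if_distrib[of "\<lambda>x. _ * x"] cong: if_cong)
    from node_poly_dvd[OF X this] obtain f where "r = node_poly X * f" by (auto simp: dvd_def)
    then have "r = B * smult (1 / lead_coeff B) f" using Bnz by (subst split) simp
    then have "L r = 0" using LB by metis
    then show ?thesis
      by (simp add: r_def L_def c_def hankel_functional_diff hankel_functional_sum hankel_functional_smult)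
  qed
  have cpos: "c x \<ge> 0" if "x \<in> X" for x
  proof -
    have "L (l x * l x) = (\<Sum>y\<in>X. if y = x then c x else 0)"
      unfolding rep using that by (intro sum.cong) (auto simp: lx)
    also have "\<dots> = c x" using X that by simp
    finally show ?thesis using psd[of "l x"] by (simp add: L_def)
  qed
  have hk: "h k = (\<Sum>x\<in>X. c x * x ^ k)" for k
    using rep[of "monom 1 k"] by (simp add: L_def hankel_functional_monom poly_monom mult.commute)
  have hk': "h k = (\<Sum>x\<in>{x\<in>X. c x > 0}. c x * x ^ k)" for k
    unfolding hk
  proof (rule sum.mono_neutral_right[OF X])
    show "\<forall>x\<in>X - {x \<in> X. 0 < c x}. c x * x ^ k = 0"
    proof
      fix x assume "x \<in> X - {x \<in> X. 0 < c x}"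
      then have "c x = 0" using cpos[of x] by simp
      then show "c x * x ^ k = 0" by simp
    qed
  qed simp
  show ?thesis
  proof (rule that[of "{x\<in>X. c x > 0}" c])
    show "finite {x\<in>X. c x > 0}" using X by simp
  qed (blast, rule hk')
qed

lemma fps_inverse_linear: "inverse (1 - fps_const x * fps_X) = Abs_fps (\<lambda>n. (x :: real) ^ n)"
proof (rule fps_inverse_unique)
  show "(1 - fps_const x * fps_X) * Abs_fps (\<lambda>n. x ^ n) = 1"
  proof (rule fps_ext)
    fix n
    show "fps_nth ((1 - fps_const x * fps_X) * Abs_fps (\<lambda>n. x ^ n)) n = fps_nth 1 n"
      by (cases n) (auto simp: ring_distribs mult.assoc)
  qed
qed

lemma cumulant_fps_nth:
  assumes "finite X"
  shows "fps_nth (cumulant_fps a X c) n = (if n = 0 then 0 else if n = 1 then a else (\<Sum>x\<in>X. c x * x ^ (n - 2)))"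
  unfolding cumulant_fps_def
  by (cases "n = 0 \<or> n = 1") (auto simp: fps_sum_nth mult.assoc fps_X_power_mult_nth fps_inverse_linear)

text \<open>Rationality is a linear recurrence: the functional of B times the j-th power is the
  coefficient of index d + j + 2 of P R = N, which lies beyond the degree of N.\<close>

lemma rational_annihilator:
  fixes R :: "real fps"
  assumes R: "R * fps_of_poly P = fps_of_poly N" and P: "coeff P 0 = 1"
  obtains B where "B \<noteq> 0" "\<And>f. hankel_functional (\<lambda>k. fps_nth R (k + 2)) (B * f) = 0"
proof -
  define h where "h k = fps_nth R (k + 2)" for k
  define d where "d = degree P + degree N"
  define B where "B = rev_poly d P"
  have deg: "degree B = d" using P by (simp add: B_def d_def degree_rev_poly)
  have Pnz: "P \<noteq> 0" using P by auto
  have cB: "coeff B i = coeff P (d - i)" if "i \<le> d" for i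
  proof (cases "i < degree N")
    case True
    then show ?thesis by (simp add: B_def rev_poly_def d_def coeff_monom_mult coeff_eq_0)
  next
    case False
    then show ?thesis using that
      by (auto simp: B_def rev_poly_def d_def coeff_monom_mult coeff_reflect_poly intro!: arg_cong[of _ _ "coeff P"])
  qed
  have mon: "hankel_functional h (B * monom 1 j) = 0" for j
  proof -
    have "degree (B * monom 1 j) \<le> d + j"
      using degree_mult_le[of B "monom 1 j"] deg degree_monom_le[of "1::real" j] by linarith
    then have "hankel_functional h (B * monom 1 j) = (\<Sum>i\<le>d + j. coeff (B * monom 1 j) i * h i)"
      by (rule hankel_functional_eq)
    also have "\<dots> = (\<Sum>i\<in>{j..d + j}. coeff B (i - j) * h i)"
      by (rule sum.mono_neutral_cong_right) (auto simp: coeff_monom_mult mult.commute[of B])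
    also have "\<dots> = (\<Sum>i\<le>d. coeff P i * h (d - i + j))"
      by (rule sum.reindex_bij_witness[of _ "\<lambda>i. d - i + j" "\<lambda>i. d - (i - j)"]) (auto simp: cB)
    also have "\<dots> = (\<Sum>i\<le>d. coeff P i * fps_nth R (d + j + 2 - i))"
      by (intro sum.cong) (auto simp: h_def intro!: arg_cong[of _ _ "fps_nth R"])
    also have "\<dots> = (\<Sum>i=0..d + j + 2. coeff P i * fps_nth R (d + j + 2 - i))"
      by (rule sum.mono_neutral_left) (auto simp: d_def coeff_eq_0)
    also have "\<dots> = fps_nth (fps_of_poly P * R) (d + j + 2)" by (simp add: fps_mult_nth)
    also have "\<dots> = coeff N (d + j + 2)" using R by (simp add: mult.commute)
    also have "\<dots> = 0" by (rule coeff_eq_0) (simp add: d_def)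
    finally show ?thesis .
  qed
  have "hankel_functional h (B * f) = 0" for f
  proof -
    have "B * f = (\<Sum>i\<le>degree f. smult (coeff f i) (B * monom 1 i))"
    proof -
      have e: "(\<Sum>i\<le>degree f. smult (coeff f i) (monom 1 i)) = f"
        using poly_as_sum_of_monoms[of f] by (simp add: smult_monom)
      have "B * f = B * (\<Sum>i\<le>degree f. smult (coeff f i) (monom 1 i))" by (simp only: e)
      then show ?thesis by (simp only: sum_distrib_left mult_smult_right)
    qed
    then show ?thesis by (simp add: hankel_functional_sum hankel_functional_smult mon)
  qed
  moreover have "B \<noteq> 0" using Pnz by (simp add: B_def rev_poly_def)
  ultimately show ?thesis using that unfolding h_def by blast
qed

section \<open>Moments of free convolution roots\<close>

lemma compact_distribution_integrable:
  assumes "compact_distribution \<nu>"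
  shows "integrable \<nu> (\<lambda>x. x ^ k)"
proof -
  obtain K where K: "compact K" "measure \<nu> K = 1" and \<nu>: "real_distribution \<nu>"
    using assms by (auto simp: compact_distribution_def)
  interpret real_distribution \<nu> by fact
  obtain b where b: "\<And>x. x \<in> K \<Longrightarrow> \<bar>x\<bar> \<le> b"
    using compact_imp_bounded[OF K(1)] by (auto simp: bounded_iff)
  have "K \<in> events" using compact_imp_closed[OF K(1)] by simp
  then have "AE x in \<nu>. x \<in> K" using K(2) by (simp add: AE_in_set_eq_1)
  then have "AE x in \<nu>. norm (x ^ k) \<le> b ^ k"
    by eventually_elim (auto simp: power_abs intro!: power_mono b)
  then show ?thesis by (rule integrable_const_bound) simp
qed

text \<open>Composing (1 + R) f = X with D, where f is the inverse of D. In this form each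
  coefficient of D depends only on lower ones, which permits coefficientwise limits.\<close>

lemma free_R_equation:
  assumes \<nu>: "prob_space \<nu>"
  defines "D \<equiv> fps_X * Abs_fps (\<lambda>n. \<integral>x. x ^ n \<partial>\<nu>)"
  shows "D = fps_X * (1 + (free_R \<nu> oo D))"
proof -
  have D0: "fps_nth D 0 = 0" by (simp add: D_def)
  have D1: "fps_nth D 1 = 1" using prob_space.prob_space[OF \<nu>] by (simp add: D_def)
  define f where "f = fps_inv D"
  have f0: "fps_nth f 0 = 0" by (simp add: f_def fps_inv_def)
  have fD: "f oo D = fps_X" unfolding f_def using D0 D1 by (intro fps_inv) auto
  have "fps_nth f 1 = 1"
    using arg_cong[OF fD, of "\<lambda>g. fps_nth g 1"] f0 D1 by (simp add: fps_compose_nth)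
  then have sf: "subdegree f = 1" using f0 by (intro subdegreeI) auto
  then have "f dvd fps_X" by (subst fps_dvd_iff) auto
  then have "fps_X / f * f = fps_X" by simp
  then have "(1 + free_R \<nu>) * f = fps_X" by (simp add: free_R_def f_def D_def)
  then have "((1 + free_R \<nu>) * f) oo D = fps_X oo D" by simp
  then show ?thesis
    using D0 fD by (simp add: fps_compose_mult_distrib fps_compose_add_distrib mult.commute)
qed

lemma fps_power_nth_tendsto:
  fixes D :: "nat \<Rightarrow> real fps"
  assumes "\<And>j. j \<le> k \<Longrightarrow> (\<lambda>n. fps_nth (D n) j) \<longlonglongrightarrow> fps_nth E j"
  shows "(\<lambda>n. fps_nth (D n ^ i) k) \<longlonglongrightarrow> fps_nth (E ^ i) k"
  using assms
proof (induction i arbitrary: k)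
  case 0
  then show ?case by simp
next
  case (Suc i)
  have "(\<lambda>n. \<Sum>j=0..k. fps_nth (D n) j * fps_nth (D n ^ i) (k - j))
    \<longlonglongrightarrow> (\<Sum>j=0..k. fps_nth E j * fps_nth (E ^ i) (k - j))"
    by (intro tendsto_sum tendsto_mult Suc) auto
  then show ?case by (simp add: fps_mult_nth)
qed

text \<open>The moment series satisfies D_n = X (1 + R(D_n) / n), so D_n tends to X coefficientwise.
  For k \<ge> 1, n times the k-th moment is the k-th coefficient of R(D_n), which tends to that of
  R.\<close>

lemma small_root_moments:
  fixes R :: "real fps"
  assumes R0: "fps_nth R 0 = 0" and \<nu>: "\<And>n. n \<ge> 1 \<Longrightarrow> prob_space (\<nu> n) \<and> R = of_nat n * free_R (\<nu> n)"
    and k: "k \<ge> 1"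
  shows "(\<lambda>n. real n * (\<integral>x. x ^ k \<partial>\<nu> n)) \<longlonglongrightarrow> fps_nth R k"
proof -
  define D where "D n = fps_X * Abs_fps (\<lambda>k. \<integral>x. x ^ k \<partial>\<nu> n)" for n
  have D: "D n = fps_X * (1 + fps_const (1 / real n) * (R oo D n))" if n: "n \<ge> 1" for n
  proof -
    have "fps_const (1 / real n) * R = free_R (\<nu> n)"
      using \<nu>[OF n] n by (simp flip: fps_of_nat mult.assoc)
    moreover have "(fps_const (1 / real n) * R) oo D n = fps_const (1 / real n) * (R oo D n)"
      by (subst fps_compose_mult_distrib) (auto simp: D_def)
    ultimately have "fps_const (1 / real n) * (R oo D n) = free_R (\<nu> n) oo D n" by simp
    then show ?thesis using free_R_equation[of "\<nu> n"] \<nu>[OF n] by (simp add: D_def)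
  qed
  have ev: "\<forall>\<^sub>F n in sequentially. (n::nat) \<ge> 1" by (rule eventually_ge_at_top)
  have inv0: "(\<lambda>n. 1 / real n) \<longlonglongrightarrow> 0" by (rule lim_1_over_n)
  have comp: "(\<lambda>n. fps_nth (R oo D n) k) \<longlonglongrightarrow> fps_nth R k"
    if "\<And>j. j \<le> k \<Longrightarrow> (\<lambda>n. fps_nth (D n) j) \<longlonglongrightarrow> fps_nth fps_X j" for k
  proof -
    have "(\<lambda>n. fps_nth (R oo D n) k) \<longlonglongrightarrow> fps_nth (R oo fps_X) k"
      unfolding fps_compose_nth using that by (intro tendsto_intros fps_power_nth_tendsto)
    then show ?thesis by simp
  qed
  have conv: "(\<lambda>n. fps_nth (D n) k) \<longlonglongrightarrow> fps_nth fps_X k" for k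
  proof (induction k rule: less_induct)
    case (less k)
    show ?case
    proof (cases k)
      case 0
      then show ?thesis by (simp add: D_def)
    next
      case (Suc j)
      have "(\<lambda>n. fps_nth 1 j + 1 / real n * fps_nth (R oo D n) j) \<longlonglongrightarrow> fps_nth 1 j + 0 * fps_nth R j"
        using less Suc by (intro tendsto_intros inv0 comp) auto
      moreover have "\<forall>\<^sub>F n in sequentially. fps_nth 1 j + 1 / real n * fps_nth (R oo D n) j = fps_nth (D n) k"
        using ev by eventually_elim (subst D, auto simp: Suc)
      ultimately show ?thesis using Suc by (auto intro: Lim_transform_eventually)
    qed
  qed
  have "\<forall>\<^sub>F n in sequentially. fps_nth (R oo D n) k = real n * (\<integral>x. x ^ k \<partial>\<nu> n)"
    using ev
  proof eventually_elim
    case (elim n)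
    have "(\<integral>x. x ^ k \<partial>\<nu> n) = fps_nth (D n) (Suc k)" by (simp add: D_def)
    also have "\<dots> = 1 / real n * fps_nth (R oo D n) k"
      by (subst D[OF elim]) (use k in auto)
    finally show ?case using elim by simp
  qed
  then show ?thesis using comp[OF conv] by (rule Lim_transform_eventually[rotated])
qed

text \<open>The shift by 2 serves positivity: on a square p * p the functional is the limit of n
  times the integrals of (x p(x))^2. The coefficients 0 and 1 of R are outside its reach; they are 0
  and the free parameter \<open>a\<close>.\<close>

lemma fid_imp_cumulant_form:
  assumes r: "is_rep P Q F" and F: "F \<in> Fdist_fid"
  obtains a X c where "finite X" "\<And>x. x \<in> X \<Longrightarrow> c x > 0"
    "fps_of_poly Q / fps_of_poly P - 1 = cumulant_fps a X c"
proof -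
  define R where "R = fps_of_poly Q / fps_of_poly P - 1"
  have F': "F \<in> Fdist" "freely_infinitely_divisible (mu_of F)" using F by (auto simp: Fdist_fid_def)
  have R: "free_R (mu_of F) = R"
    unfolding R_def by (rule free_R_moments[OF r mu_of_moments(2)[OF F'(1)]])
  have R0: "fps_nth R 0 = 0" using is_rep_coeff_0[OF r] by (simp add: R_def)
  have "\<forall>n. \<exists>\<nu>. n \<ge> 1 \<longrightarrow> compact_distribution \<nu> \<and> R = of_nat n * free_R \<nu>"
    using F'(2) unfolding freely_infinitely_divisible_def free_conv_root_def R by blast
  then obtain \<nu> where \<nu>: "\<And>n. n \<ge> 1 \<Longrightarrow> compact_distribution (\<nu> n) \<and> R = of_nat n * free_R (\<nu> n)"
    by metis
  have ps: "prob_space (\<nu> n)" if "n \<ge> 1" for n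
    using \<nu>[OF that] by (auto simp: compact_distribution_def real_distribution_def)
  have lim: "(\<lambda>n. real n * (\<integral>x. x ^ k \<partial>\<nu> n)) \<longlonglongrightarrow> fps_nth R k" if "k \<ge> 1" for k
    using \<nu> ps by (intro small_root_moments[OF R0 _ that]) auto
  define h where "h k = fps_nth R (k + 2)" for k
  have psd: "hankel_functional h (p * p) \<ge> 0" for p
  proof -
    have "(\<lambda>n. \<Sum>i\<le>degree (p * p). coeff (p * p) i * (real n * (\<integral>x. x ^ (i + 2) \<partial>\<nu> n)))
        \<longlonglongrightarrow> hankel_functional h (p * p)"
      unfolding hankel_functional_def h_def by (intro tendsto_intros lim) auto
    moreover have "\<forall>\<^sub>F n in sequentially.
        0 \<le> (\<Sum>i\<le>degree (p * p). coeff (p * p) i * (real n * (\<integral>x. x ^ (i + 2) \<partial>\<nu> n)))"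
      using eventually_ge_at_top[of 1]
    proof eventually_elim
      case (elim n)
      have int: "integrable (\<nu> n) (\<lambda>x. x ^ k)" for k
        using \<nu>[OF elim] compact_distribution_integrable by blast
      have "(\<Sum>i\<le>degree (p * p). coeff (p * p) i * (real n * (\<integral>x. x ^ (i + 2) \<partial>\<nu> n)))
        = real n * (\<integral>x. (\<Sum>i\<le>degree (p * p). coeff (p * p) i * x ^ (i + 2)) \<partial>\<nu> n)"
      proof -
        have "coeff (p * p) i * (real n * (\<integral>x. x ^ (i + 2) \<partial>\<nu> n))
            = real n * (\<integral>x. coeff (p * p) i * x ^ (i + 2) \<partial>\<nu> n)" for i
          by (simp only: integral_mult_right_zero mult.left_commute)
        moreover have "(\<integral>x. (\<Sum>i\<le>degree (p * p). coeff (p * p) i * x ^ (i + 2)) \<partial>\<nu> n)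
            = (\<Sum>i\<le>degree (p * p). \<integral>x. coeff (p * p) i * x ^ (i + 2) \<partial>\<nu> n)"
          by (intro Bochner_Integration.integral_sum integrable_mult_right int)
        ultimately show ?thesis by (simp only: sum_distrib_left)
      qed
      also have "(\<lambda>x. \<Sum>i\<le>degree (p * p). coeff (p * p) i * x ^ (i + 2)) = (\<lambda>x. (x * poly p x)\<^sup>2)"
      proof
        fix x
        have "(\<Sum>i\<le>degree (p * p). coeff (p * p) i * x ^ (i + 2)) = poly (p * p) x * x ^ 2"
          unfolding poly_altdef by (simp only: power_add sum_distrib_right mult.assoc)
        then show "(\<Sum>i\<le>degree (p * p). coeff (p * p) i * x ^ (i + 2)) = (x * poly p x)\<^sup>2"
          by (simp add: power2_eq_square mult_ac)
      qed
      finally show ?case by (simp add: integral_nonneg)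
    qed
    ultimately show ?thesis by (rule tendsto_lowerbound) simp
  qed
  have "R * fps_of_poly P = fps_of_poly (Q - P)"
    using is_rep_coeff_0[OF r]
    by (simp add: R_def ring_distribs fps_of_poly_diff fps_divide_unit mult.assoc inverse_mult_eq_1)
  then obtain B where "B \<noteq> 0" "\<And>f. hankel_functional h (B * f) = 0"
    unfolding h_def using rational_annihilator is_rep_coeff_0(1)[OF r] by blast
  then obtain X c where X: "finite X" "\<And>x. x \<in> X \<Longrightarrow> c x > 0" "\<And>k. h k = (\<Sum>x\<in>X. c x * x ^ k)"
    using hankel_atomic[OF psd] by blast
  have "R = cumulant_fps (fps_nth R 1) X c"
  proof (rule fps_ext)
    fix n
    show "fps_nth R n = fps_nth (cumulant_fps (fps_nth R 1) X c) n"
    proof (cases "n < 2")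
      case True
      then show ?thesis using R0 by (auto simp: cumulant_fps_nth[OF X(1)] less_2_cases_iff)
    next
      case False
      then have "n = n - 2 + 2" by simp
      then have "fps_nth R n = h (n - 2)" unfolding h_def by (rule arg_cong)
      then show ?thesis using False X(3) by (simp add: cumulant_fps_nth[OF X(1)])
    qed
  qed
  then show ?thesis using that X R_def by blast
qed

section \<open>Rational Nevanlinna functions\<close>

text \<open>Along the ray of angle \<open>\<theta>\<close> the quotient behaves like U(x) / B1(x)
  times \<open>\<epsilon> ^ (- m) * cis (- m * \<theta>)\<close>. Multiplying by
  \<open>\<epsilon> ^ m\<close> leaves a continuous function whose limit inherits the sign.\<close>

lemma pick_pole_ray:
  fixes U V B1 :: "real poly"
  assumes V: "V = [:- x, 1:] ^ m * B1" and B1: "poly B1 x \<noteq> 0"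
    and pick: "\<And>z. Im z > 0 \<Longrightarrow> Im (poly (cpoly U) z / poly (cpoly V) z) < 0"
    and \<theta>: "0 < \<theta>" "\<theta> < pi"
  shows "poly U x / poly B1 x * sin (real m * \<theta>) \<ge> 0"
proof -
  define u where "u \<epsilon> = complex_of_real x + of_real \<epsilon> * cis \<theta>" for \<epsilon> :: real
  define f where "f \<epsilon> = Im (cis (- (real m * \<theta>)) * (poly (cpoly U) (u \<epsilon>) / poly (cpoly B1) (u \<epsilon>)))" for \<epsilon>
  define S where "S = {\<epsilon>. poly (cpoly B1) (u \<epsilon>) \<noteq> 0}"
  have "open S" unfolding S_def u_def by (intro open_Collect_neq continuous_intros)
  moreover have "continuous_on S f"
    unfolding f_def by (intro continuous_intros) (auto simp: S_def u_def intro!: continuous_intros)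
  moreover have "0 \<in> S" using B1 by (simp add: S_def u_def)
  ultimately have "isCont f 0" using continuous_on_eq_continuous_at by blast
  then have "(f \<longlongrightarrow> f 0) (at_right 0)"
    by (metis at_le filterlim_mono isCont_def order_refl top_greatest)
  moreover have "\<forall>\<^sub>F \<epsilon> in at_right 0. f \<epsilon> \<le> 0"
    using eventually_at_right_less[of 0]
  proof eventually_elim
    case (elim \<epsilon>)
    have cV: "poly (cpoly V) (u \<epsilon>) = of_real (\<epsilon> ^ m) * cis (real m * \<theta>) * poly (cpoly B1) (u \<epsilon>)"
    proof -
      have "poly (cpoly V) (u \<epsilon>) = (u \<epsilon> - of_real x) ^ m * poly (cpoly B1) (u \<epsilon>)"
        by (simp add: V)
      then show ?thesis by (simp add: u_def power_mult_distrib Complex.DeMoivre)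
    qed
    have "cis (- (real m * \<theta>)) = 1 / cis (real m * \<theta>)"
      by (metis cis_inverse inverse_eq_divide)
    then have "cis (- (real m * \<theta>)) * (poly (cpoly U) (u \<epsilon>) / poly (cpoly B1) (u \<epsilon>))
        = of_real (\<epsilon> ^ m) * (poly (cpoly U) (u \<epsilon>) / poly (cpoly V) (u \<epsilon>))"
      unfolding cV using elim by simp
    then have "f \<epsilon> = \<epsilon> ^ m * Im (poly (cpoly U) (u \<epsilon>) / poly (cpoly V) (u \<epsilon>))"
      by (simp only: f_def Im_complex_of_real Re_complex_of_real times_complex.simps mult_zero_left add_0_right)
    moreover have "Im (u \<epsilon>) > 0" using elim \<theta> by (simp add: u_def sin_gt_zero)
    ultimately show ?case using pick elim by (simp add: mult_nonneg_nonpos less_imp_le)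
  qed
  ultimately have "f 0 \<le> 0" by (intro tendsto_upperbound[of f "f 0" "at_right 0"]) auto
  moreover have "f 0 = - (poly U x / poly B1 x * sin (real m * \<theta>))"
    by (simp add: f_def u_def flip: of_real_divide)
  ultimately show ?thesis by simp
qed

text \<open>Nonreal poles are excluded above the axis by hypothesis and below it by conjugation. At
  a real pole of order m the angle pi / (2m) makes the leading coefficient positive, and for m \<ge>
  2 the angle 3 pi / (2m) would make it negative. The degree condition removes the constant
  term.\<close>

lemma pick_partial_fractions_coprime:
  fixes U V :: "real poly"
  assumes co: "coprime U V" and V0: "V \<noteq> 0" and deg: "degree U < degree V"
    and pick: "\<And>z. Im z > 0 \<Longrightarrow> poly (cpoly V) z \<noteq> 0 \<and> Im (poly (cpoly U) z / poly (cpoly V) z) < 0"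
  obtains Y p where "finite Y" "\<And>y. y \<in> Y \<Longrightarrow> p y > 0 \<and> poly V y = 0"
    "\<And>u. poly V u \<noteq> 0 \<Longrightarrow> poly U u / poly V u = (\<Sum>y\<in>Y. p y / (u - y))"
proof -
  have real: "z \<in> \<real>" if "poly (cpoly V) z = 0" for z
  proof (rule ccontr)
    assume "z \<notin> \<real>"
    then have "Im z > 0 \<or> Im (cnj z) > 0" by (auto simp: complex_is_Real_iff)
    moreover have "poly (cpoly V) (cnj z) = 0" using that by (simp add: poly_cpoly_cnj)
    ultimately show False using pick that by blast
  qed
  have simple: "poly (pderiv V) x \<noteq> 0 \<and> poly U x / poly (pderiv V) x > 0" if x: "poly V x = 0" for x
  proof -
    obtain B1 where B1: "V = [:- x, 1:] ^ order x V * B1" "\<not> [:- x, 1:] dvd B1"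
      using order_decomp[OF V0] by blast
    obtain j where j: "order x V = Suc j" using x V0 order_root[of V x] by (cases "order x V") auto
    note Vj = B1(1)[unfolded j]
    have n0: "poly B1 x \<noteq> 0" using B1 by (simp add: poly_eq_0_iff_dvd)
    have Ux: "poly U x \<noteq> 0"
    proof
      assume "poly U x = 0"
      then have "poly (cpoly U) (of_real x) = 0" by simp
      from coprime_imp_no_common_root[OF co this] x show False by simp
    qed
    define r where "r = poly U x / poly B1 x"
    have r: "r \<noteq> 0" using n0 Ux by (simp add: r_def)
    have ray: "r * sin (real (Suc j) * \<theta>) \<ge> 0" if "0 < \<theta>" "\<theta> < pi" for \<theta>
      unfolding r_def using pick that by (intro pick_pole_ray[OF Vj n0]) auto
    have "r > 0"
    proof -
      have "r * sin (real (Suc j) * (pi / (2 * real (Suc j)))) \<ge> 0"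
        by (rule ray) (auto simp: field_simps add_pos_nonneg)
      also have "real (Suc j) * (pi / (2 * real (Suc j))) = pi / 2" by (simp del: of_nat_Suc)
      finally show ?thesis using r by simp
    qed
    have "j = 0"
    proof (rule ccontr)
      assume "j \<noteq> 0"
      then have "real j \<ge> 1" by simp
      \<comment> \<open>This angle lies below pi exactly because the order is at least 2.\<close>
      then have "r * sin (real (Suc j) * (3 * pi / (2 * real (Suc j)))) \<ge> 0"
        by (intro ray) (auto simp: field_simps add_pos_nonneg)
      also have "real (Suc j) * (3 * pi / (2 * real (Suc j))) = 3 / 2 * pi" by (simp del: of_nat_Suc)
      finally show False using \<open>r > 0\<close> unfolding sin_3over2_pi by simp
    qed
    then have "V = [:- x, 1:] * B1" using Vj by (simp only: power_Suc power_0 mult_1_right)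
    then have "poly (pderiv V) x = poly B1 x"
      by (simp add: pderiv_mult pderiv_pCons del: mult_pCons_left)
    then show ?thesis using n0 \<open>r > 0\<close> by (simp add: r_def)
  qed
  define Y where "Y = {y. poly V y = 0}"
  have Y: "finite Y" unfolding Y_def by (rule poly_roots_finite[OF V0])
  have split: "V = smult (lead_coeff V) (node_poly Y)"
    unfolding Y_def using real simple by (intro real_simple_roots_split V0) auto
  have l: "lead_coeff V \<noteq> 0" using V0 by simp
  have card: "degree V = card Y" using l by (subst split) simp
  have c0: "coeff U (card Y) = 0" using deg card by (simp add: coeff_eq_0)
  show ?thesis
  proof (rule that[OF Y])
    show "poly U y / poly (pderiv V) y > 0 \<and> poly V y = 0" if "y \<in> Y" for y
      using simple that by (simp add: Y_def)
    show "poly U u / poly V u = (\<Sum>y\<in>Y. poly U y / poly (pderiv V) y / (u - y))" if "poly V u \<noteq> 0" for u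
      using partial_fractions[OF Y split l _ that, of U] deg card c0 by simp
  qed
qed

lemma pick_partial_fractions:
  fixes U V :: "real poly"
  assumes V0: "V \<noteq> 0" and deg: "degree U < degree V"
    and pick: "\<And>z. Im z > 0 \<Longrightarrow> poly (cpoly V) z \<noteq> 0 \<and> Im (poly (cpoly U) z / poly (cpoly V) z) < 0"
  obtains Y p where "finite Y" "\<And>y. y \<in> Y \<Longrightarrow> p y > 0 \<and> poly V y = 0"
    "\<And>u. poly V u \<noteq> 0 \<Longrightarrow> poly U u / poly V u = (\<Sum>y\<in>Y. p y / (u - y))"
proof -
  have U0: "U \<noteq> 0" using pick[of \<i>] by auto
  define g where "g = gcd U V"
  obtain U1 V1 where UV: "U = U1 * g" "V = V1 * g" "coprime U1 V1"
    using gcd_coprime_exists[of U V] V0 unfolding g_def by auto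
  have nz: "U1 \<noteq> 0" "V1 \<noteq> 0" "g \<noteq> 0" using UV U0 V0 by auto
  have "degree U1 < degree V1" using deg nz unfolding UV(1,2) by (simp add: degree_mult_eq)
  moreover have "poly (cpoly V1) z \<noteq> 0 \<and> Im (poly (cpoly U1) z / poly (cpoly V1) z) < 0" if "Im z > 0" for z
    using pick[OF that] unfolding UV(1,2) by auto
  ultimately obtain Y p where Y: "finite Y" "\<And>y. y \<in> Y \<Longrightarrow> p y > 0 \<and> poly V1 y = 0"
    "\<And>u. poly V1 u \<noteq> 0 \<Longrightarrow> poly U1 u / poly V1 u = (\<Sum>y\<in>Y. p y / (u - y))"
    using pick_partial_fractions_coprime[OF UV(3) nz(2)] by blast
  show ?thesis
  proof (rule that[OF Y(1)])
    show "p y > 0 \<and> poly V y = 0" if "y \<in> Y" for y using Y(2)[OF that] by (simp add: UV(2))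
    show "poly U u / poly V u = (\<Sum>y\<in>Y. p y / (u - y))" if "poly V u \<noteq> 0" for u
      using Y(3)[of u] that by (simp add: UV(1,2))
  qed
qed

text \<open>The Cauchy transform of the atomic measure with weights \<open>p\<close>. It is
  polymorphic since signs are studied at complex points and sizes at real ones.\<close>

definition stieltjes :: "real set \<Rightarrow> (real \<Rightarrow> real) \<Rightarrow> 'a :: real_field \<Rightarrow> 'a" where
  "stieltjes Y p z = (\<Sum>y\<in>Y. of_real (p y) / (z - of_real y))"

lemma Im_inverse_neg: "Im z > 0 \<Longrightarrow> Im (1 / z) < 0"
  by (simp add: Im_divide divide_neg_pos sum_power2_gt_zero_iff)

lemma Im_inverse_pos: "Im z < 0 \<Longrightarrow> Im (1 / z) > 0"
  by (simp add: Im_divide divide_neg_pos sum_power2_gt_zero_iff)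

lemma Im_stieltjes_neg:
  assumes "finite Y" "Y \<noteq> {}" "\<And>y. y \<in> Y \<Longrightarrow> p y > 0" "Im z > 0"
  shows "Im (stieltjes Y p z) < 0"
proof -
  have "Im (of_real (p y) / (z - of_real y)) < 0" if "y \<in> Y" for y
  proof -
    have "of_real (p y) / (z - of_real y) = of_real (p y) * (1 / (z - of_real y))" by simp
    then have "Im (of_real (p y) / (z - of_real y)) = p y * Im (1 / (z - of_real y))"
      by (simp only: times_complex.simps Re_complex_of_real Im_complex_of_real mult_zero_left add_0_right)
    then show ?thesis using assms(3)[OF that] Im_inverse_neg[of "z - of_real y"] assms(4)
      by (simp only: mult_less_0_iff) simp
  qed
  then have "(\<Sum>y\<in>Y. Im (of_real (p y) / (z - of_real y))) < (\<Sum>y\<in>Y. 0)"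
    using assms by (intro sum_strict_mono) auto
  then show ?thesis by (simp add: stieltjes_def)
qed

text \<open>For G = U / V the term c G / (1 - e G) is c U / (V - e U), so this is the denominator of
  the next iterate, whose numerator is the product of the V - e U. The map \<open>e\<close> is the
  embedding of the nodes into the field.\<close>

lemma poly_cumulant_step:
  fixes U V :: "'a :: field poly"
  assumes X: "finite X" and nz: "\<And>x. x \<in> X \<Longrightarrow> poly V z - e x * poly U z \<noteq> 0"
  shows "poly ([:- a, 1:] * (\<Prod>x\<in>X. V - smult (e x) U)
      - (\<Sum>x\<in>X. smult (c x) (U * (\<Prod>y\<in>X - {x}. V - smult (e y) U)))) z
    = poly (\<Prod>x\<in>X. V - smult (e x) U) z *
      (z - a - (\<Sum>x\<in>X. c x * (poly U z / (poly V z - e x * poly U z))))"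
proof -
  define W where "W = (\<Prod>x\<in>X. poly V z - e x * poly U z)"
  have "(\<Prod>y\<in>X - {x}. poly V z - e y * poly U z) = W / (poly V z - e x * poly U z)" if "x \<in> X" for x
    using nz[OF that] by (simp add: W_def prod.remove[OF X that])
  then have "(\<Sum>x\<in>X. c x * (poly U z * (\<Prod>y\<in>X - {x}. poly V z - e y * poly U z)))
      = W * (\<Sum>x\<in>X. c x * (poly U z / (poly V z - e x * poly U z)))"
    unfolding sum_distrib_left by (intro sum.cong) (auto simp: mult_ac)
  then show ?thesis
    by (simp add: poly_sum poly_prod algebra_simps flip: W_def)
qed

text \<open>The half-plane argument gives the new atoms and the positivity of their weights; the
  bound \<open>\<beta>\<close> on the real axis outside (-b, b) excludes zeros of the new
  denominator there and reproduces itself.\<close>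

lemma stieltjes_step:
  assumes Y: "finite Y" "Y \<noteq> {}" "\<And>y. y \<in> Y \<Longrightarrow> p y > 0 \<and> \<bar>y\<bar> < b"
    and G: "\<And>u::real. \<bar>u\<bar> \<ge> b \<Longrightarrow> \<bar>stieltjes Y p u\<bar> \<le> \<beta>"
    and X: "finite X" "\<And>x. x \<in> X \<Longrightarrow> c x > 0 \<and> \<bar>x\<bar> * \<beta> \<le> 1 / 2"
    and \<beta>: "\<beta> > 0" and b: "b - \<bar>a\<bar> - 2 * \<beta> * (\<Sum>x\<in>X. c x) \<ge> 1 / \<beta>"
  obtains Y' p' where "finite Y'" "Y' \<noteq> {}" "\<And>y. y \<in> Y' \<Longrightarrow> p' y > 0 \<and> \<bar>y\<bar> < b"
    "\<And>u::real. \<bar>u\<bar> \<ge> b \<Longrightarrow> \<bar>stieltjes Y' p' u\<bar> \<le> \<beta> \<and>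
      stieltjes Y' p' u * (u - a - (\<Sum>x\<in>X. c x * (stieltjes Y p u / (1 - x * stieltjes Y p u)))) = 1"
proof -
  define V where "V = node_poly Y"
  define U where "U = (\<Sum>y\<in>Y. smult (p y) (node_poly (Y - {y})))"
  define U' where "U' = (\<Prod>x\<in>X. V - smult x U)"
  define T where "T = (\<Sum>x\<in>X. smult (c x) (U * (\<Prod>y\<in>X - {x}. V - smult y U)))"
  define V' where "V' = [:- a, 1:] * U' - T"
  have degV: "degree V = card Y" by (simp add: V_def)
  have cardY: "card Y > 0" using Y by (simp add: card_gt_0_iff)
  have degU: "degree U < card Y"
  proof -
    have "degree U \<le> card Y - 1"
      unfolding U_def using Y(1) by (intro degree_sum_le) (auto intro!: order.trans[OF degree_smult_le])
    then show ?thesis using cardY by simp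
  qed
  have degD: "degree (V - smult x U) = card Y" "V - smult x U \<noteq> 0" for x
  proof -
    have "degree (- smult x U) < degree V"
      using degU degV degree_smult_le[of x U] by (simp only: degree_minus)
    from degree_add_eq_left[OF this] show "degree (V - smult x U) = card Y" by (simp add: degV)
    then show "V - smult x U \<noteq> 0" using cardY by auto
  qed
  have U'0: "U' \<noteq> 0" using X(1) degD by (simp add: U'_def)
  have degP: "degree (\<Prod>x\<in>Z. V - smult x U) = card Z * card Y" for Z
    using degD by (subst degree_prod_eq_sum_degree) auto
  have degT: "degree T \<le> degree U'"
    unfolding T_def
  proof (rule degree_sum_le[OF X(1)])
    fix x assume x: "x \<in> X"
    have "degree (smult (c x) (U * (\<Prod>y\<in>X - {x}. V - smult y U))) \<le> degree U + card (X - {x}) * card Y"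
      using order.trans[OF degree_smult_le degree_mult_le] by (metis degP)
    also have "\<dots> \<le> card Y + card (X - {x}) * card Y" using degU by simp
    also have "\<dots> = card X * card Y" using card.remove[OF X(1) x] by simp
    finally show "degree (smult (c x) (U * (\<Prod>y\<in>X - {x}. V - smult y U))) \<le> degree U'"
      by (simp add: U'_def degP)
  qed
  have "degree ([:- a, 1:] * U') = Suc (degree U')" using U'0 by (subst degree_mult_eq) auto
  then have "degree V' = Suc (degree U')"
    using degree_add_eq_left[of "- T" "[:- a, 1:] * U'"] degT by (simp add: V'_def del: mult_pCons_left)
  then have deg: "degree U' < degree V'" "V' \<noteq> 0" by auto
  have stC: "poly (cpoly U) z = stieltjes Y p z * poly (cpoly V) z" if "poly (cpoly V) z \<noteq> 0" for z
  proof -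
    have "poly (cpoly (node_poly (Y - {y}))) z = poly (cpoly V) z / (z - of_real y)" if "y \<in> Y" for y
      using \<open>poly (cpoly V) z \<noteq> 0\<close> that Y(1) by (auto simp: V_def poly_cpoly_node_poly prod.remove[OF Y(1) that])
    then show ?thesis by (simp add: U_def stieltjes_def poly_sum sum_distrib_right)
  qed
  have stR: "poly U u = stieltjes Y p u * poly V u" if "poly V u \<noteq> 0" for u :: real
  proof -
    have "poly (node_poly (Y - {y})) u = poly V u / (u - y)" if "y \<in> Y" for y
      using \<open>poly V u \<noteq> 0\<close> that Y(1) by (auto simp: V_def poly_node_poly prod.remove[OF Y(1) that])
    then show ?thesis by (simp add: U_def stieltjes_def poly_sum sum_distrib_right)
  qed
  have pick: "poly (cpoly V') z \<noteq> 0 \<and> Im (poly (cpoly U') z / poly (cpoly V') z) < 0" if z: "Im z > 0" for z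
  proof -
    define g where "g = stieltjes Y p z"
    have Img: "Im g < 0" unfolding g_def using Y z by (intro Im_stieltjes_neg) auto
    have Vz: "poly (cpoly V) z \<noteq> 0" using Y(1) z by (auto simp: V_def poly_cpoly_node_poly)
    have Uz: "poly (cpoly U) z = g * poly (cpoly V) z" using stC[OF Vz] by (simp add: g_def)
    have g1: "1 - of_real x * g \<noteq> 0" for x
    proof
      assume e: "1 - of_real x * g = 0"
      then have "Im (1 - of_real x * g) = 0" by (simp only: zero_complex.simps)
      then have "x = 0" using Img by simp
      with e show False by simp
    qed
    have nz: "poly (cpoly V) z - of_real x * poly (cpoly U) z \<noteq> 0" for x
    proof -
      have "poly (cpoly V) z - of_real x * poly (cpoly U) z = (1 - of_real x * g) * poly (cpoly V) z"
        by (simp add: Uz algebra_simps)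
      then show ?thesis using Vz g1 by simp
    qed
    define K where "K = z - of_real a - (\<Sum>x\<in>X. of_real (c x) * (poly (cpoly U) z / (poly (cpoly V) z - of_real x * poly (cpoly U) z)))"
    have "cpoly V' = [:- of_real a, 1:] * (\<Prod>x\<in>X. cpoly V - smult (of_real x) (cpoly U))
      - (\<Sum>x\<in>X. smult (of_real (c x)) (cpoly U * (\<Prod>y\<in>X - {x}. cpoly V - smult (of_real y) (cpoly U))))"
      by (simp add: V'_def U'_def T_def)
    then have V'z: "poly (cpoly V') z = poly (cpoly U') z * K"
      using poly_cumulant_step[OF X(1), of "cpoly V" z of_real "cpoly U" "of_real a" "\<lambda>x. of_real (c x)"] nz
      by (simp add: K_def U'_def)
    have U'z: "poly (cpoly U') z \<noteq> 0" using X(1) nz by (auto simp: U'_def poly_prod)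
    have "Im (of_real (c x) * (poly (cpoly U) z / (poly (cpoly V) z - of_real x * poly (cpoly U) z))) \<le> 0"
      if x: "x \<in> X" for x
    proof -
      have g0: "g \<noteq> 0" using Img by auto
      \<comment> \<open>Written as 1 / (1/g - x), each summand is a twofold inversion and keeps the
        sign of the imaginary part of g. Hence K lies in the upper half-plane and 1 / K in the lower
        one.\<close>
      have "poly (cpoly V) z - of_real x * poly (cpoly U) z = (1 - of_real x * g) * poly (cpoly V) z"
        by (simp add: Uz algebra_simps)
      then have "poly (cpoly U) z / (poly (cpoly V) z - of_real x * poly (cpoly U) z) = g / (1 - of_real x * g)"
        using Vz by (simp add: Uz)
      also have "\<dots> = 1 / (1 / g - of_real x)" using g0 g1[of x] by (simp add: divide_simps)
      finally have e: "poly (cpoly U) z / (poly (cpoly V) z - of_real x * poly (cpoly U) z) = 1 / (1 / g - of_real x)" .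
      have "Im (1 / (1 / g - of_real x)) < 0"
        using Im_inverse_pos[OF Img] by (intro Im_inverse_neg) simp
      moreover have "Im (of_real (c x) * (1 / (1 / g - of_real x))) = c x * Im (1 / (1 / g - of_real x))"
        by (simp only: times_complex.simps Re_complex_of_real Im_complex_of_real mult_zero_left add_0_right)
      ultimately show ?thesis unfolding e using X(2)[OF x] by (simp only: mult_le_0_iff) simp
    qed
    then have "(\<Sum>x\<in>X. Im (of_real (c x) * (poly (cpoly U) z / (poly (cpoly V) z - of_real x * poly (cpoly U) z)))) \<le> 0"
      by (rule sum_nonpos)
    then have ImK: "Im K > 0" using z unfolding K_def minus_complex.simps Im_sum Im_complex_of_real by linarith
    then have "K \<noteq> 0" by auto
    then show ?thesis using V'z U'z Im_inverse_neg[OF ImK] by simp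
  qed
  obtain Y' p' where Y': "finite Y'" "\<And>y. y \<in> Y' \<Longrightarrow> p' y > 0 \<and> poly V' y = 0"
    "\<And>u. poly V' u \<noteq> 0 \<Longrightarrow> poly U' u / poly V' u = (\<Sum>y\<in>Y'. p' y / (u - y))"
    using pick_partial_fractions[OF deg(2,1) pick] by blast
  have real: "poly V' u \<noteq> 0 \<and> \<bar>stieltjes Y' p' u\<bar> \<le> \<beta> \<and>
      stieltjes Y' p' u * (u - a - (\<Sum>x\<in>X. c x * (stieltjes Y p u / (1 - x * stieltjes Y p u)))) = 1"
    if u: "\<bar>u\<bar> \<ge> b" for u :: real
  proof -
    define g where "g = stieltjes Y p u"
    have Vu: "poly V u \<noteq> 0" using Y u by (force simp: V_def poly_node_poly_eq_0_iff)
    have Uu: "poly U u = g * poly V u" using stR[OF Vu] by (simp add: g_def)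
    have g: "\<bar>g\<bar> \<le> \<beta>" unfolding g_def by (rule G[OF u])
    have xg: "\<bar>x * g\<bar> \<le> 1 / 2" if "x \<in> X" for x
    proof -
      have "\<bar>x * g\<bar> \<le> \<bar>x\<bar> * \<beta>" unfolding abs_mult using g by (intro mult_left_mono) auto
      then show ?thesis using X(2)[OF that] by linarith
    qed
    have e: "poly V u - x * poly U u = (1 - x * g) * poly V u" for x
      by (simp add: Uu algebra_simps)
    have nz: "poly V u - x * poly U u \<noteq> 0" if "x \<in> X" for x
      unfolding e using xg[OF that] Vu by auto
    define K where "K = u - a - (\<Sum>x\<in>X. c x * (g / (1 - x * g)))"
    have "poly V' u = poly U' u * (u - a - (\<Sum>x\<in>X. c x * (poly U u / (poly V u - x * poly U u))))"
      using poly_cumulant_step[OF X(1), of V u "\<lambda>x. x" U a c] nz by (simp add: V'_def U'_def T_def)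
    also have "(\<Sum>x\<in>X. c x * (poly U u / (poly V u - x * poly U u))) = (\<Sum>x\<in>X. c x * (g / (1 - x * g)))"
      unfolding e using Vu by (simp add: Uu)
    finally have V'u: "poly V' u = poly U' u * K" by (simp add: K_def)
    have U'u: "poly U' u \<noteq> 0" using X(1) nz by (auto simp: U'_def poly_prod)
    \<comment> \<open>The bound 1/2 on |x g| costs a factor 2; the assumption on b then leaves |K|
      \<ge> 1 / \<beta>.\<close>
    have "\<bar>\<Sum>x\<in>X. c x * (g / (1 - x * g))\<bar> \<le> (\<Sum>x\<in>X. c x * (2 * \<beta>))"
    proof (rule order.trans[OF sum_abs sum_mono])
      fix x assume x: "x \<in> X"
      have "\<bar>1 - x * g\<bar> \<ge> 1 / 2" using xg[OF x] by linarith
      then have "\<bar>g\<bar> / \<bar>1 - x * g\<bar> \<le> \<beta> / (1 / 2)" using g \<beta> by (intro frac_le) auto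
      then have "c x * (\<bar>g\<bar> / \<bar>1 - x * g\<bar>) \<le> c x * (2 * \<beta>)" using X(2)[OF x] by (intro mult_left_mono) auto
      then show "\<bar>c x * (g / (1 - x * g))\<bar> \<le> c x * (2 * \<beta>)" using X(2)[OF x] by (simp add: abs_mult)
    qed
    also have "\<dots> = 2 * \<beta> * (\<Sum>x\<in>X. c x)" by (simp add: sum_distrib_right[symmetric])
    finally have K: "\<bar>K\<bar> \<ge> 1 / \<beta>" using b u unfolding K_def by linarith
    then have K0: "K \<noteq> 0" using \<beta> by auto
    then have V'0: "poly V' u \<noteq> 0" using V'u U'u by simp
    have st: "stieltjes Y' p' u = 1 / K"
      using Y'(3)[OF V'0] V'u U'u by (simp add: stieltjes_def)
    have "\<bar>1 / K\<bar> \<le> \<beta>"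
      using K \<beta> K0 by (simp add: field_simps)
    then show ?thesis using V'0 st K0 by (simp add: K_def g_def)
  qed
  show ?thesis
  proof (rule that[of Y' p'])
    show "finite Y'" by fact
    show "p' y > 0 \<and> \<bar>y\<bar> < b" if "y \<in> Y'" for y
      using Y'(2)[OF that] real[of y] by (cases "\<bar>y\<bar> \<ge> b") auto
    \<comment> \<open>Without atoms the transform would be 0, but its product with K is 1.\<close>
    show "Y' \<noteq> {}" using real[of "\<bar>b\<bar>"] abs_ge_self[of b] by (auto simp: stieltjes_def)
  qed (use real in blast)
qed

section \<open>Iterating the subordination equation\<close>

text \<open>Dividing by the power of x at the subdegree leaves a continuous function that vanishes
  near 0 but has the nonzero leading coefficient as its value at 0.\<close>

lemma has_fps_expansion_real_zero:
  fixes f :: "real \<Rightarrow> real"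
  assumes f: "f has_fps_expansion A" and z: "\<forall>\<^sub>F x in nhds 0. f x = 0"
  shows "A = 0"
proof (rule ccontr)
  assume A: "A \<noteq> 0"
  define n where "n = subdegree A"
  define g where "g x = (if x = 0 then fps_nth A n else f x / x ^ n)" for x
  have "g has_fps_expansion fps_shift n A"
    unfolding g_def by (intro has_fps_expansion_shift f) (auto simp: n_def)
  then have "(g \<longlongrightarrow> g 0) (at 0)"
    using has_fps_expansion_imp_continuous[of g _ UNIV] by (simp add: continuous_def)
  moreover have "\<forall>\<^sub>F x in at 0. g x = 0"
    using z unfolding eventually_at_filter by eventually_elim (simp add: g_def)
  then have "(g \<longlongrightarrow> 0) (at 0)" by (simp add: tendsto_eventually)
  ultimately have "g 0 = 0" by (intro tendsto_unique[of "at 0"]) auto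
  then show False using A by (simp add: g_def n_def)
qed

lemma has_fps_expansion_real_unique:
  fixes f :: "real \<Rightarrow> real"
  assumes "f has_fps_expansion A" "g has_fps_expansion B" "\<forall>\<^sub>F x in nhds 0. f x = g x"
  shows "A = B"
  using has_fps_expansion_real_zero[OF has_fps_expansion_diff[OF assms(1,2)]] assms(3)
  by (auto elim: eventually_mono)

definition moment_fps :: "real set \<Rightarrow> (real \<Rightarrow> real) \<Rightarrow> real fps" where
  "moment_fps Y p = fps_X * Abs_fps (\<lambda>k. \<Sum>y\<in>Y. p y * y ^ k)"

text \<open>This is X R(D) / D for the Levy form R. It turns D = X (1 + R(D)) into D (1 - tail) = X,
  the same shape as one step of the iteration of Cauchy transforms.\<close>

definition cumulant_tail :: "real \<Rightarrow> real set \<Rightarrow> (real \<Rightarrow> real) \<Rightarrow> real fps \<Rightarrow> real fps" where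
  "cumulant_tail a X c D = fps_X * (fps_const a + (\<Sum>x\<in>X. fps_const (c x) * (D * inverse (1 - fps_const x * D))))"

lemma moment_fps_expansion:
  "(\<lambda>w. \<Sum>y\<in>Y. p y * (w * inverse (1 - y * w))) has_fps_expansion moment_fps Y p"
proof -
  have "(\<lambda>w. \<Sum>y\<in>Y. p y * (w * inverse (1 - y * w))) has_fps_expansion
      (\<Sum>y\<in>Y. fps_const (p y) * (fps_X * inverse (1 - fps_const y * fps_X)))"
    by (intro fps_expansion_intros) auto
  also have "(\<Sum>y\<in>Y. fps_const (p y) * (fps_X * inverse (1 - fps_const y * fps_X))) = moment_fps Y p"
  proof (rule fps_ext)
    fix n
    show "fps_nth (\<Sum>y\<in>Y. fps_const (p y) * (fps_X * inverse (1 - fps_const y * fps_X))) n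
      = fps_nth (moment_fps Y p) n"
      unfolding fps_inverse_linear moment_fps_def by (cases n) (auto simp: fps_sum_nth mult.assoc)
  qed
  finally show ?thesis .
qed

text \<open>At u = 1/w the Cauchy transform is the moment series in w. The identity for |u| \<ge> b
  thus holds near w = 0, and expansions there are unique.\<close>

lemma moment_fps_step:
  assumes b: "b > 0" and Y: "\<And>y. y \<in> Y \<Longrightarrow> \<bar>y\<bar> < b" and Y': "\<And>y. y \<in> Y' \<Longrightarrow> \<bar>y\<bar> < b"
    and st: "\<And>u::real. \<bar>u\<bar> \<ge> b \<Longrightarrow>
      stieltjes Y' p' u * (u - a - (\<Sum>x\<in>X. c x * (stieltjes Y p u / (1 - x * stieltjes Y p u)))) = 1"
  shows "moment_fps Y' p' * (1 - cumulant_tail a X c (moment_fps Y p)) = fps_X"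
proof -
  define d where "d w = (\<Sum>y\<in>Y. p y * (w * inverse (1 - y * w)))" for w :: real
  define d' where "d' w = (\<Sum>y\<in>Y'. p' y * (w * inverse (1 - y * w)))" for w :: real
  have exp: "d has_fps_expansion moment_fps Y p" "d' has_fps_expansion moment_fps Y' p'"
    unfolding d_def d'_def by (rule moment_fps_expansion)+
  have "(\<lambda>w. d' w * (1 - w * (a + (\<Sum>x\<in>X. c x * (d w * inverse (1 - x * d w))))))
      has_fps_expansion moment_fps Y' p' * (1 - cumulant_tail a X c (moment_fps Y p))"
    unfolding cumulant_tail_def using exp
    by (intro fps_expansion_intros) (auto simp: moment_fps_def)
  moreover have "(\<lambda>w::real. w) has_fps_expansion fps_X" by (rule has_fps_expansion_fps_X)
  moreover have "\<forall>\<^sub>F w in nhds 0. d' w * (1 - w * (a + (\<Sum>x\<in>X. c x * (d w * inverse (1 - x * d w))))) = w"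
  proof -
    have "\<forall>\<^sub>F w in nhds (0::real). \<bar>w\<bar> < 1 / b"
      using b by (auto simp: eventually_nhds_metric intro!: exI[of _ "1 / b"])
    then show ?thesis
    proof eventually_elim
      case (elim w)
      show ?case
      proof (cases "w = 0")
        case True
        then show ?thesis by (simp add: d'_def)
      next
        case False
        have u: "\<bar>1 / w\<bar> \<ge> b" using elim False b by (simp add: field_simps)
        have kern: "w * inverse (1 - y * w) = 1 / (1 / w - y)" for y
          using False by (simp add: divide_simps)
        have "stieltjes Y p (1 / w) = d w" "stieltjes Y' p' (1 / w) = d' w"
          unfolding d_def d'_def kern by (simp_all add: stieltjes_def)
        define S where "S = (\<Sum>x\<in>X. c x * (d w * inverse (1 - x * d w)))"
        have "d' w * (1 / w - a - S) = 1"
          using st[OF u] \<open>stieltjes Y p (1 / w) = d w\<close> \<open>stieltjes Y' p' (1 / w) = d' w\<close>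
          by (simp add: S_def divide_inverse)
        moreover have "d' w * (1 - w * (a + S)) = w * (d' w * (1 / w - a - S))"
          using False by (simp add: field_simps)
        ultimately show ?thesis by (simp add: S_def)
      qed
    qed
  qed
  ultimately show ?thesis by (rule has_fps_expansion_real_unique)
qed

text \<open>The difference of two resolvent terms contains D - E, and the outer factor X gains one
  more order: the map contracts in the X-adic sense.\<close>

lemma cumulant_tail_diff_dvd:
  assumes "fps_nth D 0 = 0" "fps_nth E 0 = 0"
  shows "fps_X * (D - E) dvd cumulant_tail a X c D - cumulant_tail a X c E"
proof -
  have key: "fps_const (c x) * (D * inverse (1 - fps_const x * D)) - fps_const (c x) * (E * inverse (1 - fps_const x * E))
    = (D - E) * (fps_const (c x) * inverse (1 - fps_const x * D) * inverse (1 - fps_const x * E))" for x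
  proof -
    define i j where "i = inverse (1 - fps_const x * D)" and "j = inverse (1 - fps_const x * E)"
    have i: "i * (1 - fps_const x * D) = 1" and j: "j * (1 - fps_const x * E) = 1"
      unfolding i_def j_def using assms by (simp_all add: inverse_mult_eq_1)
    have "D * i - E * j = D * i * (j * (1 - fps_const x * E)) - E * j * (i * (1 - fps_const x * D))"
      by (simp only: i j mult_1_right)
    also have "\<dots> = (D - E) * (i * j)" by (simp add: algebra_simps)
    finally have e: "D * i - E * j = (D - E) * (i * j)" .
    have "fps_const (c x) * (D * i) - fps_const (c x) * (E * j) = (D - E) * (fps_const (c x) * i * j)"
      unfolding right_diff_distrib[symmetric] e by (simp only: mult_ac)
    then show ?thesis by (simp only: i_def j_def)
  qed
  have "cumulant_tail a X c D - cumulant_tail a X c E = fps_X * (\<Sum>x\<in>X.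
      fps_const (c x) * (D * inverse (1 - fps_const x * D)) - fps_const (c x) * (E * inverse (1 - fps_const x * E)))"
    unfolding cumulant_tail_def
    by (simp only: right_diff_distrib[symmetric] add_diff_cancel_left sum_subtractf[symmetric])
  also have "\<dots> = fps_X * (D - E) *
     (\<Sum>x\<in>X. fps_const (c x) * inverse (1 - fps_const x * D) * inverse (1 - fps_const x * E))"
    unfolding key by (simp only: sum_distrib_left mult.assoc)
  finally show ?thesis by simp
qed

text \<open>Subtracting the two equations shows that each step makes one more coefficient exact,
  whatever the starting series with zero constant term.\<close>

lemma moment_fps_approx:
  assumes D: "fps_nth D 0 = 0" "D * (1 - cumulant_tail a X c D) = fps_X"
    and E: "\<And>n. fps_nth (E n) 0 = 0" "\<And>n. E (Suc n) * (1 - cumulant_tail a X c (E n)) = fps_X"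
  shows "fps_X ^ n dvd D - E n"
proof (induction n)
  case 0
  show ?case by simp
next
  case (Suc n)
  let ?S = "cumulant_tail a X c"
  have "(D - E (Suc n)) * (1 - ?S D) = E (Suc n) * (?S D - ?S (E n))"
  proof -
    have "(D - E (Suc n)) * (1 - ?S D) = E (Suc n) * (1 - ?S (E n)) - E (Suc n) * (1 - ?S D)"
      unfolding left_diff_distrib D(2) E(2) ..
    also have "\<dots> = E (Suc n) * (?S D - ?S (E n))" by (simp add: algebra_simps)
    finally show ?thesis .
  qed
  moreover have "fps_X * fps_X ^ n dvd ?S D - ?S (E n)"
    using cumulant_tail_diff_dvd[OF D(1) E(1)] mult_dvd_mono[OF dvd_refl Suc] by (rule dvd_trans[rotated])
  ultimately have "fps_X ^ Suc n dvd (D - E (Suc n)) * (1 - ?S D)" by simp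
  moreover have "is_unit (1 - ?S D)" by (simp add: fps_is_unit_iff cumulant_tail_def)
  ultimately show ?case by (simp only: dvd_mult_unit_iff)
qed

text \<open>From D P(D) = X Q(D) and Q = (1 + R) P the factor P(D) cancels, as its constant term is
  1.\<close>

lemma comp_inverse_cumulant:
  assumes r: "is_rep P Q F" and X: "finite X" and R: "fps_of_poly Q / fps_of_poly P - 1 = cumulant_fps a X c"
  shows "comp_inverse F * (1 - cumulant_tail a X c (comp_inverse F)) = fps_X"
proof -
  define D where "D = comp_inverse F"
  have "F \<in> Frat" using r by (auto simp: Frat_def)
  then have D0: "fps_nth D 0 = 0" unfolding D_def by (rule comp_inverse_is_inverse)
  let ?P = "fps_of_poly P oo D" and ?Q = "fps_of_poly Q oo D"
  have "fps_of_poly Q = (1 + cumulant_fps a X c) * fps_of_poly P"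
    using is_rep_coeff_0[OF r] unfolding R[symmetric] by (simp add: fps_divide_unit mult.assoc inverse_mult_eq_1)
  then have "?Q = (1 + (cumulant_fps a X c oo D)) * ?P"
    using D0 by (simp add: fps_compose_mult_distrib fps_compose_add_distrib)
  moreover have "D * ?P = fps_X * ?Q" unfolding D_def by (rule comp_inverse_equation[OF r])
  ultimately have "D * ?P = fps_X * (1 + (cumulant_fps a X c oo D)) * ?P" by (simp add: mult.assoc)
  moreover have "?P \<noteq> 0"
    using is_rep_coeff_0[OF r] by (metis fps_compose_nth_0 fps_of_poly_nth fps_zero_nth zero_neq_one)
  ultimately have D: "D = fps_X * (1 + (cumulant_fps a X c oo D))" by simp
  have "fps_X * (cumulant_fps a X c oo D) = D * cumulant_tail a X c D"
  proof -
    have inv: "inverse (1 - fps_const x * fps_X) oo D = inverse (1 - fps_const x * D)" for x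
    proof -
      have "(inverse (1 - fps_const x * fps_X) * (1 - fps_const x * fps_X)) oo D = 1 oo D"
        by (subst inverse_mult_eq_1) auto
      then have "(inverse (1 - fps_const x * fps_X) oo D) * (1 - fps_const x * D) = 1"
        using D0 by (simp add: fps_compose_mult_distrib fps_compose_sub_distrib)
      then show ?thesis by (metis fps_inverse_unique mult.commute)
    qed
    have "cumulant_fps a X c oo D = fps_const a * D + (\<Sum>x\<in>X. fps_const (c x) * D\<^sup>2 * inverse (1 - fps_const x * D))"
      using D0 by (simp add: cumulant_fps_def fps_compose_add_distrib fps_compose_sum_distrib
          fps_compose_mult_distrib inv fps_compose_power[symmetric])
    also have "\<dots> = D * (fps_const a + (\<Sum>x\<in>X. fps_const (c x) * (D * inverse (1 - fps_const x * D))))"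
      by (simp add: ring_distribs sum_distrib_left power2_eq_square mult_ac)
    finally show ?thesis by (simp add: cumulant_tail_def mult_ac)
  qed
  with D have "D = fps_X + D * cumulant_tail a X c D" by (simp add: ring_distribs)
  then show ?thesis by (simp add: D_def algebra_simps)
qed

text \<open>A pmf carries the discrete sigma-algebra; the push-forward along the identity moves it
  to the Borel sets that \<open>real_distribution\<close> requires.\<close>

definition atomic_measure :: "real set \<Rightarrow> (real \<Rightarrow> real) \<Rightarrow> real measure" where
  "atomic_measure Y p = distr (measure_pmf (embed_pmf (\<lambda>y. if y \<in> Y then p y else 0))) borel (\<lambda>x. x)"

lemma atomic_measure:
  assumes Y: "finite Y" and p: "\<And>y. y \<in> Y \<Longrightarrow> p y > 0" and sum: "(\<Sum>y\<in>Y. p y) = 1"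
  shows "real_distribution (atomic_measure Y p)"
    and "f \<in> borel_measurable borel \<Longrightarrow> (\<integral>x. f x \<partial>atomic_measure Y p) = (\<Sum>y\<in>Y. p y * (f y :: real))"
    and "A \<in> sets borel \<Longrightarrow> Y \<subseteq> A \<Longrightarrow> measure (atomic_measure Y p) A = 1"
proof -
  define g where "g y = (if y \<in> Y then p y else 0)" for y
  have nn: "g y \<ge> 0" for y using p by (simp add: g_def less_imp_le)
  have "(\<integral>\<^sup>+y. ennreal (g y) \<partial>count_space UNIV) = (\<Sum>y\<in>Y. ennreal (g y))"
    using Y by (intro nn_integral_count_space'[of Y]) (auto simp: g_def)
  also have "\<dots> = ennreal (\<Sum>y\<in>Y. p y)" using nn p by (simp add: sum_ennreal g_def less_imp_le)
  finally have one: "(\<integral>\<^sup>+y. ennreal (g y) \<partial>count_space UNIV) = 1" by (simp add: sum)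
  define M where "M = embed_pmf g"
  have pmf: "pmf M y = g y" for y unfolding M_def by (rule pmf_embed_pmf[OF nn one])
  have setM: "set_pmf M \<subseteq> Y" using pmf by (auto simp: set_pmf_iff g_def split: if_splits)
  have am: "atomic_measure Y p = distr (measure_pmf M) borel (\<lambda>x. x)"
    by (simp add: atomic_measure_def M_def g_def[abs_def])
  show "real_distribution (atomic_measure Y p)"
    unfolding am by (rule prob_space.real_distribution_distr) (auto intro: measure_pmf.prob_space_axioms)
  show "(\<integral>x. f x \<partial>atomic_measure Y p) = (\<Sum>y\<in>Y. p y * f y)" if "f \<in> borel_measurable borel"
  proof -
    have "(\<integral>x. f x \<partial>atomic_measure Y p) = measure_pmf.expectation M f"
      unfolding am using that by (subst integral_distr) auto
    also have "\<dots> = (\<Sum>y\<in>Y. f y * pmf M y)"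
      using setM Y by (intro integral_measure_pmf_real) auto
    finally show ?thesis by (simp add: pmf g_def mult.commute)
  qed
  show "measure (atomic_measure Y p) A = 1" if A: "A \<in> sets borel" "Y \<subseteq> A"
  proof -
    have "measure (atomic_measure Y p) A = measure_pmf.prob M A"
      unfolding am using A by (subst measure_distr) auto
    also have "\<dots> = 1" using setM A(2) by (subst measure_pmf.prob_eq_1) (auto simp: AE_measure_pmf_iff)
    finally show ?thesis .
  qed
qed

text \<open>Weak convergence tests only bounded functions, so powers are taken of the cut-off
  \<open>\<kappa>\<close> to [-b, b], which changes nothing on the atoms. Pushing the weak limit
  forward along \<open>\<kappa>\<close> yields the moments without examining the support of that
  limit.\<close>

lemma atomic_limit_moments:
  fixes Y :: "nat \<Rightarrow> real set" and p :: "nat \<Rightarrow> real \<Rightarrow> real" and m :: "nat \<Rightarrow> real"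
  assumes Y: "\<And>n. finite (Y n)" "\<And>n y. y \<in> Y n \<Longrightarrow> p n y > 0" "\<And>n y. y \<in> Y n \<Longrightarrow> \<bar>y\<bar> < b"
    and one: "\<And>n. (\<Sum>y\<in>Y n. p n y) = 1"
    and mom: "\<And>k. \<forall>\<^sub>F n in sequentially. (\<Sum>y\<in>Y n. p n y * y ^ k) = m k"
  shows "\<exists>\<nu>. real_distribution \<nu> \<and> has_moments \<nu> m"
proof -
  define \<mu> where "\<mu> n = atomic_measure (Y n) (p n)" for n
  note am = atomic_measure[OF Y(1,2) one, folded \<mu>_def]
  have b: "b > 0"
  proof -
    have "Y 0 \<noteq> {}" using one[of 0] by auto
    then show ?thesis using Y(3)[of _ 0] by force
  qed
  have tight: "tight \<mu>"
    unfolding tight_def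
  proof (intro conjI allI impI exI)
    show "real_distribution (\<mu> n)" for n by (rule am(1))
    show "- b < b" using b by simp
    fix \<epsilon> :: real and n assume "\<epsilon> > 0"
    have "measure (\<mu> n) {- b<..b} = 1" using Y(3)[of _ n] by (intro am(3)) force+
    then show "1 - \<epsilon> < measure (\<mu> n) {- b<..b}" using \<open>\<epsilon> > 0\<close> by simp
  qed
  obtain r M where r: "strict_mono r" and M: "real_distribution M" and conv: "weak_conv_m (\<mu> \<circ> id \<circ> r) M"
    using tight_imp_convergent_subsubsequence[OF tight, of id] by (auto simp: strict_mono_id)
  define \<kappa> where "\<kappa> x = max (- b) (min b x)" for x :: real
  have \<kappa>c: "isCont (\<lambda>x. \<kappa> x ^ k) x" for k x
    unfolding \<kappa>_def by (intro continuous_intros)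
  have \<kappa>b: "norm (\<kappa> x ^ k) \<le> b ^ k" for k x
    using b by (auto simp: \<kappa>_def power_abs norm_power intro!: power_mono)
  have [measurable]: "\<kappa> \<in> borel_measurable borel" unfolding \<kappa>_def by measurable
  interpret M: real_distribution M by fact
  have int: "(\<integral>x. \<kappa> x ^ k \<partial>M) = m k" for k
  proof -
    have "(\<lambda>n. \<integral>x. \<kappa> x ^ k \<partial>\<mu> (r n)) \<longlonglongrightarrow> (\<integral>x. \<kappa> x ^ k \<partial>M)"
      using weak_conv_imp_integral_bdd_continuous_conv[OF _ M conv \<kappa>c \<kappa>b] am(1) by simp
    moreover have "\<forall>\<^sub>F n in sequentially. (\<integral>x. \<kappa> x ^ k \<partial>\<mu> (r n)) = m k"
    proof -
      have "\<forall>\<^sub>F n in sequentially. (\<Sum>y\<in>Y (r n). p (r n) y * y ^ k) = m k"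
        using mom[of k] filterlim_subseq[OF r] by (rule eventually_compose_filterlim)
      then show ?thesis
      proof eventually_elim
        case (elim n)
        have "(\<integral>x. \<kappa> x ^ k \<partial>\<mu> (r n)) = (\<Sum>y\<in>Y (r n). p (r n) y * \<kappa> y ^ k)"
          by (rule am(2)) measurable
        also have "\<dots> = (\<Sum>y\<in>Y (r n). p (r n) y * y ^ k)"
          using Y(3)[of _ "r n"] by (intro sum.cong) (force simp: \<kappa>_def)+
        finally show ?case using elim by simp
      qed
    qed
    ultimately show ?thesis by (metis LIMSEQ_unique tendsto_eventually)
  qed
  have "real_distribution (distr M borel \<kappa>)"
    by (rule M.real_distribution_distr) measurable
  moreover have "has_moments (distr M borel \<kappa>) m"
    unfolding has_moments_def
  proof (intro allI conjI)
    fix k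
    have "integrable M (\<lambda>x. \<kappa> x ^ k)"
      using \<kappa>b by (intro M.integrable_const_bound[where B = "b ^ k"]) auto
    then show "integrable (distr M borel \<kappa>) (\<lambda>x. x ^ k)" by (subst integrable_distr_eq) auto
    show "m k = (\<integral>x. x ^ k \<partial>distr M borel \<kappa>)" by (subst integral_distr) (auto simp: int)
  qed
  ultimately show ?thesis by blast
qed

lemma cumulant_form_imp_moments:
  assumes r: "is_rep P Q F" and X: "finite X" "\<And>x. x \<in> X \<Longrightarrow> c x > 0"
    and R: "fps_of_poly Q / fps_of_poly P - 1 = cumulant_fps a X c"
  shows "\<exists>\<nu>. real_distribution \<nu> \<and> has_moments \<nu> (\<lambda>n. s_coeff n F)"
proof -
  \<comment> \<open>The constant dominates all nodes and is positive even for empty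
    \<open>X\<close>; \<open>\<beta>\<close> and \<open>b\<close> are then chosen to meet the
    conditions of the step with equality in the one on \<open>b\<close>.\<close>
  define \<xi> where "\<xi> = (\<Sum>x\<in>X. \<bar>x\<bar>) + 1"
  define \<beta> where "\<beta> = 1 / (2 * \<xi>)"
  define b where "b = \<bar>a\<bar> + 2 * \<beta> * (\<Sum>x\<in>X. c x) + 1 / \<beta>"
  have \<xi>: "\<xi> > 0" unfolding \<xi>_def by (intro add_nonneg_pos sum_nonneg) auto
  have \<beta>: "\<beta> > 0" using \<xi> by (simp add: \<beta>_def)
  have x\<beta>: "c x > 0 \<and> \<bar>x\<bar> * \<beta> \<le> 1 / 2" if "x \<in> X" for x
  proof -
    have "\<bar>x\<bar> \<le> (\<Sum>x\<in>X. \<bar>x\<bar>)" using that X(1) by (intro member_le_sum) auto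
    then have "\<bar>x\<bar> \<le> \<xi>" by (simp add: \<xi>_def)
    then show ?thesis using \<xi> X(2)[OF that] by (simp add: \<beta>_def field_simps)
  qed
  have "(\<Sum>x\<in>X. c x) \<ge> 0" using X(2) by (intro sum_nonneg) (auto intro: less_imp_le)
  then have "2 * \<beta> * (\<Sum>x\<in>X. c x) \<ge> 0" using \<beta> by simp
  then have b: "b \<ge> 1 / \<beta>" "b - \<bar>a\<bar> - 2 * \<beta> * (\<Sum>x\<in>X. c x) \<ge> 1 / \<beta>" by (simp_all add: b_def)
  moreover have "1 / \<beta> > 0" using \<beta> by simp
  ultimately have b0: "b > 0" by linarith
  define inv where "inv s \<longleftrightarrow> finite (fst s) \<and> fst s \<noteq> {} \<and> (\<forall>y\<in>fst s. snd s y > 0 \<and> \<bar>y\<bar> < b) \<and>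
    (\<forall>u::real. \<bar>u\<bar> \<ge> b \<longrightarrow> \<bar>stieltjes (fst s) (snd s) u\<bar> \<le> \<beta>)" for s :: "real set \<times> (real \<Rightarrow> real)"
  define step where "step s s' \<longleftrightarrow> (\<forall>u::real. \<bar>u\<bar> \<ge> b \<longrightarrow> stieltjes (fst s') (snd s') u *
    (u - a - (\<Sum>x\<in>X. c x * (stieltjes (fst s) (snd s) u / (1 - x * stieltjes (fst s) (snd s) u)))) = 1)"
    for s s' :: "real set \<times> (real \<Rightarrow> real)"
  have "\<exists>s. inv s"
  proof
    have "\<bar>1 / u\<bar> \<le> \<beta>" if "\<bar>u\<bar> \<ge> b" for u :: real
    proof -
      have "1 / \<beta> \<le> \<bar>u\<bar>" using that b by linarith
      then show ?thesis using \<beta> that b0 by (simp add: field_simps)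
    qed
    \<comment> \<open>The start is the unit mass at 0, with transform 1 / u, which is small enough
      since b \<ge> 1 / \<beta>.\<close>
    then show "inv ({0}, \<lambda>_. 1)" using b0 by (simp add: inv_def stieltjes_def)
  qed
  moreover have "\<exists>s'. inv s' \<and> step s s'" if "inv s" for s
  proof -
    obtain Y p where s: "s = (Y, p)" by (cases s)
    show ?thesis
    proof (rule stieltjes_step[of Y p b \<beta> X c a])
      fix Y' p' assume *: "finite Y'" "Y' \<noteq> {}" "\<And>y. y \<in> Y' \<Longrightarrow> p' y > 0 \<and> \<bar>y\<bar> < b"
        "\<And>u::real. \<bar>u\<bar> \<ge> b \<Longrightarrow> \<bar>stieltjes Y' p' u\<bar> \<le> \<beta> \<and>
          stieltjes Y' p' u * (u - a - (\<Sum>x\<in>X. c x * (stieltjes Y p u / (1 - x * stieltjes Y p u)))) = 1"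
      then show ?thesis by (intro exI[of _ "(Y', p')"]) (simp add: inv_def step_def s)
    qed (use that X(1) x\<beta> \<beta> b in \<open>auto simp: inv_def s\<close>)
  qed
  ultimately obtain f where f: "\<And>n::nat. inv (f n)" "\<And>n. step (f n) (f (Suc n))"
    using dependent_nat_choice[of "\<lambda>_. inv" "\<lambda>_. step"] by blast
  define E where "E n = moment_fps (fst (f n)) (snd (f n))" for n
  have E0: "fps_nth (E n) 0 = 0" for n by (simp add: E_def moment_fps_def)
  have Es: "E (Suc n) * (1 - cumulant_tail a X c (E n)) = fps_X" for n
    unfolding E_def using f(1)[of n] f(1)[of "Suc n"] f(2)[of n]
    by (intro moment_fps_step[OF b0]) (auto simp: inv_def step_def)
  have F: "F \<in> Frat" using r by (auto simp: Frat_def)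
  define D where "D = comp_inverse F"
  have D0: "fps_nth D 0 = 0" unfolding D_def by (rule comp_inverse_is_inverse[OF F])
  have D: "D * (1 - cumulant_tail a X c D) = fps_X"
    unfolding D_def by (rule comp_inverse_cumulant[OF r X(1) R])
  have coeff: "s_coeff k F = (\<Sum>y\<in>fst (f n). snd (f n) y * y ^ k)" if "Suc k < n" for k n
  proof -
    have "fps_X ^ n dvd D - E n" using D0 D E0 Es by (rule moment_fps_approx)
    then obtain g where "D - E n = fps_X ^ n * g" by (rule dvdE)
    then have "fps_nth (D - E n) (Suc k) = 0" using that by (simp add: fps_X_power_mult_nth)
    then show ?thesis by (simp add: s_coeff_def D_def E_def moment_fps_def)
  qed
  have "s_coeff 0 F = 1"
  proof -
    have "fps_nth D 1 = fps_nth D 1 * fps_nth (1 - cumulant_tail a X c D) 0" by (simp add: cumulant_tail_def)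
    also have "\<dots> = fps_nth (D * (1 - cumulant_tail a X c D)) 1" using D0 by (simp add: fps_mult_nth)
    also have "\<dots> = 1" unfolding D by simp
    finally show ?thesis by (simp add: s_coeff_def D_def)
  qed
  \<comment> \<open>The invariant does not record total mass 1; it follows from the agreement of the
    zeroth moment, which is available from index 2 on. Hence the shift.\<close>
  then have one: "(\<Sum>y\<in>fst (f (n + 2)). snd (f (n + 2)) y) = 1" for n
    using coeff[of 0 "n + 2"] by simp
  show ?thesis
  proof (rule atomic_limit_moments[of "\<lambda>n. fst (f (n + 2))" "\<lambda>n. snd (f (n + 2))" b])
    fix k
    show "\<forall>\<^sub>F n in sequentially. (\<Sum>y\<in>fst (f (n + 2)). snd (f (n + 2)) y * y ^ k) = s_coeff k F"
      using eventually_ge_at_top[of k] by eventually_elim (rule coeff[symmetric], simp)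
  qed (use f(1) one in \<open>auto simp: inv_def\<close>)
qed

section \<open>The equivalence\<close>

lemma cumulant_fps_scale:
  "fps_const t * cumulant_fps a X c = cumulant_fps (t * a) X (\<lambda>x. t * c x)"
  unfolding cumulant_fps_def distrib_left sum_distrib_left fps_const_mult[symmetric] mult.assoc ..

lemma R_fps_scale:
  assumes "coeff P 0 = 1"
  shows "fps_of_poly (P + smult t (Q - P)) / fps_of_poly P - 1
    = fps_const t * (fps_of_poly Q / fps_of_poly P - (1 :: real fps))"
proof -
  have "fps_of_poly P * inverse (fps_of_poly P) = 1"
    using assms by (simp add: inverse_mult_eq_1')
  then show ?thesis
    using assms by (simp add: fps_divide_unit fps_of_poly_add fps_of_poly_smult fps_of_poly_diff
        left_diff_distrib distrib_right right_diff_distrib mult.assoc)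
qed

lemma boxplus_power_Frr0_iff:
  assumes r: "is_rep P Q F" and t: "t \<noteq> 0" and S: "S = P + smult t (Q - P)"
  shows "boxplus_power F t \<in> Frr0 \<longleftrightarrow>
    (\<forall>z. poly (cpoly ((P + [:0, 1:] * pderiv P) * S - [:0, 1:] * P * pderiv S)) z = 0 \<longrightarrow> z \<in> \<real>)"
proof -
  have r': "is_rep P S (boxplus_power F t)" unfolding S by (rule boxplus_power_rep[OF r t])
  then have "boxplus_power F t \<in> Frat" by (auto simp: Frat_def)
  then show ?thesis
    by (simp only: Frr0_def charpoly_rat_def Let_def rep_num_eq[OF r'] rep_den_eq[OF r'] mem_Collect_eq simp_thms)
qed

text \<open>The free power with exponent 1/n is again in Levy form, with \<open>a\<close> and the
  weights divided by n, so the existence of a measure for it provides the n-th root.\<close>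

lemma cumulant_form_imp_fid:
  assumes r: "is_rep P Q F" and X: "finite X" "\<And>x. x \<in> X \<Longrightarrow> c x > 0"
    and R: "fps_of_poly Q / fps_of_poly P - 1 = cumulant_fps a X c"
  shows "F \<in> Fdist_fid"
proof -
  have F: "F \<in> Frat" using r by (auto simp: Frat_def)
  then have dist: "F \<in> Fdist"
    using cumulant_form_imp_moments[OF r X R] by (simp add: Fdist_def)
  note mu = mu_of_moments[OF dist]
  have "\<exists>\<nu>. compact_distribution \<nu> \<and> free_conv_root n (mu_of F) \<nu>" if n: "n \<ge> 1" for n
  proof -
    define S where "S = P + smult (1 / real n) (Q - P)"
    have r': "is_rep P S (boxplus_power F (1 / real n))"
      unfolding S_def by (rule boxplus_power_rep[OF r]) (use n in simp)
    then have F': "boxplus_power F (1 / real n) \<in> Frat" by (auto simp: Frat_def)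
    have RS: "fps_of_poly S / fps_of_poly P - 1 = fps_const (1 / real n) * (fps_of_poly Q / fps_of_poly P - 1)"
      unfolding S_def by (rule R_fps_scale) (rule is_rep_coeff_0[OF r])
    then have "fps_of_poly S / fps_of_poly P - 1 = cumulant_fps (1 / real n * a) X (\<lambda>x. 1 / real n * c x)"
      unfolding R cumulant_fps_scale .
    then obtain \<nu> where \<nu>: "real_distribution \<nu>" "has_moments \<nu> (\<lambda>k. s_coeff k (boxplus_power F (1 / real n)))"
      using cumulant_form_imp_moments[OF r' X(1), of "\<lambda>x. 1 / real n * c x" "1 / real n * a"] X(2) n by auto
    have "of_nat n * free_R \<nu> = free_R (mu_of F)"
      unfolding free_R_moments[OF r' \<nu>(2)] free_R_moments[OF r mu(2)] RS
      using n by (simp flip: fps_of_nat mult.assoc)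
    then show ?thesis
      using moments_compact_distribution[OF F' \<nu>] by (auto simp: free_conv_root_def)
  qed
  then show ?thesis
    using dist moments_compact_distribution[OF F mu] by (simp add: Fdist_fid_def freely_infinitely_divisible_def)
qed

theorem theorem4p2:
  fixes F :: "real poly fract"
  assumes "F \<in> Frat"
  shows "F \<in> Fdist_fid \<longleftrightarrow>
    (\<exists>t0::real. t0 > 0 \<and> (\<forall>t\<in>{0<..<t0}. boxplus_power F t \<in> Frr0))"
proof -
  obtain P Q where r: "is_rep P Q F" using assms by (auto simp: Frat_def)
  then have PQ: "coprime P Q" "poly P 0 = 1" "poly Q 0 = 1" by (auto simp: is_rep_def)
  show ?thesis
  proof
    assume F: "F \<in> Fdist_fid"
    show "\<exists>t0>0. \<forall>t\<in>{0<..<t0}. boxplus_power F t \<in> Frr0"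
    proof (rule fid_imp_cumulant_form[OF r F])
      fix a X c
      assume form: "finite X" "\<And>x. x \<in> X \<Longrightarrow> c x > 0"
        "fps_of_poly Q / fps_of_poly P - 1 = cumulant_fps a X c"
      show ?thesis
      proof (rule cumulant_form_imp_real_rooted[OF PQ form])
        fix t0 :: real
        assume t0: "t0 > 0" "\<And>t z S. 0 < t \<Longrightarrow> t < t0 \<Longrightarrow> S = P + smult t (Q - P) \<Longrightarrow>
           poly (cpoly ((P + [:0, 1:] * pderiv P) * S - [:0, 1:] * P * pderiv S)) z = 0 \<Longrightarrow> z \<in> \<real>"
        have "boxplus_power F t \<in> Frr0" if "0 < t" "t < t0" for t
          unfolding boxplus_power_Frr0_iff[OF r less_imp_neq[OF that(1), symmetric] refl]
          by (intro allI impI, rule t0(2)[OF that refl])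
        then show ?thesis using t0(1) by auto
      qed
    qed
  next
    assume "\<exists>t0>0. \<forall>t\<in>{0<..<t0}. boxplus_power F t \<in> Frr0"
    then obtain t0 where t0: "t0 > 0" "\<And>t. 0 < t \<Longrightarrow> t < t0 \<Longrightarrow> boxplus_power F t \<in> Frr0" by auto
    have rr: "z \<in> \<real>" if t: "0 < t" "t < t0" and S: "S = P + smult t (Q - P)"
      and z: "poly (cpoly ((P + [:0, 1:] * pderiv P) * S - [:0, 1:] * P * pderiv S)) z = 0" for t z S
      by (rule t0(2)[OF t, unfolded boxplus_power_Frr0_iff[OF r less_imp_neq[OF t(1), symmetric] S],
            rule_format, OF z])
    show "F \<in> Fdist_fid"
    proof (rule real_rooted_imp_cumulant_form[OF PQ t0(1) rr])
      fix a X c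
      assume "finite X" "\<And>x. x \<in> X \<Longrightarrow> c x > 0"
        "fps_of_poly Q / fps_of_poly P - 1 = cumulant_fps a X c"
      then show ?thesis by (rule cumulant_form_imp_fid[OF r])
    qed
  qed
qed

end
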